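(* Let $\Psi$ be an $\mathcal A$-localized frame for $\mathcal H$ and $w$ an $\mathcal A$-admissible weight. Assume that the bounded linear operator $O:\mathcal H\to\mathcal H$ is invertible and that $\mathcal M_{(\Psi,\tilde\Psi)}(O)\in\mathcal A$. Then $O$ is invertible simultaneously on all coorbit spaces $\mathcal H^p_w$, $1\le p\le\infty$.
   Context: $\mathcal H$ is a separable Hilbert space and $K\subseteq\mathbb R^d$ a countable separated index set; sequences and matrices are indexed by $K$. $\ell^{00}$ denotes the finitely supported sequences. A weight is a sequence $w=(w_k)$ with $w_k>0$; $\ell^p_w=\{c:(w_kc_k)\in\ell^p\}$ with $\|c\|_{\ell^p_w}=\|(w_kc_k)\|_{\ell^p}$. A frame $\Psi=(\psi_k)_{k\in K}$ satisfies $A\|f\|^2\le\sum_k|\langle f,\psi_k\rangle|^2\le B\|f\|^2$ for all $f\in\mathcal H$ with some $A,B>0$; $C_\Psi f=(\langle f,\psi_k\rangle)_k$, $D_\Psi c=\sum_kc_k\psi_k$, $S_\Psi=D_\Psi C_\Psi$; the canonical dual frame is $\tilde\Psi=(\tilde\psi_k)$, $\tilde\psi_k=S_\Psi^{-1}\psi_k$. Cross-Gram matrix: $(G_{\Psi,\Phi})_{k,l}=\langle\phi_l,\psi_k\rangle$. $\mathcal A$ is a fixed solid spectral matrix algebra: a Banach $*$-algebra of matrices over $K$ such that (i) $\mathcal A\subseteq\mathcal B(\ell^2)$; (ii) $A\in\mathcal A$ invertible on $\ell^2$ implies $A^{-1}\in\mathcal A$; (iii) $A\in\mathcal A$ and $|b_{k,l}|\le|a_{k,l}|$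 for all $k,l$ imply $B=(b_{k,l})\in\mathcal A$ and $\|B\|_{\mathcal A}\le\|A\|_{\mathcal A}$. $\Psi$ is $\mathcal A$-localized if $G_{\Psi,\Psi}\in\mathcal A$ (it is known that then $G_{\Psi,\tilde\Psi},G_{\tilde\Psi,\tilde\Psi}\in\mathcal A$). A weight $w$ is $\mathcal A$-admissible if every $A\in\mathcal A$ defines a bounded operator on $\ell^p_w$ for all $1\le p\le\infty$. Coorbit spaces: $\mathcal H^{00}=\{\sum_kc_k\psi_k:c\in\ell^{00}\}$. For $1\le p<\infty$, $\mathcal H^p_w$ is the completion of $\mathcal H^{00}$ in the norm $\|f\|_{\mathcal H^p_w}=\|C_{\tilde\Psi}f\|_{\ell^p_w}$. $\mathcal H^\infty_w$ is the set of equivalence classes $f=[f_n]$ of sequences $f_n\in\mathcal H$ such that $\alpha_k=\lim_n\langle f_n,\tilde\psi_k\rangle$ exists for all $k$ and $\sup_n\|C_{\tilde\Psi}f_n\|_{\ell^\infty_w}<\infty$, where $(f_n)\sim(g_n)$ iff $\langle f_n-g_n,\tilde\psi_k\rangle\to0$ for all $k$; $C_{\tilde\Psi}f=\alpha$, $\|f\|_{\mathcal H^\infty_w}=\|\alpha\|_{\ell^\infty_w}$. $\mathcal M_{(\Psi,\tilde\Psi)}(O)$ is the matrix with entries $(\mathcal M_{(\Psi,\tilde\Psi)}(O))_{k,l}=\langle O\tilde\psi_l,\psi_k\rangle_{\mathcal H}$. "Invertible on $\mathcal H^p_w$" means that $O$ acts (by extension from $\mathcal H^{00}$, weak-$*$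 for $p=\infty$, namely as $D_{\tilde\Psi}\,\mathcal M_{(\Psi,\tilde\Psi)}(O)\,C_\Psi$) as a bounded bijection of $\mathcal H^p_w$ with bounded inverse (the corresponding extension of $O^{-1}$). Here for $f\in\mathcal H^p_w$ with coefficient sequence $C_{\tilde\Psi}f$ one sets $C_\Psi f=G_{\Psi,\Psi}C_{\tilde\Psi}f$, and the extension acts through $D_\Psi$ in place of $D_{\tilde\Psi}$ and $C_{\tilde\Psi}$ in place of $C_\Psi$ when the dual roles are used: precisely, $O=D_{\tilde\Psi}\circ\mathcal M_{(\Psi,\tilde\Psi)}(O)\circ C_{\Psi'}$ with $\Psi'=\Psi$ being the canonical dual of $\tilde\Psi$.
   Formalization: The matrix algebra is additionally assumed to contain the identity matrix; without any element invertible on ℓ², condition (ii) is vacuous and the claim can fail, while one such element already forces the identity to belong to the algebra. *)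

theory Defs
  imports "HOL-Analysis.Analysis"
begin

section \<open>Complex Hilbert spaces\<close>

text \<open>
  The inner product is linear in its first and conjugate-linear in its second argument.
  The real inner product of the superclass is the real part of the complex one, so that the
  norm is the usual Hilbert space norm.
\<close>

class complex_hilbert = real_inner + complete_space +
  fixes scaleC :: "complex \<Rightarrow> 'a \<Rightarrow> 'a"  (infixr \<open>*\<^sub>C\<close> 75)
    and cinner :: "'a \<Rightarrow> 'a \<Rightarrow> complex"
  assumes scaleC_add_right: "a *\<^sub>C (x + y) = a *\<^sub>C x + a *\<^sub>C y"
    and scaleC_add_left: "(a + b) *\<^sub>C x = a *\<^sub>C x + b *\<^sub>C x"
    and scaleC_scaleC: "a *\<^sub>C (b *\<^sub>C x) = (a * b) *\<^sub>C x"
    and scaleC_of_real: "complex_of_real r *\<^sub>C x = r *\<^sub>R x"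
    and cinner_commute: "cinner x y = cnj (cinner y x)"
    and cinner_add_left: "cinner (x + y) z = cinner x z + cinner y z"
    and cinner_scaleC_left: "cinner (a *\<^sub>C x) y = a * cinner x y"
    and Re_cinner: "Re (cinner x y) = inner x y"

subclass (in complex_hilbert) banach ..

definition separable_space_UNIV :: "'h::topological_space itself \<Rightarrow> bool" where
  "separable_space_UNIV _ \<longleftrightarrow> (\<exists>D::'h set. countable D \<and> closure D = UNIV)"

definition bounded_clinear :: "('h::complex_hilbert \<Rightarrow> 'h) \<Rightarrow> bool" where
  "bounded_clinear U \<longleftrightarrow> bounded_linear U \<and> (\<forall>a x. U (a *\<^sub>C x) = a *\<^sub>C U x)"

definition invertible_operator :: "('h::complex_hilbert \<Rightarrow> 'h) \<Rightarrow> bool" where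
  "invertible_operator U \<longleftrightarrow> bounded_clinear U \<and> bij U \<and> bounded_clinear (inv U)"


section \<open>Sequences and matrices over an index set\<close>

text \<open>
  Sequences and matrices over \<open>K\<close> are total functions that vanish off \<open>K\<close> and off
  \<open>K \<times> K\<close>, so that they are determined by their entries.
\<close>

type_synonym 'k cseq = "'k \<Rightarrow> complex"
type_synonym 'k cmat = "'k \<Rightarrow> 'k \<Rightarrow> complex"

definition separated_set :: "'k::metric_space set \<Rightarrow> bool" where
  "separated_set K \<longleftrightarrow> (\<exists>\<delta>>0. \<forall>x\<in>K. \<forall>y\<in>K. x \<noteq> y \<longrightarrow> \<delta> \<le> dist x y)"

definition weight :: "'k set \<Rightarrow> ('k \<Rightarrow> real) \<Rightarrow> bool" where
  "weight K w \<longleftrightarrow> (\<forall>k\<in>K. w k > 0)"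

definition l00 :: "'k set \<Rightarrow> 'k cseq set" where
  "l00 K = {c. finite {k. c k \<noteq> 0} \<and> {k. c k \<noteq> 0} \<subseteq> K}"

definition lp :: "'k set \<Rightarrow> ennreal \<Rightarrow> ('k \<Rightarrow> real) \<Rightarrow> 'k cseq set" where
  "lp K p w = {c. (\<forall>k. k \<notin> K \<longrightarrow> c k = 0) \<and>
     (if p = \<infinity> then bdd_above ((\<lambda>k. w k * cmod (c k)) ` K)
      else (\<lambda>k. (w k * cmod (c k)) powr enn2real p) summable_on K)}"

text \<open>Inserting \<open>0\<close> only matters for \<open>K = {}\<close>, where the real supremum is unspecified.\<close>

definition lp_norm :: "'k set \<Rightarrow> ennreal \<Rightarrow> ('k \<Rightarrow> real) \<Rightarrow> 'k cseq \<Rightarrow> real" where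
  "lp_norm K p w c =
     (if p = \<infinity> then Sup (insert 0 ((\<lambda>k. w k * cmod (c k)) ` K))
      else (\<Sum>\<^sub>\<infinity>k\<in>K. (w k * cmod (c k)) powr enn2real p) powr (1 / enn2real p))"

definition matrices :: "'k set \<Rightarrow> 'k cmat set" where
  "matrices K = {A. \<forall>k l. k \<notin> K \<or> l \<notin> K \<longrightarrow> A k l = 0}"

definition mat_id :: "'k set \<Rightarrow> 'k cmat" where
  "mat_id K = (\<lambda>k l. if k \<in> K \<and> k = l then 1 else 0)"

definition mat_mult :: "'k set \<Rightarrow> 'k cmat \<Rightarrow> 'k cmat \<Rightarrow> 'k cmat" where
  "mat_mult K A B = (\<lambda>k l. \<Sum>\<^sub>\<infinity>m\<in>K. A k m * B m l)"

definition mat_adj :: "'k cmat \<Rightarrow> 'k cmat" where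
  "mat_adj A = (\<lambda>k l. cnj (A l k))"

definition mat_vec :: "'k set \<Rightarrow> 'k cmat \<Rightarrow> 'k cseq \<Rightarrow> 'k cseq" where
  "mat_vec K A c = (\<lambda>k. \<Sum>\<^sub>\<infinity>l\<in>K. A k l * c l)"

text \<open>
  The summability clause is needed because \<open>infsum\<close> is \<open>0\<close> on families that are not summable.
\<close>

definition bounded_on_lp :: "'k set \<Rightarrow> ennreal \<Rightarrow> ('k \<Rightarrow> real) \<Rightarrow> 'k cmat \<Rightarrow> bool" where
  "bounded_on_lp K p w A \<longleftrightarrow>
     (\<forall>c\<in>lp K p w. (\<forall>k\<in>K. (\<lambda>l. A k l * c l) summable_on K) \<and> mat_vec K A c \<in> lp K p w) \<and>
     (\<exists>C. \<forall>c\<in>lp K p w. lp_norm K p w (mat_vec K A c) \<le> C * lp_norm K p w c)"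

definition B_l2 :: "'k set \<Rightarrow> 'k cmat set" where
  "B_l2 K = {A \<in> matrices K. bounded_on_lp K 2 (\<lambda>_. 1) A}"

definition inverse_on_l2 :: "'k set \<Rightarrow> 'k cmat \<Rightarrow> 'k cmat \<Rightarrow> bool" where
  "inverse_on_l2 K A B \<longleftrightarrow> B \<in> B_l2 K \<and>
     (\<forall>c\<in>lp K 2 (\<lambda>_. 1). mat_vec K A (mat_vec K B c) = c \<and> mat_vec K B (mat_vec K A c) = c)"


section \<open>Solid spectral matrix algebras\<close>

text \<open>
  The laws of an algebra with involution hold for the matrix operations and are not listed.
  The involution is not required to be isometric. Inverse-closedness refers to the identity
  of \<open>\<B>(\<ell>\<^sup>2)\<close>, which therefore has to lie in the algebra.
\<close>

locale banach_star_matrix_algebra =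
  fixes K :: "'k set" and \<A> :: "'k cmat set" and N :: "'k cmat \<Rightarrow> real"
  assumes subset_matrices: "\<A> \<subseteq> matrices K"
    and id_mem: "mat_id K \<in> \<A>"
    and add_mem: "\<lbrakk>A \<in> \<A>; B \<in> \<A>\<rbrakk> \<Longrightarrow> (\<lambda>k l. A k l + B k l) \<in> \<A>"
    and scale_mem: "A \<in> \<A> \<Longrightarrow> (\<lambda>k l. a * A k l) \<in> \<A>"
    and mult_mem: "\<lbrakk>A \<in> \<A>; B \<in> \<A>\<rbrakk> \<Longrightarrow> mat_mult K A B \<in> \<A>"
    and adj_mem: "A \<in> \<A> \<Longrightarrow> mat_adj A \<in> \<A>"
    and norm_eq_0_iff: "A \<in> \<A> \<Longrightarrow> N A = 0 \<longleftrightarrow> A = (\<lambda>k l. 0)"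
    and norm_triangle: "\<lbrakk>A \<in> \<A>; B \<in> \<A>\<rbrakk> \<Longrightarrow> N (\<lambda>k l. A k l + B k l) \<le> N A + N B"
    and norm_scale: "A \<in> \<A> \<Longrightarrow> N (\<lambda>k l. a * A k l) = cmod a * N A"
    and norm_mult: "\<lbrakk>A \<in> \<A>; B \<in> \<A>\<rbrakk> \<Longrightarrow> N (mat_mult K A B) \<le> N A * N B"
    and complete:
      "\<lbrakk>\<And>n::nat. X n \<in> \<A>;
        \<And>e. e > 0 \<Longrightarrow> \<exists>M. \<forall>m\<ge>M. \<forall>n\<ge>M. N (\<lambda>k l. X m k l - X n k l) < e\<rbrakk>
       \<Longrightarrow> \<exists>A\<in>\<A>. (\<lambda>n. N (\<lambda>k l. X n k l - A k l)) \<longlonglongrightarrow> 0"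

locale solid_spectral_matrix_algebra = banach_star_matrix_algebra +
  assumes subset_B_l2: "\<A> \<subseteq> B_l2 K"
    and inverse_closed: "\<lbrakk>A \<in> \<A>; inverse_on_l2 K A B\<rbrakk> \<Longrightarrow> B \<in> \<A>"
    and solid: "\<lbrakk>A \<in> \<A>; B \<in> matrices K; \<And>k l. cmod (B k l) \<le> cmod (A k l)\<rbrakk>
                 \<Longrightarrow> B \<in> \<A> \<and> N B \<le> N A"

definition admissible :: "'k set \<Rightarrow> 'k cmat set \<Rightarrow> ('k \<Rightarrow> real) \<Rightarrow> bool" where
  "admissible K \<A> w \<longleftrightarrow> (\<forall>A\<in>\<A>. \<forall>p\<ge>1. bounded_on_lp K p w A)"


section \<open>Frames\<close>

definition is_frame :: "'k set \<Rightarrow> ('k \<Rightarrow> 'h::complex_hilbert) \<Rightarrow> bool" where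
  "is_frame K \<psi> \<longleftrightarrow> (\<exists>A>0. \<exists>B>0. \<forall>f.
     (\<lambda>k. (cmod (cinner f (\<psi> k)))\<^sup>2) summable_on K \<and>
     A * (norm f)\<^sup>2 \<le> (\<Sum>\<^sub>\<infinity>k\<in>K. (cmod (cinner f (\<psi> k)))\<^sup>2) \<and>
     (\<Sum>\<^sub>\<infinity>k\<in>K. (cmod (cinner f (\<psi> k)))\<^sup>2) \<le> B * (norm f)\<^sup>2)"

definition analysis :: "'k set \<Rightarrow> ('k \<Rightarrow> 'h::complex_hilbert) \<Rightarrow> 'h \<Rightarrow> 'k cseq" where
  "analysis K \<psi> f = (\<lambda>k. if k \<in> K then cinner f (\<psi> k) else 0)"

definition synthesis :: "'k set \<Rightarrow> ('k \<Rightarrow> 'h::complex_hilbert) \<Rightarrow> 'k cseq \<Rightarrow> 'h" where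
  "synthesis K \<psi> c = (\<Sum>\<^sub>\<infinity>k\<in>K. c k *\<^sub>C \<psi> k)"

definition frame_operator :: "'k set \<Rightarrow> ('k \<Rightarrow> 'h::complex_hilbert) \<Rightarrow> 'h \<Rightarrow> 'h" where
  "frame_operator K \<psi> f = synthesis K \<psi> (analysis K \<psi> f)"

definition dual_frame :: "'k set \<Rightarrow> ('k \<Rightarrow> 'h::complex_hilbert) \<Rightarrow> 'k \<Rightarrow> 'h" where
  "dual_frame K \<psi> k = inv (frame_operator K \<psi>) (\<psi> k)"

definition op_matrix ::
    "'k set \<Rightarrow> ('k \<Rightarrow> 'h::complex_hilbert) \<Rightarrow> ('k \<Rightarrow> 'h) \<Rightarrow> ('h \<Rightarrow> 'h) \<Rightarrow> 'k cmat" where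
  "op_matrix K \<psi> \<phi> U = (\<lambda>k l. if k \<in> K \<and> l \<in> K then cinner (U (\<phi> l)) (\<psi> k) else 0)"

definition cross_gram ::
    "'k set \<Rightarrow> ('k \<Rightarrow> 'h::complex_hilbert) \<Rightarrow> ('k \<Rightarrow> 'h) \<Rightarrow> 'k cmat" where
  "cross_gram K \<psi> \<phi> = (\<lambda>k l. if k \<in> K \<and> l \<in> K then cinner (\<phi> l) (\<psi> k) else 0)"

definition localized :: "'k set \<Rightarrow> 'k cmat set \<Rightarrow> ('k \<Rightarrow> 'h::complex_hilbert) \<Rightarrow> bool" where
  "localized K \<A> \<psi> \<longleftrightarrow> cross_gram K \<psi> \<psi> \<in> \<A>"


section \<open>Coorbit spaces\<close>

definition H00 :: "'k set \<Rightarrow> ('k \<Rightarrow> 'h::complex_hilbert) \<Rightarrow> 'h set" where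
  "H00 K \<psi> = synthesis K \<psi> ` l00 K"

definition dual_coef :: "'k set \<Rightarrow> ('k \<Rightarrow> 'h::complex_hilbert) \<Rightarrow> 'h \<Rightarrow> 'k cseq" where
  "dual_coef K \<psi> f = analysis K (dual_frame K \<psi>) f"

definition pre_norm ::
    "'k set \<Rightarrow> ('k \<Rightarrow> 'h::complex_hilbert) \<Rightarrow> ennreal \<Rightarrow> ('k \<Rightarrow> real) \<Rightarrow> 'h \<Rightarrow> real" where
  "pre_norm K \<psi> p w f = lp_norm K p w (dual_coef K \<psi> f)"

text \<open>
  An element of a coorbit space is an equivalence class of sequences in \<open>\<H>\<close>. For \<open>p < \<infinity>\<close>
  this is the completion of \<open>H00\<close> by Cauchy sequences modulo null sequences.
\<close>

type_synonym 'h coorb = "(nat \<Rightarrow> 'h) set"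

definition coorbit_seqs ::
    "'k set \<Rightarrow> ('k \<Rightarrow> 'h::complex_hilbert) \<Rightarrow> ennreal \<Rightarrow> ('k \<Rightarrow> real) \<Rightarrow> (nat \<Rightarrow> 'h) set" where
  "coorbit_seqs K \<psi> p w =
     (if p = \<infinity> then
        {f. (\<forall>k\<in>K. convergent (\<lambda>n. dual_coef K \<psi> (f n) k)) \<and>
            (\<forall>n. dual_coef K \<psi> (f n) \<in> lp K \<infinity> w) \<and>
            bdd_above (range (\<lambda>n. lp_norm K \<infinity> w (dual_coef K \<psi> (f n))))}
      else
        {f. (\<forall>n. f n \<in> H00 K \<psi>) \<and>
            (\<forall>e>0. \<exists>M. \<forall>m\<ge>M. \<forall>n\<ge>M. pre_norm K \<psi> p w (f m - f n) < e)})"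

definition coorbit_rel ::
    "'k set \<Rightarrow> ('k \<Rightarrow> 'h::complex_hilbert) \<Rightarrow> ennreal \<Rightarrow> ('k \<Rightarrow> real)
      \<Rightarrow> ((nat \<Rightarrow> 'h) \<times> (nat \<Rightarrow> 'h)) set" where
  "coorbit_rel K \<psi> p w =
     {(f, g). f \<in> coorbit_seqs K \<psi> p w \<and> g \<in> coorbit_seqs K \<psi> p w \<and>
        (if p = \<infinity> then \<forall>k\<in>K. (\<lambda>n. dual_coef K \<psi> (f n - g n) k) \<longlonglongrightarrow> 0
         else (\<lambda>n. pre_norm K \<psi> p w (f n - g n)) \<longlonglongrightarrow> 0)}"

definition coorbit ::
    "'k set \<Rightarrow> ('k \<Rightarrow> 'h::complex_hilbert) \<Rightarrow> ennreal \<Rightarrow> ('k \<Rightarrow> real) \<Rightarrow> 'h coorb set" where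
  "coorbit K \<psi> p w = coorbit_seqs K \<psi> p w // coorbit_rel K \<psi> p w"

definition coorbit_add ::
    "'k set \<Rightarrow> ('k \<Rightarrow> 'h::complex_hilbert) \<Rightarrow> ennreal \<Rightarrow> ('k \<Rightarrow> real)
      \<Rightarrow> 'h coorb \<Rightarrow> 'h coorb \<Rightarrow> 'h coorb" where
  "coorbit_add K \<psi> p w F G = coorbit_rel K \<psi> p w `` {\<lambda>n. f n + g n | f g. f \<in> F \<and> g \<in> G}"

definition coorbit_scale ::
    "'k set \<Rightarrow> ('k \<Rightarrow> 'h::complex_hilbert) \<Rightarrow> ennreal \<Rightarrow> ('k \<Rightarrow> real)
      \<Rightarrow> complex \<Rightarrow> 'h coorb \<Rightarrow> 'h coorb" where
  "coorbit_scale K \<psi> p w a F = coorbit_rel K \<psi> p w `` {\<lambda>n. a *\<^sub>C f n | f. f \<in> F}"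

definition coorbit_coef ::
    "'k set \<Rightarrow> ('k \<Rightarrow> 'h::complex_hilbert) \<Rightarrow> 'h coorb \<Rightarrow> 'k cseq" where
  "coorbit_coef K \<psi> F = (\<lambda>k. THE a. \<forall>f\<in>F. (\<lambda>n. dual_coef K \<psi> (f n) k) \<longlonglongrightarrow> a)"

definition coorbit_norm ::
    "'k set \<Rightarrow> ('k \<Rightarrow> 'h::complex_hilbert) \<Rightarrow> ennreal \<Rightarrow> ('k \<Rightarrow> real) \<Rightarrow> 'h coorb \<Rightarrow> real" where
  "coorbit_norm K \<psi> p w F =
     (if p = \<infinity> then lp_norm K \<infinity> w (coorbit_coef K \<psi> F)
      else THE r. \<forall>f\<in>F. (\<lambda>n. pre_norm K \<psi> p w (f n)) \<longlonglongrightarrow> r)"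

text \<open>
  The element of the coorbit space given by a vector \<open>g\<close> of \<open>\<H>\<close> with dual coefficients in
  \<open>\<ell>\<^sup>p\<^sub>w\<close>. For \<open>p < \<infinity>\<close> the vector need not lie in \<open>H00\<close> (this happens already for the dual
  frame vectors), so one takes the class of all sequences in \<open>H00\<close> that converge to \<open>g\<close> in
  the coorbit norm.
\<close>

definition coorbit_embed ::
    "'k set \<Rightarrow> ('k \<Rightarrow> 'h::complex_hilbert) \<Rightarrow> ennreal \<Rightarrow> ('k \<Rightarrow> real) \<Rightarrow> 'h \<Rightarrow> 'h coorb" where
  "coorbit_embed K \<psi> p w g =
     (if p = \<infinity> then coorbit_rel K \<psi> p w `` {\<lambda>n. g}
      else {f. (\<forall>n. f n \<in> H00 K \<psi> \<and> dual_coef K \<psi> (f n - g) \<in> lp K p w) \<and>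
               (\<lambda>n. pre_norm K \<psi> p w (f n - g)) \<longlonglongrightarrow> 0})"

text \<open>
  \<open>has_dual_synthesis K \<psi> p w c X\<close> says that the series with terms \<open>c k *\<^sub>C dual_frame K \<psi> k\<close>
  has the sum \<open>X\<close> in the coorbit space: unconditionally in norm for \<open>p < \<infinity>\<close>, and
  weak-* (coefficientwise against the dual frame) for \<open>p = \<infinity>\<close>.
\<close>

definition has_dual_synthesis ::
    "'k set \<Rightarrow> ('k \<Rightarrow> 'h::complex_hilbert) \<Rightarrow> ennreal \<Rightarrow> ('k \<Rightarrow> real)
      \<Rightarrow> 'k cseq \<Rightarrow> 'h coorb \<Rightarrow> bool" where
  "has_dual_synthesis K \<psi> p w c X \<longleftrightarrow>
     (let S = (\<lambda>J. coorbit_embed K \<psi> p w (\<Sum>k\<in>J. c k *\<^sub>C dual_frame K \<psi> k)) in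
      X \<in> coorbit K \<psi> p w \<and>
      (\<forall>J. finite J \<and> J \<subseteq> K \<longrightarrow> S J \<in> coorbit K \<psi> p w) \<and>
      (if p = \<infinity> then
         \<forall>l\<in>K. ((\<lambda>J. coorbit_coef K \<psi> (S J) l) \<longlongrightarrow> coorbit_coef K \<psi> X l)
                  (finite_subsets_at_top K)
       else
         ((\<lambda>J. coorbit_norm K \<psi> p w
                 (coorbit_add K \<psi> p w (S J) (coorbit_scale K \<psi> p w (-1) X))) \<longlongrightarrow> 0)
           (finite_subsets_at_top K)))"

definition coorbit_bounded_linear ::
    "'k set \<Rightarrow> ('k \<Rightarrow> 'h::complex_hilbert) \<Rightarrow> ennreal \<Rightarrow> ('k \<Rightarrow> real)
      \<Rightarrow> ('h coorb \<Rightarrow> 'h coorb) \<Rightarrow> bool" where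
  "coorbit_bounded_linear K \<psi> p w T \<longleftrightarrow>
     (\<forall>X\<in>coorbit K \<psi> p w. T X \<in> coorbit K \<psi> p w) \<and>
     (\<forall>X\<in>coorbit K \<psi> p w. \<forall>Y\<in>coorbit K \<psi> p w.
        T (coorbit_add K \<psi> p w X Y) = coorbit_add K \<psi> p w (T X) (T Y)) \<and>
     (\<forall>a. \<forall>X\<in>coorbit K \<psi> p w.
        T (coorbit_scale K \<psi> p w a X) = coorbit_scale K \<psi> p w a (T X)) \<and>
     (\<exists>C. \<forall>X\<in>coorbit K \<psi> p w. coorbit_norm K \<psi> p w (T X) \<le> C * coorbit_norm K \<psi> p w X)"

text \<open>
  \<open>T\<close> is the extension of \<open>U\<close> to the coorbit space: a bounded linear map that agrees with \<open>U\<close>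
  on \<open>H00\<close> and maps \<open>X\<close> to the dual synthesis of \<open>M (G \<alpha>)\<close>, where \<open>M\<close> is the matrix of \<open>U\<close>,
  \<open>\<alpha>\<close> is the sequence of dual coefficients of \<open>X\<close>, and \<open>G \<alpha>\<close> (with \<open>G\<close> the Gram matrix) is the
  sequence of coefficients of \<open>X\<close> with respect to \<open>\<psi>\<close>.
\<close>

definition coorbit_extension ::
    "'k set \<Rightarrow> ('k \<Rightarrow> 'h::complex_hilbert) \<Rightarrow> ennreal \<Rightarrow> ('k \<Rightarrow> real)
      \<Rightarrow> ('h \<Rightarrow> 'h) \<Rightarrow> ('h coorb \<Rightarrow> 'h coorb) \<Rightarrow> bool" where
  "coorbit_extension K \<psi> p w U T \<longleftrightarrow>
     (let G = cross_gram K \<psi> \<psi>; M = op_matrix K \<psi> (dual_frame K \<psi>) U in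
      coorbit_bounded_linear K \<psi> p w T \<and>
      (\<forall>f\<in>H00 K \<psi>. T (coorbit_embed K \<psi> p w f) = coorbit_embed K \<psi> p w (U f)) \<and>
      bounded_on_lp K p w G \<and> bounded_on_lp K p w M \<and>
      (\<forall>X\<in>coorbit K \<psi> p w. coorbit_coef K \<psi> X \<in> lp K p w \<and>
         has_dual_synthesis K \<psi> p w (mat_vec K M (mat_vec K G (coorbit_coef K \<psi> X))) (T X)))"

definition invertible_on_coorbit ::
    "'k set \<Rightarrow> ('k \<Rightarrow> 'h::complex_hilbert) \<Rightarrow> ennreal \<Rightarrow> ('k \<Rightarrow> real) \<Rightarrow> ('h \<Rightarrow> 'h) \<Rightarrow> bool" where
  "invertible_on_coorbit K \<psi> p w U \<longleftrightarrow>
     (\<exists>T T'. coorbit_extension K \<psi> p w U T \<and> coorbit_extension K \<psi> p w (inv U) T' \<and>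
        bij_betw T (coorbit K \<psi> p w) (coorbit K \<psi> p w) \<and>
        (\<forall>X\<in>coorbit K \<psi> p w. T' (T X) = X))"

end

(*
  Write M(R) for the matrix of an operator R, with entries <R phi_l, psi_k> where phi is the dual
  frame. By the reconstruction formula M(R) M(T) = M(R T), and M(S) is the Gram matrix. The main
  point is that the projection M(1) lies in the algebra A. Let W be a multiple of the inverse of S
  with norm at most 1/2. For |u| = 1 the matrix F_0(u) = M((1 - u W)^-1) is in A by spectral
  invariance, and the map F_0 is Lipschitz for the norm of A by the resolvent identity and
  compactness of the circle. Put F_j(u) = M((1 - u W^(2^j))^-1). From
  F_(j+1)(u^2) = (F_j(u) + F_j(-u)) / 2 the Lipschitz constants decay geometrically, so F_j(1)
  is a Cauchy sequence in A. Its entries converge to those of M(1). If M(R) is in A and R is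
  invertible, then 1 - M(1) + M(R) is in A and has the inverse 1 - M(1) + M(inv R) on l^2, so
  M(inv R) is in A by spectral invariance.

  The dual coefficients identify the coorbit space isometrically with the sequences in l^p_w
  that are fixed by M(1). Under this identification the extension of U acts as
  M(inv S o U o S), and the inverse matrix M(inv S o inv U o S) is again in A.
*)
theory Submission
  imports Defs
begin

section \<open>Operators on complex Hilbert spaces\<close>

text \<open>Spectral invariance speaks of matrices that are invertible on all of l^2, but
  \<open>M(R)\<close> vanishes on the kernel of dual synthesis, so for a redundant frame it is never
  invertible there. Therefore everything is phrased through \<open>1 - M(R)\<close>, which is the
  identity on that kernel and has the inverse \<open>1 - M(T)\<close> whenever R T = T R = R + T.
  After scaling, the spectrum of the Gram matrix lies in 0 together with numbers of modulus at least
  2, and \<open>M(1)\<close> is the spectral projection for the second part. Classically it is a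
  Riesz integral of the resolvent over the unit circle. \<open>F_j(1)\<close> is the mean of
  \<open>F_0\<close> over the 2^j-th roots of unity, a Riemann sum for that integral; doubling the
  number of nodes turns integration in the algebra into a Cauchy sequence for \<open>N\<close>.
  Spectral invariance is qualitative and bounds no inverse in the norm of the algebra. This is why
  the Lipschitz estimate rests on an identity between resolvents alone.\<close>

lemma cinner_scaleC_right: "cinner x (a *\<^sub>C y) = cnj a * cinner x y"
  for x :: "'h::complex_hilbert"
  by (metis cinner_commute cinner_scaleC_left complex_cnj_mult)

lemma norm_scaleC: "norm (a *\<^sub>C x) = cmod a * norm x"
  for x :: "'h::complex_hilbert"
proof -
  have "cinner (a *\<^sub>C x) (a *\<^sub>C x) = of_real ((cmod a)\<^sup>2) * cinner x x"
    by (simp only: cinner_scaleC_left cinner_scaleC_right complex_norm_square mult.assoc mult.left_commute)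
  then have "inner (a *\<^sub>C x) (a *\<^sub>C x) = (cmod a)\<^sup>2 * inner x x"
    by (simp flip: Re_cinner)
  then have "(norm (a *\<^sub>C x))\<^sup>2 = (cmod a * norm x)\<^sup>2"
    by (simp add: power2_norm_eq_inner power_mult_distrib)
  then show ?thesis
    by (simp add: power2_eq_iff_nonneg)
qed

lemma norm_cinner_le: "cmod (cinner x y) \<le> norm x * norm y"
  for x :: "'h::complex_hilbert"
proof (cases "cinner x y = 0")
  case False
  \<comment> \<open>The unimodular \<open>a\<close> rotates the inner product onto the positive real
    axis, where it equals its real part and the real Cauchy-Schwarz inequality applies.\<close>
  define a where "a = cnj (cinner x y) / of_real (cmod (cinner x y))"
  have a: "cmod a = 1" "a * cinner x y = of_real (cmod (cinner x y))"
    using False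
    using complex_norm_square[of "cinner x y"]
    by (auto simp: a_def norm_divide divide_simps power2_eq_square mult.commute)
  have "cmod (cinner x y) = Re (cinner (a *\<^sub>C x) y)"
    by (simp add: cinner_scaleC_left a)
  also have "\<dots> \<le> norm (a *\<^sub>C x) * norm y"
    by (simp add: Re_cinner norm_cauchy_schwarz)
  finally show ?thesis
    by (simp add: norm_scaleC a)
qed simp

lemma scaleC_scaleR: "a *\<^sub>C (r *\<^sub>R x) = r *\<^sub>R (a *\<^sub>C x)"
  for x :: "'h::complex_hilbert"
  by (metis scaleC_of_real scaleC_scaleC mult.commute)

lemma bounded_linear_cinner_left: "bounded_linear (\<lambda>x. cinner x y)"
  for y :: "'h::complex_hilbert"
proof (rule bounded_linear_intro[where K="norm y"])
  show "cinner (r *\<^sub>R x) y = r *\<^sub>R cinner x y" for r x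
    by (metis cinner_scaleC_left scaleC_of_real scaleR_conv_of_real)
qed (simp_all add: cinner_add_left norm_cinner_le)

lemma bounded_linear_scaleC_right: "bounded_linear (\<lambda>x::'h::complex_hilbert. a *\<^sub>C x)"
  by (rule bounded_linear_intro[where K="cmod a"])
    (simp_all add: scaleC_add_right scaleC_scaleR norm_scaleC mult.commute)

lemma cinner_diff_left: "cinner (x - y) z = cinner x z - cinner y z"
  for x :: "'h::complex_hilbert"
  using bounded_linear_cinner_left by (rule linear_diff[OF bounded_linear.linear])

lemma cinner_zero_left [simp]: "cinner 0 x = 0"
  for x :: "'h::complex_hilbert"
  using bounded_linear_cinner_left by (rule linear_0[OF bounded_linear.linear])

lemma scaleC_diff_right: "a *\<^sub>C (x - y) = a *\<^sub>C x - a *\<^sub>C y"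
  for x :: "'h::complex_hilbert"
  using bounded_linear_scaleC_right by (rule linear_diff[OF bounded_linear.linear])

lemma scaleC_zero_right [simp]: "a *\<^sub>C (0::'h::complex_hilbert) = 0"
  using bounded_linear_scaleC_right by (rule linear_0[OF bounded_linear.linear])

lemma scaleC_one [simp]: "1 *\<^sub>C (x::'h::complex_hilbert) = x"
  using scaleC_of_real[of 1 x] by simp

lemma scaleC_zero_left [simp]: "0 *\<^sub>C (x::'h::complex_hilbert) = 0"
  using scaleC_of_real[of 0 x] by simp

lemma scaleC_minus1: "(-1) *\<^sub>C (x::'h::complex_hilbert) = - x"
  using scaleC_of_real[of "-1" x] by simp

lemma scaleC_minus_left: "(- a) *\<^sub>C x = - (a *\<^sub>C x)"
  for x :: "'h::complex_hilbert"
  using scaleC_scaleC[of "-1" a x] by (simp add: scaleC_minus1)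

lemma scaleC_diff_left: "(a - b) *\<^sub>C x = a *\<^sub>C x - b *\<^sub>C x"
  for x :: "'h::complex_hilbert"
  using scaleC_add_left[of a "-b" x] by (simp add: scaleC_minus_left)

lemma cinner_eqI: "(\<And>z. cinner x z = cinner y z) \<Longrightarrow> x = y"
  for x :: "'h::complex_hilbert"
proof -
  assume *: "\<And>z. cinner x z = cinner y z"
  have "cinner (x - y) (x - y) = 0"
    by (simp add: cinner_diff_left *)
  then have "inner (x - y) (x - y) = 0"
    by (metis Re_cinner zero_complex.simps(1))
  then show ?thesis
    by simp
qed

lemma bounded_clinearD:
  assumes "bounded_clinear R"
  shows "bounded_linear R" "R (a *\<^sub>C x) = a *\<^sub>C R x" "R (x + y) = R x + R y" "R (x - y) = R x - R y"
    "R 0 = 0"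
  using assms unfolding bounded_clinear_def
  by (auto simp: bounded_linear.linear linear_add linear_diff linear_0)

lemma bounded_clinear_id: "bounded_clinear (\<lambda>x. x)"
  by (simp add: bounded_clinear_def bounded_linear_ident)

lemma bounded_clinear_comp:
  "bounded_clinear R \<Longrightarrow> bounded_clinear T \<Longrightarrow> bounded_clinear (\<lambda>x. R (T x))"
  by (simp add: bounded_clinear_def bounded_linear_compose)

lemma bounded_clinear_diff:
  "bounded_clinear R \<Longrightarrow> bounded_clinear T \<Longrightarrow> bounded_clinear (\<lambda>x. R x - T x)"
  by (simp add: bounded_clinear_def bounded_linear_sub scaleC_diff_right)

lemma bounded_clinear_scaleC: "bounded_clinear R \<Longrightarrow> bounded_clinear (\<lambda>x. a *\<^sub>C R x)"
  by (auto simp: bounded_clinear_def scaleC_scaleC mult.commute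
      intro: bounded_linear_compose[OF bounded_linear_scaleC_right])

text \<open>The lower bound controls the inverse directly, without the open mapping theorem, and
  yields the explicit constant \<open>1 / c\<close> that the resolvent estimates use.\<close>

lemma invertible_operatorI:
  assumes R: "bounded_clinear R" and "bij R" and c: "c > 0" "\<And>x. c * norm x \<le> norm (R x)"
  shows "invertible_operator R" "norm (inv R x) \<le> norm x / c"
proof -
  note RR = surj_f_inv_f[OF bij_is_surj[OF \<open>bij R\<close>]]
  have invI: "inv R x = y" if "R y = x" for x y
    using that bij_inv_eq_iff[OF \<open>bij R\<close>] by metis
  note R' = bounded_clinearD[OF R]
  have *: "norm (inv R x) \<le> norm x * (1 / c)" for x
    using c(2)[of "inv R x"] c(1) by (simp add: field_simps RR)
  have "bounded_linear (inv R)"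
  proof (rule bounded_linear_intro[OF _ _ *])
    show "inv R (x + y) = inv R x + inv R y" for x y
      by (rule invI) (simp add: R' RR)
    show "inv R (r *\<^sub>R x) = r *\<^sub>R inv R x" for r x
      by (rule invI) (simp add: R' RR flip: scaleC_of_real)
  qed
  moreover have "inv R (a *\<^sub>C x) = a *\<^sub>C inv R x" for a x
    by (rule invI) (simp add: R' RR)
  ultimately have "bounded_clinear (inv R)"
    by (simp add: bounded_clinear_def)
  then show "invertible_operator R"
    using R \<open>bij R\<close> by (simp add: invertible_operator_def)
  show "norm (inv R x) \<le> norm x / c"
    using * by simp
qed

lemma invertible_operatorD:
  assumes "invertible_operator R"
  shows "bounded_clinear R" "bounded_clinear (inv R)" "R (inv R x) = x" "inv R (R x) = x"
  using assms unfolding invertible_operator_def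
  by (simp_all add: bij_is_surj surj_f_inv_f bij_is_inj)

text \<open>A Neumann series in disguise: solving \<open>x - R x = y\<close> means finding the fixed
  point of the contraction that sends \<open>x\<close> to \<open>R x + y\<close>.\<close>

lemma contraction_invertible:
  fixes R :: "'h::complex_hilbert \<Rightarrow> 'h"
  assumes R: "bounded_clinear R" and q: "0 \<le> q" "q < 1" and le: "\<And>x. norm (R x) \<le> q * norm x"
  shows "invertible_operator (\<lambda>x. x - R x)"
    and "norm (inv (\<lambda>x. x - R x) x) \<le> norm x / (1 - q)"
proof -
  have low: "(1 - q) * norm x \<le> norm (x - R x)" for x
    using le[of x] norm_triangle_ineq2[of x "R x"] by (simp add: algebra_simps)
  have "\<exists>!x. x - R x = y" for y
  proof -
    have "\<exists>!x. R x + y = x"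
      using q by (rule banach_fix_type) (auto simp: dist_norm le simp flip: bounded_clinearD(4)[OF R])
    then show ?thesis
      by (metis add_diff_cancel_left' diff_add_cancel add.commute)
  qed
  then have "bij (\<lambda>x. x - R x)"
    by (simp add: bij_iff)
  then show "invertible_operator (\<lambda>x. x - R x)" "norm (inv (\<lambda>x. x - R x) x) \<le> norm x / (1 - q)"
    using invertible_operatorI[OF bounded_clinear_diff[OF bounded_clinear_id R], of "1 - q"] low q
    by auto
qed

section \<open>Frames and operator matrices\<close>

text \<open>Cauchy criterion for unordered sums. Frame expansions converge unconditionally but in
  general not absolutely, so a comparison of norms would not do.\<close>

lemma summable_on_small_tailsI:
  fixes f :: "'a \<Rightarrow> 'b::banach"
  assumes "\<And>e. e > 0 \<Longrightarrow>
    \<exists>E. finite E \<and> E \<subseteq> A \<and> (\<forall>F. finite F \<and> F \<subseteq> A - E \<longrightarrow> norm (sum f F) < e)"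
  shows "f summable_on A"
proof -
  have "\<exists>P. eventually P (finite_subsets_at_top A) \<and>
              (\<forall>F F'. P F \<and> P F' \<longrightarrow> dist (sum f F) (sum f F') < e)" if "e > 0" for e
  proof -
    obtain E where E: "finite E" "E \<subseteq> A"
      "\<And>F. finite F \<Longrightarrow> F \<subseteq> A - E \<Longrightarrow> norm (sum f F) < e/2"
      using assms[of "e/2"] \<open>e > 0\<close> by auto
    define P where "P F \<longleftrightarrow> finite F \<and> E \<subseteq> F \<and> F \<subseteq> A" for F
    have *: "dist (sum f F) (sum f E) < e/2" if "P F" for F
      using that E(3)[of "F - E"] E(1) unfolding P_def
      by (simp add: dist_norm sum_diff Diff_mono)
    have "eventually P (finite_subsets_at_top A)"
      unfolding P_def eventually_finite_subsets_at_top using E(1,2) by blast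
    then show ?thesis
      by (intro exI[of _ P] conjI) (auto intro: dist_triangle_half_l *)
  qed
  then have "cauchy_filter (filtermap (sum f) (finite_subsets_at_top A))"
    by (simp add: cauchy_filter_metric_filtermap)
  moreover have "complete (UNIV::'b set)"
    by (rule complete_UNIV)
  ultimately obtain L where "(sum f \<longlongrightarrow> L) (finite_subsets_at_top A)"
    using complete_uniform[where S=UNIV] by (force simp add: filterlim_def)
  then show ?thesis
    using summable_on_def has_sum_def by blast
qed

lemma lp2_iff: "c \<in> lp K 2 (\<lambda>_. 1) \<longleftrightarrow>
    (\<forall>k. k \<notin> K \<longrightarrow> c k = 0) \<and> (\<lambda>k. (cmod (c k))\<^sup>2) summable_on K"
  by (simp add: lp_def powr_numeral)

lemma lp2_norm: "lp_norm K 2 (\<lambda>_. 1) c = sqrt (\<Sum>\<^sub>\<infinity>k\<in>K. (cmod (c k))\<^sup>2)"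
  by (simp add: lp_norm_def powr_numeral powr_half_sqrt infsum_nonneg)

section \<open>Frame bounds, the frame operator, and operator matrices on l^2\<close>

locale hilbert_frame =
  fixes K :: "'k set" and \<psi> :: "'k \<Rightarrow> 'h::complex_hilbert"
  assumes frame: "is_frame K \<psi>"
begin

abbreviation "S \<equiv> frame_operator K \<psi>"
abbreviation "\<phi> \<equiv> dual_frame K \<psi>"
abbreviation "C \<equiv> analysis K \<psi>"
abbreviation "l2 \<equiv> lp K 2 (\<lambda>_. 1)"
abbreviation "M \<equiv> op_matrix K \<psi> \<phi>"

lemma frame_bounds:
  obtains a b where "a > 0" "b > 0"
    "\<And>f. (\<lambda>k. (cmod (cinner f (\<psi> k)))\<^sup>2) summable_on K"
    "\<And>f. a * (norm f)\<^sup>2 \<le> (\<Sum>\<^sub>\<infinity>k\<in>K. (cmod (cinner f (\<psi> k)))\<^sup>2)"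
    "\<And>f. (\<Sum>\<^sub>\<infinity>k\<in>K. (cmod (cinner f (\<psi> k)))\<^sup>2) \<le> b * (norm f)\<^sup>2"
  using frame unfolding is_frame_def by blast

lemma analysis_l2: "C f \<in> l2"
proof -
  have "(\<lambda>k. (cmod (cinner f (\<psi> k)))\<^sup>2) summable_on K"
    by (metis frame_bounds)
  then show ?thesis
    by (simp add: lp2_iff analysis_def cong: summable_on_cong)
qed

lemma infsum_cmod_analysis:
  "(\<Sum>\<^sub>\<infinity>k\<in>K. (cmod (C f k))\<^sup>2) = (\<Sum>\<^sub>\<infinity>k\<in>K. (cmod (cinner f (\<psi> k)))\<^sup>2)"
  by (rule infsum_cong) (simp add: analysis_def)

text \<open>Duality: synthesis is adjoint to analysis and inherits its bound. Pairing the finite sum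
  \<open>g\<close> with itself, Cauchy-Schwarz leaves the upper frame inequality for
  \<open>g\<close>, after which one factor \<open>(norm g)\<^sup>2\<close> cancels.\<close>

lemma synthesis_finite_bound:
  obtains b where "b > 0"
    "\<And>J c. finite J \<Longrightarrow> J \<subseteq> K \<Longrightarrow> (norm (\<Sum>k\<in>J. c k *\<^sub>C \<psi> k))\<^sup>2 \<le> b * (\<Sum>k\<in>J. (cmod (c k))\<^sup>2)"
proof -
  obtain a b where ab: "b > 0"
    "\<And>f. (\<lambda>k. (cmod (cinner f (\<psi> k)))\<^sup>2) summable_on K"
    "\<And>f. (\<Sum>\<^sub>\<infinity>k\<in>K. (cmod (cinner f (\<psi> k)))\<^sup>2) \<le> b * (norm f)\<^sup>2"
    by (metis frame_bounds)
  have "(norm (\<Sum>k\<in>J. c k *\<^sub>C \<psi> k))\<^sup>2 \<le> b * (\<Sum>k\<in>J. (cmod (c k))\<^sup>2)" if J: "finite J" "J \<subseteq> K" for J c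
  proof -
    define g where "g = (\<Sum>k\<in>J. c k *\<^sub>C \<psi> k)"
    have "cinner g g = (\<Sum>k\<in>J. c k * cinner (\<psi> k) g)"
      by (subst (1) g_def)
        (simp add: linear_sum[OF bounded_linear.linear[OF bounded_linear_cinner_left]] cinner_scaleC_left)
    moreover have "(norm g)\<^sup>2 = Re (cinner g g)"
      by (simp add: Re_cinner power2_norm_eq_inner)
    ultimately have "(norm g)\<^sup>2 \<le> cmod (\<Sum>k\<in>J. c k * cinner (\<psi> k) g)"
      by (metis complex_Re_le_cmod)
    also have "\<dots> \<le> (\<Sum>k\<in>J. \<bar>cmod (c k)\<bar> * \<bar>cmod (cinner g (\<psi> k))\<bar>)"
      by (rule order_trans[OF norm_sum]) (simp add: norm_mult cinner_commute[of _ g])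
    also have "\<dots> \<le> L2_set (\<lambda>k. cmod (c k)) J * L2_set (\<lambda>k. cmod (cinner g (\<psi> k))) J"
      by (rule L2_set_mult_ineq)
    finally have "((norm g)\<^sup>2)\<^sup>2 \<le> (L2_set (\<lambda>k. cmod (c k)) J * L2_set (\<lambda>k. cmod (cinner g (\<psi> k))) J)\<^sup>2"
      by (rule power_mono) simp
    also have "\<dots> = (\<Sum>k\<in>J. (cmod (c k))\<^sup>2) * (\<Sum>k\<in>J. (cmod (cinner g (\<psi> k)))\<^sup>2)"
      by (simp add: power_mult_distrib L2_set_def sum_nonneg)
    also have "\<dots> \<le> (\<Sum>k\<in>J. (cmod (c k))\<^sup>2) * (b * (norm g)\<^sup>2)"
      using finite_sum_le_infsum[OF ab(2)[of g] J] ab(3)[of g]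
      by (intro mult_left_mono) (auto intro: sum_nonneg order_trans)
    finally have "(norm g)\<^sup>2 * (norm g)\<^sup>2 \<le> (b * (\<Sum>k\<in>J. (cmod (c k))\<^sup>2)) * (norm g)\<^sup>2"
      by (simp add: power2_eq_square mult_ac)
    then show ?thesis
      using ab(1) mult_right_le_imp_le[of "(norm g)\<^sup>2" "(norm g)\<^sup>2"]
      by (cases "g = 0") (auto simp del: power2_eq_square simp: g_def[symmetric] sum_nonneg)
  qed
  then show ?thesis
    using ab(1) that by blast
qed

lemma synthesis_summable:
  assumes "c \<in> l2"
  shows "(\<lambda>k. c k *\<^sub>C \<psi> k) summable_on K"
proof (rule summable_on_small_tailsI)
  fix e :: real assume "e > 0"
  obtain b where b: "b > 0"
    "\<And>J c. finite J \<Longrightarrow> J \<subseteq> K \<Longrightarrow> (norm (\<Sum>k\<in>J. c k *\<^sub>C \<psi> k))\<^sup>2 \<le> b * (\<Sum>k\<in>J. (cmod (c k))\<^sup>2)"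
    by (metis synthesis_finite_bound)
  have sm: "(\<lambda>k. (cmod (c k))\<^sup>2) summable_on K"
    using assms by (simp add: lp2_iff)
  obtain E where E: "finite E" "E \<subseteq> K"
    "dist (\<Sum>k\<in>E. (cmod (c k))\<^sup>2) (\<Sum>\<^sub>\<infinity>k\<in>K. (cmod (c k))\<^sup>2) \<le> e\<^sup>2 / (2 * b)"
    using infsum_finite_approximation[OF sm, of "e\<^sup>2 / (2 * b)"] \<open>e > 0\<close> b(1) by auto
  have "norm (\<Sum>k\<in>F. c k *\<^sub>C \<psi> k) < e" if F: "finite F" "F \<subseteq> K - E" for F
  proof -
    have "(\<Sum>k\<in>E \<union> F. (cmod (c k))\<^sup>2) \<le> (\<Sum>\<^sub>\<infinity>k\<in>K. (cmod (c k))\<^sup>2)"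
      using F E by (intro finite_sum_le_infsum[OF sm]) auto
    then have "(\<Sum>k\<in>F. (cmod (c k))\<^sup>2) \<le> e\<^sup>2 / (2 * b)"
      using E F by (subst (asm) sum.union_disjoint) (auto simp: dist_real_def)
    then have "b * (\<Sum>k\<in>F. (cmod (c k))\<^sup>2) \<le> b * (e\<^sup>2 / (2 * b))"
      using b(1) by (intro mult_left_mono) auto
    also have "\<dots> < e\<^sup>2"
      using b(1) \<open>e > 0\<close> by simp
    finally have "b * (\<Sum>k\<in>F. (cmod (c k))\<^sup>2) < e\<^sup>2" .
    then have "(norm (\<Sum>k\<in>F. c k *\<^sub>C \<psi> k))\<^sup>2 < e\<^sup>2"
      using b(2)[of F c] F by (auto intro: le_less_trans)
    then show ?thesis
      using \<open>e > 0\<close> power_less_imp_less_base by fastforce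
  qed
  then show "\<exists>E. finite E \<and> E \<subseteq> K \<and>
      (\<forall>F. finite F \<and> F \<subseteq> K - E \<longrightarrow> norm (\<Sum>k\<in>F. c k *\<^sub>C \<psi> k) < e)"
    using E by blast
qed

lemma synthesis_has_sum:
  "c \<in> l2 \<Longrightarrow> ((\<lambda>k. c k *\<^sub>C \<psi> k) has_sum synthesis K \<psi> c) K"
  unfolding synthesis_def by (intro has_sum_infsum synthesis_summable)

lemma synthesis_bound:
  obtains b where "b > 0"
    "\<And>c. c \<in> l2 \<Longrightarrow> (norm (synthesis K \<psi> c))\<^sup>2 \<le> b * (\<Sum>\<^sub>\<infinity>k\<in>K. (cmod (c k))\<^sup>2)"
proof -
  obtain b where b: "b > 0"
    "\<And>J c. finite J \<Longrightarrow> J \<subseteq> K \<Longrightarrow> (norm (\<Sum>k\<in>J. c k *\<^sub>C \<psi> k))\<^sup>2 \<le> b * (\<Sum>k\<in>J. (cmod (c k))\<^sup>2)"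
    by (metis synthesis_finite_bound)
  have "(norm (synthesis K \<psi> c))\<^sup>2 \<le> b * (\<Sum>\<^sub>\<infinity>k\<in>K. (cmod (c k))\<^sup>2)" if c: "c \<in> l2" for c
  proof (rule tendsto_upperbound)
    show "((\<lambda>J. (norm (\<Sum>k\<in>J. c k *\<^sub>C \<psi> k))\<^sup>2) \<longlongrightarrow> (norm (synthesis K \<psi> c))\<^sup>2) (finite_subsets_at_top K)"
      using synthesis_has_sum[OF c] unfolding has_sum_def by (intro tendsto_intros)
    have "(norm (\<Sum>k\<in>J. c k *\<^sub>C \<psi> k))\<^sup>2 \<le> b * (\<Sum>\<^sub>\<infinity>k\<in>K. (cmod (c k))\<^sup>2)" if J: "finite J" "J \<subseteq> K" for J
      by (rule order_trans[OF b(2)[OF J] mult_left_mono])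
        (use J b(1) c in \<open>auto simp: lp2_iff intro: finite_sum_le_infsum\<close>)
    then show "\<forall>\<^sub>F J in finite_subsets_at_top K.
        (norm (\<Sum>k\<in>J. c k *\<^sub>C \<psi> k))\<^sup>2 \<le> b * (\<Sum>\<^sub>\<infinity>k\<in>K. (cmod (c k))\<^sup>2)"
      by (intro eventually_finite_subsets_at_top_weakI) auto
  qed simp
  then show ?thesis
    using b(1) that by blast
qed

lemma frame_operator_has_sum: "((\<lambda>k. cinner f (\<psi> k) *\<^sub>C \<psi> k) has_sum S f) K"
  using synthesis_has_sum[OF analysis_l2[of f]] unfolding frame_operator_def
  by (rule has_sum_cong[THEN iffD1, rotated]) (simp add: analysis_def)

lemma frame_operator_cinner:
  "((\<lambda>k. cinner f (\<psi> k) * cinner (\<psi> k) g) has_sum cinner (S f) g) K"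
  using has_sum_bounded_linear[OF bounded_linear_cinner_left frame_operator_has_sum, of f g]
  by (simp add: cinner_scaleC_left)

lemma frame_operator_selfadjoint: "cinner (S f) g = cinner f (S g)"
proof -
  have "((\<lambda>k. cnj (cinner g (\<psi> k) * cinner (\<psi> k) f)) has_sum cnj (cinner (S g) f)) K"
    using frame_operator_cinner by (simp only: has_sum_cnj_iff)
  then have "((\<lambda>k. cinner f (\<psi> k) * cinner (\<psi> k) g) has_sum cinner f (S g)) K"
    by (simp add: cinner_commute[of f] cinner_commute[of _ g] mult.commute)
  then show ?thesis
    using frame_operator_cinner has_sum_unique by blast
qed

lemma frame_operator_bounded_clinear: "bounded_clinear S"
proof -
  obtain b where b: "b > 0"
    "\<And>c. c \<in> l2 \<Longrightarrow> (norm (synthesis K \<psi> c))\<^sup>2 \<le> b * (\<Sum>\<^sub>\<infinity>k\<in>K. (cmod (c k))\<^sup>2)"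
    by (metis synthesis_bound)
  obtain b' where b': "b' > 0"
    "\<And>f. (\<Sum>\<^sub>\<infinity>k\<in>K. (cmod (cinner f (\<psi> k)))\<^sup>2) \<le> b' * (norm f)\<^sup>2"
    by (metis frame_bounds)
  have "(norm (S f))\<^sup>2 \<le> (norm f * sqrt (b * b'))\<^sup>2" for f
  proof -
    have "(norm (S f))\<^sup>2 \<le> b * (b' * (norm f)\<^sup>2)"
      unfolding frame_operator_def
      by (rule order_trans[OF b(2)[OF analysis_l2] mult_left_mono])
        (use b(1) b'(2) in \<open>auto simp: infsum_cmod_analysis\<close>)
    then show ?thesis
      using b b' by (simp add: power_mult_distrib mult_ac)
  qed
  then have "norm (S f) \<le> norm f * sqrt (b * b')" for f
    by (rule power2_le_imp_le) (use b(1) b'(1) in auto)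
  \<comment> \<open>Linearity follows from self-adjointness: testing against \<open>z\<close> moves
    \<open>S\<close> onto \<open>z\<close>, and the inner product is linear in the remaining
    argument.\<close>
  moreover have "S (f + g) = S f + S g" for f g
    by (rule cinner_eqI) (simp add: frame_operator_selfadjoint cinner_add_left)
  moreover have sc: "S (a *\<^sub>C f) = a *\<^sub>C S f" for a f
    by (rule cinner_eqI) (simp add: frame_operator_selfadjoint cinner_scaleC_left)
  moreover have "S (r *\<^sub>R f) = r *\<^sub>R S f" for r f
    using sc[of "of_real r" f] by (simp add: scaleC_of_real)
  ultimately show ?thesis
    unfolding bounded_clinear_def by (intro conjI bounded_linear_intro allI)
qed

lemma frame_operator_lower:
  obtains a where "a > 0" "\<And>f. a * (norm f)\<^sup>2 \<le> inner (S f) f"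
proof -
  obtain a where a: "a > 0"
    "\<And>f. a * (norm f)\<^sup>2 \<le> (\<Sum>\<^sub>\<infinity>k\<in>K. (cmod (cinner f (\<psi> k)))\<^sup>2)"
    by (metis frame_bounds)
  have "inner (S f) f = (\<Sum>\<^sub>\<infinity>k\<in>K. (cmod (cinner f (\<psi> k)))\<^sup>2)" for f
  proof -
    have "((\<lambda>k. complex_of_real ((cmod (cinner f (\<psi> k)))\<^sup>2)) has_sum cinner (S f) f) K"
      using frame_operator_cinner[of f f]
      unfolding complex_norm_square by (simp add: cinner_commute[of _ f])
    then have "((\<lambda>k. (cmod (cinner f (\<psi> k)))\<^sup>2) has_sum inner (S f) f) K"
      using has_sum_Re by (fastforce simp flip: Re_cinner)
    then show ?thesis
      by (simp add: infsumI)
  qed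
  then show ?thesis
    using a that by metis
qed

text \<open>A multiple of \<open>S\<close> is within distance less than 1 of the identity, so the
  contraction lemma applies to \<open>1 - t S\<close>.\<close>

lemma frame_operator_invertible: "invertible_operator S"
proof -
  obtain a where a: "a > 0" "\<And>f. a * (norm f)\<^sup>2 \<le> inner (S f) f"
    by (metis frame_operator_lower)
  obtain b0 where b0: "\<And>f. norm (S f) \<le> norm f * b0"
    using bounded_linear.bounded[OF bounded_clinearD(1)[OF frame_operator_bounded_clinear]] by blast
  \<comment> \<open>Taking the maximum ensures \<open>a \<le> b\<close>, hence \<open>b > 0\<close>
    and a nonnegative radicand in \<open>q\<close>, even on a trivial space.\<close>
  define b where "b = max a b0"
  have b: "b \<ge> a" "norm (S f) \<le> b * norm f" for f
    using b0[of f] mult_right_mono[of b0 b "norm f"] by (auto simp: b_def mult.commute)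
  \<comment> \<open>This \<open>t\<close> minimises the bound 1 - 2 t a + t^2 b^2 for the squared
    norm of 1 - t S; the minimum 1 - a^2 / b^2 is the square of \<open>q\<close>.\<close>
  define t where "t = a / b\<^sup>2"
  define R where "R f = f - of_real t *\<^sub>C S f" for f
  have bc: "bounded_clinear R" unfolding R_def
    by (intro bounded_clinear_diff bounded_clinear_scaleC bounded_clinear_id frame_operator_bounded_clinear)
  define q where "q = sqrt (1 - a\<^sup>2 / b\<^sup>2)"
  have ab: "a\<^sup>2 / b\<^sup>2 \<le> 1" "0 < a\<^sup>2 / b\<^sup>2" "t > 0"
    using a(1) b(1) by (auto simp: power_mono t_def)
  have q: "0 \<le> q" "q < 1"
    using ab by (auto simp: q_def)
  have "(norm (R f))\<^sup>2 \<le> (q * norm f)\<^sup>2" for f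
  proof -
    have "(norm (R f))\<^sup>2 = (norm f)\<^sup>2 - 2 * t * inner (S f) f + t\<^sup>2 * (norm (S f))\<^sup>2"
      unfolding R_def scaleC_of_real power2_norm_eq_inner
      by (simp add: inner_diff_left inner_diff_right inner_commute power2_eq_square)
    also have "\<dots> \<le> (norm f)\<^sup>2 - 2 * t * (a * (norm f)\<^sup>2) + t\<^sup>2 * (b * norm f)\<^sup>2"
      using ab(3) a(2)[of f] b(2)[of f]
      by (intro add_mono diff_mono mult_left_mono power_mono) auto
    also have "\<dots> = (1 - a\<^sup>2 / b\<^sup>2) * (norm f)\<^sup>2"
      using a(1) b(1) by (simp add: t_def field_simps power2_eq_square)
    finally show ?thesis
      using ab by (simp add: q_def power_mult_distrib)
  qed
  then have "norm (R f) \<le> q * norm f" for f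
    by (rule power2_le_imp_le) (use q in auto)
  note inv = contraction_invertible(1)[OF bc q this]
  have eq: "(\<lambda>f. f - R f) = (\<lambda>f. of_real t *\<^sub>C S f)"
    by (simp add: R_def)
  define T where "T = inv (\<lambda>f. f - R f)"
  have T: "of_real t *\<^sub>C S (T x) = x" "T (of_real t *\<^sub>C S x) = x" for x
    using invertible_operatorD(3,4)[OF inv, of x] unfolding T_def[symmetric] by (simp_all add: R_def)
  have Tc: "bounded_clinear T"
    using invertible_operatorD(2)[OF inv] unfolding T_def .
  have "S (of_real t *\<^sub>C T x) = x" "of_real t *\<^sub>C T (S x) = x" for x
    using T[of x] by (simp_all add: bounded_clinearD[OF Tc] bounded_clinearD[OF frame_operator_bounded_clinear])
  then have S: "bij S" "inv S = (\<lambda>x. of_real t *\<^sub>C T x)"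
    by (auto intro!: o_bij[of "\<lambda>x. of_real t *\<^sub>C T x"] inv_equality)
  show ?thesis
    unfolding invertible_operator_def S(2)
    by (intro conjI S(1) bounded_clinear_scaleC Tc frame_operator_bounded_clinear)
qed

lemmas S_inv = invertible_operatorD[OF frame_operator_invertible]

lemma inv_S_selfadjoint: "cinner (inv S f) g = cinner f (inv S g)"
  by (metis S_inv(3) frame_operator_selfadjoint)

lemma dual_coef_eq: "dual_coef K \<psi> f = C (inv S f)"
  by (simp add: dual_coef_def analysis_def dual_frame_def inv_S_selfadjoint fun_eq_iff)

lemma S_dual_frame: "S (\<phi> k) = \<psi> k"
  by (simp add: dual_frame_def S_inv)

text \<open>Written through \<open>inv S\<close>, so that boundedness and the reconstruction formula
  come from \<open>S\<close>; the next lemma recovers the series over the dual frame.\<close>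

definition dual_synthesis :: "'k cseq \<Rightarrow> 'h" where
  "dual_synthesis c = inv S (synthesis K \<psi> c)"

lemma dual_synthesis_has_sum:
  "c \<in> l2 \<Longrightarrow> ((\<lambda>k. c k *\<^sub>C \<phi> k) has_sum dual_synthesis c) K"
  using has_sum_bounded_linear[OF bounded_clinearD(1)[OF S_inv(2)] synthesis_has_sum]
  by (simp add: bounded_clinearD(2)[OF S_inv(2)] dual_frame_def dual_synthesis_def)

lemma dual_synthesis_analysis [simp]: "dual_synthesis (C f) = f"
  by (simp add: dual_synthesis_def flip: frame_operator_def) (simp add: S_inv)

text \<open>On l^2 the matrix factors as analysis after \<open>R\<close> after dual synthesis: the
  continuous \<open>R\<close> may be applied termwise to the dual frame series.\<close>

lemma op_matrix_mat_vec_has_sum: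
  assumes R: "bounded_clinear R" and c: "c \<in> l2" and k: "k \<in> K"
  shows "((\<lambda>l. M R k l * c l) has_sum C (R (dual_synthesis c)) k) K"
proof -
  have "((\<lambda>l. cinner (R (c l *\<^sub>C \<phi> l)) (\<psi> k)) has_sum cinner (R (dual_synthesis c)) (\<psi> k)) K"
    by (rule has_sum_bounded_linear[OF _ dual_synthesis_has_sum[OF c]])
      (intro bounded_linear_compose[OF bounded_linear_cinner_left] bounded_clinearD(1)[OF R])
  then show ?thesis
    using k by (subst (asm) has_sum_cong[where g = "\<lambda>l. M R k l * c l"])
      (auto simp: bounded_clinearD[OF R] cinner_scaleC_left op_matrix_def analysis_def)
qed

lemma op_matrix_mat_vec:
  assumes "bounded_clinear R" "c \<in> l2"
  shows "mat_vec K (M R) c = C (R (dual_synthesis c))"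
proof
  fix k
  show "mat_vec K (M R) c k = C (R (dual_synthesis c)) k"
    using op_matrix_mat_vec_has_sum[OF assms, of k]
    by (cases "k \<in> K") (auto simp: mat_vec_def op_matrix_def analysis_def infsumI)
qed

text \<open>Column \<open>l\<close> of \<open>M T\<close> is the analysis of
  \<open>T (\<phi> l)\<close>, and the dual synthesis inside \<open>M R\<close> undoes that
  analysis.\<close>

lemma op_matrix_mult:
  assumes R: "bounded_clinear R" and T: "bounded_clinear T"
  shows "mat_mult K (M R) (M T) = M (\<lambda>x. R (T x))"
proof (intro ext)
  fix k l
  show "mat_mult K (M R) (M T) k l = M (\<lambda>x. R (T x)) k l"
  proof (cases "l \<in> K")
    case True
    then have "(\<lambda>m. M T m l) = C (T (\<phi> l))"
      by (auto simp: op_matrix_def analysis_def)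
    then have "mat_mult K (M R) (M T) k l = mat_vec K (M R) (C (T (\<phi> l))) k"
      by (simp add: mat_mult_def mat_vec_def fun_eq_iff)
    also have "\<dots> = C (R (T (\<phi> l))) k"
      by (simp add: op_matrix_mat_vec[OF R analysis_l2])
    finally show ?thesis
      using True by (simp add: analysis_def op_matrix_def)
  qed (simp add: mat_mult_def op_matrix_def)
qed

lemma op_matrix_frame_operator: "M S = cross_gram K \<psi> \<psi>"
  by (simp add: op_matrix_def cross_gram_def S_dual_frame cong: if_cong)

end

section \<open>Weighted sequence spaces\<close>

text \<open>Convexity on the open half-line handles positive arguments. If one argument is 0, the
  claim reduces to \<open>v powr r \<le> v\<close> on the unit interval.\<close>

lemma powr_convex_nonneg:
  fixes x y u r :: real
  assumes r: "1 \<le> r" and "0 \<le> x" "0 \<le> y" and u: "0 \<le> u" "u \<le> 1"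
  shows "(u * x + (1 - u) * y) powr r \<le> u * x powr r + (1 - u) * y powr r"
proof -
  have le: "v powr r \<le> v" if "0 \<le> v" "v \<le> 1" for v :: real
    using powr_mono'[of 1 r v] that r by (cases "v = 0") auto
  consider "x = 0" | "y = 0" | "0 < x" "0 < y"
    using assms by linarith
  then show ?thesis
  proof cases
    case 1
    then show ?thesis
      using le[of "1 - u"] u \<open>0 \<le> y\<close> r by (simp add: powr_mult mult_right_mono)
  next
    case 2
    then show ?thesis
      using le[of u] u \<open>0 \<le> x\<close> r by (simp add: powr_mult mult_right_mono)
  next
    case 3
    show ?thesis
      using convex_onD[OF powr_convex[OF r], of "1 - u" x y] u 3 by (simp add: algebra_simps)
  qed
qed

text \<open>Stated with arbitrary bounds \<open>s\<close> and \<open>t\<close> in place of the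
  norms, which is the form in which balls are added below.\<close>

lemma minkowski_sum:
  fixes a b :: "'a \<Rightarrow> real"
  assumes r: "1 \<le> r" and J: "finite J" and a: "\<And>k. k \<in> J \<Longrightarrow> 0 \<le> a k" and b: "\<And>k. k \<in> J \<Longrightarrow> 0 \<le> b k"
    and "0 \<le> s" "0 \<le> t"
    and sa: "(\<Sum>k\<in>J. a k powr r) \<le> s powr r" and sb: "(\<Sum>k\<in>J. b k powr r) \<le> t powr r"
  shows "(\<Sum>k\<in>J. (a k + b k) powr r) \<le> (s + t) powr r"
proof -
  have zero: "\<forall>k\<in>J. f k = 0"
    if "(\<Sum>k\<in>J. f k powr r) \<le> 0 powr r" "\<And>k. k \<in> J \<Longrightarrow> 0 \<le> f k" for f :: "'a \<Rightarrow> real"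
  proof -
    have "(\<Sum>k\<in>J. f k powr r) = 0"
      using that(1) by (intro antisym sum_nonneg) auto
    then show ?thesis
      using sum_nonneg_eq_0_iff[OF J, of "\<lambda>k. f k powr r"] by auto
  qed
  consider "s = 0" | "t = 0" | "0 < s" "0 < t"
    using assms by linarith
  then show ?thesis
  proof cases
    case 1
    then show ?thesis
      using zero[of a] sa sb a by (simp cong: sum.cong)
  next
    case 2
    then show ?thesis
      using zero[of b] sa sb b by (simp cong: sum.cong)
  next
    case 3
    \<comment> \<open>With the weight \<open>s / (s + t)\<close>, the number
      \<open>(a k + b k) / (s + t)\<close> is a convex combination of the normalised terms
      \<open>a k / s\<close> and \<open>b k / t\<close>.\<close>
    define u where "u = s / (s + t)"
    have u: "0 \<le> u" "u \<le> 1" "1 - u = t / (s + t)"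
      using 3 by (auto simp: u_def field_simps)
    have "(\<Sum>k\<in>J. (a k + b k) powr r) =
        (\<Sum>k\<in>J. (s + t) powr r * (u * (a k / s) + (1 - u) * (b k / t)) powr r)"
    proof (rule sum.cong)
      fix k assume "k \<in> J"
      have "a k + b k = (s + t) * (u * (a k / s) + (1 - u) * (b k / t))"
        using 3 unfolding u(3) distrib_left by (simp add: u_def)
      moreover have "0 \<le> u * (a k / s) + (1 - u) * (b k / t)"
        using u 3 a[OF \<open>k \<in> J\<close>] b[OF \<open>k \<in> J\<close>] by simp
      ultimately show "(a k + b k) powr r = (s + t) powr r * (u * (a k / s) + (1 - u) * (b k / t)) powr r"
        using 3 by (simp add: powr_mult)
    qed simp
    also have "\<dots> \<le> (\<Sum>k\<in>J. (s + t) powr r * (u * (a k / s) powr r + (1 - u) * (b k / t) powr r))"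
      using 3 a b u r by (intro sum_mono mult_left_mono powr_convex_nonneg) auto
    also have "\<dots> = (s + t) powr r *
        (u * ((\<Sum>k\<in>J. a k powr r) / s powr r) + (1 - u) * ((\<Sum>k\<in>J. b k powr r) / t powr r))"
      using 3 a b by (simp add: powr_divide sum.distrib flip: sum_distrib_left sum_divide_distrib)
    also have "\<dots> \<le> (s + t) powr r * (u * 1 + (1 - u) * 1)"
      using u 3 sa sb by (intro mult_left_mono add_mono) auto
    finally show ?thesis
      by simp
  qed
qed

section \<open>Norm, completeness and truncation in weighted l^p\<close>

locale weighted_lp =
  fixes K :: "'k set" and p :: ennreal and w :: "'k \<Rightarrow> real"
  assumes p: "1 \<le> p" and weight: "weight K w"
begin

abbreviation "Lp \<equiv> lp K p w"
abbreviation "nrm \<equiv> lp_norm K p w"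
abbreviation "r \<equiv> enn2real p"

text \<open>The closed ball of radius \<open>m\<close>, tested on finite sets or single coordinates
  only. In this form it passes to coordinatewise limits and carries no summability condition, so the
  default value of \<open>infsum\<close> cannot interfere.\<close>

definition lp_ball :: "real \<Rightarrow> 'k cseq \<Rightarrow> bool" where
  "lp_ball m c \<longleftrightarrow> (\<forall>k. k \<notin> K \<longrightarrow> c k = 0) \<and>
     (if p = \<infinity> then \<forall>k\<in>K. w k * cmod (c k) \<le> m
      else \<forall>J. finite J \<and> J \<subseteq> K \<longrightarrow> (\<Sum>k\<in>J. (w k * cmod (c k)) powr r) \<le> m powr r)"

lemma lp_ball_fin: "p \<noteq> \<infinity> \<Longrightarrow> lp_ball m c \<longleftrightarrow> (\<forall>k. k \<notin> K \<longrightarrow> c k = 0) \<and>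
    (\<forall>J. finite J \<and> J \<subseteq> K \<longrightarrow> (\<Sum>k\<in>J. (w k * cmod (c k)) powr r) \<le> m powr r)"
  and lp_ball_inf: "p = \<infinity> \<Longrightarrow> lp_ball m c \<longleftrightarrow> (\<forall>k. k \<notin> K \<longrightarrow> c k = 0) \<and>
    (\<forall>k\<in>K. w k * cmod (c k) \<le> m)"
  unfolding lp_ball_def by simp_all

lemma r_ge_1: "p \<noteq> \<infinity> \<Longrightarrow> 1 \<le> r"
  using p enn2real_mono[of 1 p] by (simp add: less_top)

lemma w_pos: "k \<in> K \<Longrightarrow> 0 < w k"
  using weight by (simp add: weight_def)

lemma lp_norm_nonneg: "c \<in> Lp \<Longrightarrow> 0 \<le> nrm c"
  by (auto simp: lp_norm_def lp_def intro!: cSup_upper)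

lemma lp_norm_powr: "p \<noteq> \<infinity> \<Longrightarrow> nrm c powr r = (\<Sum>\<^sub>\<infinity>k\<in>K. (w k * cmod (c k)) powr r)"
  using r_ge_1 by (simp add: lp_norm_def powr_powr infsum_nonneg)

lemma lp_ball_iff:
  assumes m: "0 \<le> m"
  shows "lp_ball m c \<longleftrightarrow> c \<in> Lp \<and> nrm c \<le> m"
proof (cases "p = \<infinity>")
  case True
  show ?thesis
  proof
    assume c: "lp_ball m c"
    then have "bdd_above ((\<lambda>k. w k * cmod (c k)) ` K)"
      unfolding lp_ball_inf[OF True] by (auto intro: bdd_aboveI2)
    moreover have "Sup (insert 0 ((\<lambda>k. w k * cmod (c k)) ` K)) \<le> m"
      using c m unfolding lp_ball_inf[OF True] by (intro cSup_least) auto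
    ultimately show "c \<in> Lp \<and> nrm c \<le> m"
      using c unfolding lp_ball_inf[OF True] by (simp add: True lp_def lp_norm_def)
  next
    assume c: "c \<in> Lp \<and> nrm c \<le> m"
    then have "w k * cmod (c k) \<le> nrm c" if "k \<in> K" for k
      using that True by (auto simp: lp_def lp_norm_def intro!: cSup_upper)
    with c show "lp_ball m c"
      unfolding lp_ball_inf[OF True] by (force simp: lp_def)
  qed
next
  case False
  note r = r_ge_1[OF False]
  let ?f = "\<lambda>k. (w k * cmod (c k)) powr r"
  show ?thesis
  proof
    assume c: "lp_ball m c"
    then have le: "sum ?f J \<le> m powr r" if "finite J" "J \<subseteq> K" for J
      using that False by (simp add: lp_ball_def)
    have sm: "?f summable_on K"
      by (rule nonneg_bdd_above_summable_on) (auto intro!: bdd_aboveI2 le)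
    have "nrm c powr r \<le> m powr r"
      unfolding lp_norm_powr[OF False] by (rule infsum_le_finite_sums[OF sm le])
    moreover have "c \<in> Lp"
      using c sm False by (simp add: lp_def lp_ball_def)
    ultimately show "c \<in> Lp \<and> nrm c \<le> m"
      using m r by (metis less_le_trans linorder_not_le powr_less_mono2 zero_less_one)
  next
    assume c: "c \<in> Lp \<and> nrm c \<le> m"
    then have sm: "?f summable_on K"
      using False by (simp add: lp_def)
    have "sum ?f J \<le> m powr r" if "finite J" "J \<subseteq> K" for J
    proof -
      have "sum ?f J \<le> nrm c powr r"
        unfolding lp_norm_powr[OF False] by (rule finite_sum_le_infsum[OF sm that]) simp
      also have "\<dots> \<le> m powr r"
        using c r lp_norm_nonneg by (intro powr_mono2) auto
      finally show ?thesis .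
    qed
    then show "lp_ball m c"
      using c False by (simp add: lp_ball_def lp_def)
  qed
qed

lemma lp_ball_norm: "c \<in> Lp \<Longrightarrow> lp_ball (nrm c) c"
  by (simp add: lp_ball_iff lp_norm_nonneg)

lemma lpI: "0 \<le> m \<Longrightarrow> lp_ball m c \<Longrightarrow> c \<in> Lp"
  and lp_norm_leI: "0 \<le> m \<Longrightarrow> lp_ball m c \<Longrightarrow> nrm c \<le> m"
  by (simp_all add: lp_ball_iff)

lemma lp_vanish: "c \<in> Lp \<Longrightarrow> k \<notin> K \<Longrightarrow> c k = 0"
  by (simp add: lp_def)

lemma lp_ball_mono_seq:
  assumes "lp_ball m c" "\<And>k. cmod (d k) \<le> cmod (c k)"
  shows "lp_ball m d"
proof -
  have le: "w k * cmod (d k) \<le> w k * cmod (c k)" "0 \<le> w k * cmod (d k)" if "k \<in> K" for k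
    using assms(2) w_pos[OF that] by simp_all
  have "d k = 0" if "k \<notin> K" for k
    using assms that by (metis lp_ball_def norm_le_zero_iff norm_zero)
  moreover have "(\<Sum>k\<in>J. (w k * cmod (d k)) powr r) \<le> m powr r"
    if "finite J" "J \<subseteq> K" "p \<noteq> \<infinity>" for J
  proof -
    have "(\<Sum>k\<in>J. (w k * cmod (d k)) powr r) \<le> (\<Sum>k\<in>J. (w k * cmod (c k)) powr r)"
      using le that r_ge_1 by (intro sum_mono powr_mono2) auto
    also have "\<dots> \<le> m powr r"
      using assms(1) that by (simp add: lp_ball_def)
    finally show ?thesis .
  qed
  moreover have "w k * cmod (d k) \<le> m" if "k \<in> K" "p = \<infinity>" for k
    using le(1)[OF that(1)] assms(1) that(1) unfolding lp_ball_inf[OF that(2)] by force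
  ultimately show ?thesis
    by (simp add: lp_ball_def)
qed

lemma lp_ball_add:
  assumes "0 \<le> m" "0 \<le> n" "lp_ball m c" "lp_ball n d"
  shows "lp_ball (m + n) (\<lambda>k. c k + d k)"
proof -
  have le: "w k * cmod (c k + d k) \<le> w k * cmod (c k) + w k * cmod (d k)"
    "0 \<le> w k * cmod (c k + d k)" "0 \<le> w k * cmod (c k)" "0 \<le> w k * cmod (d k)"
    if "k \<in> K" for k
    using w_pos[OF that] norm_triangle_ineq[of "c k" "d k"] by (auto simp flip: distrib_left)
  have "(\<Sum>k\<in>J. (w k * cmod (c k + d k)) powr r) \<le> (m + n) powr r"
    if J: "finite J" "J \<subseteq> K" "p \<noteq> \<infinity>" for J
  proof -
    have "(\<Sum>k\<in>J. (w k * cmod (c k + d k)) powr r) \<le>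
        (\<Sum>k\<in>J. (w k * cmod (c k) + w k * cmod (d k)) powr r)"
      using le that r_ge_1 by (intro sum_mono powr_mono2) auto
    also have "\<dots> \<le> (m + n) powr r"
    proof (rule minkowski_sum[OF r_ge_1[OF J(3)] J(1) _ _ assms(1,2)])
      show "0 \<le> w k * cmod (c k)" "0 \<le> w k * cmod (d k)" if "k \<in> J" for k
        using le(3,4) J(2) that by blast+
      show "(\<Sum>k\<in>J. (w k * cmod (c k)) powr r) \<le> m powr r"
        "(\<Sum>k\<in>J. (w k * cmod (d k)) powr r) \<le> n powr r"
        using assms(3,4) J(1,2) unfolding lp_ball_fin[OF J(3)] by simp_all
    qed
    finally show ?thesis .
  qed
  moreover have "w k * cmod (c k + d k) \<le> m + n" if "k \<in> K" "p = \<infinity>" for k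
    using le(1)[OF that(1)] assms(3,4) that(1) unfolding lp_ball_inf[OF that(2)] by force
  ultimately show ?thesis
    using assms by (simp add: lp_ball_def)
qed

lemma lp_ball_scale:
  assumes "0 \<le> m" "lp_ball m c"
  shows "lp_ball (cmod a * m) (\<lambda>k. a * c k)"
proof -
  have "(\<Sum>k\<in>J. (w k * cmod (a * c k)) powr r) \<le> (cmod a * m) powr r"
    if J: "finite J" "J \<subseteq> K" "p \<noteq> \<infinity>" for J
  proof -
    have "(\<Sum>k\<in>J. (w k * cmod (a * c k)) powr r) = (\<Sum>k\<in>J. cmod a powr r * (w k * cmod (c k)) powr r)"
      using J w_pos by (intro sum.cong refl) (auto simp: norm_mult less_imp_le mult.left_commute simp flip: powr_mult)
    also have "\<dots> = cmod a powr r * (\<Sum>k\<in>J. (w k * cmod (c k)) powr r)"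
      by (simp add: sum_distrib_left)
    also have "\<dots> \<le> cmod a powr r * m powr r"
      using assms J by (intro mult_left_mono) (auto simp: lp_ball_def)
    finally show ?thesis
      using assms(1) by (simp add: powr_mult)
  qed
  then show ?thesis
    using assms by (auto simp: lp_ball_def norm_mult mult.left_commute mult_left_mono)
qed

lemma lp_zero: "(\<lambda>k. 0) \<in> Lp" "nrm (\<lambda>k. 0) = 0"
proof -
  have "lp_ball 0 (\<lambda>k. 0)"
    by (simp add: lp_ball_def)
  then show "(\<lambda>k. 0) \<in> Lp" "nrm (\<lambda>k. 0) = 0"
    using lpI[of 0 "\<lambda>k. 0"] lp_norm_leI[of 0 "\<lambda>k. 0"] lp_norm_nonneg[of "\<lambda>k. 0"] by auto
qed

lemma lp_add: "c \<in> Lp \<Longrightarrow> d \<in> Lp \<Longrightarrow> (\<lambda>k. c k + d k) \<in> Lp"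
  and lp_norm_add: "c \<in> Lp \<Longrightarrow> d \<in> Lp \<Longrightarrow> nrm (\<lambda>k. c k + d k) \<le> nrm c + nrm d"
  using lp_ball_add[OF lp_norm_nonneg lp_norm_nonneg lp_ball_norm lp_ball_norm, of c d]
    lp_norm_nonneg[of c] lp_norm_nonneg[of d] lp_ball_iff[of "nrm c + nrm d"] by auto

lemma lp_scale: "c \<in> Lp \<Longrightarrow> (\<lambda>k. a * c k) \<in> Lp"
  and lp_norm_scale_le: "c \<in> Lp \<Longrightarrow> nrm (\<lambda>k. a * c k) \<le> cmod a * nrm c"
  using lp_ball_scale[OF lp_norm_nonneg lp_ball_norm, of c a]
    lp_norm_nonneg[of c] lp_ball_iff[of "cmod a * nrm c"] by auto

lemma lp_diff: "c \<in> Lp \<Longrightarrow> d \<in> Lp \<Longrightarrow> (\<lambda>k. c k - d k) \<in> Lp"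
  using lp_add[OF _ lp_scale[of d "-1"], of c] by simp

lemma lp_norm_minus_commute:
  assumes "c \<in> Lp" "d \<in> Lp"
  shows "nrm (\<lambda>k. c k - d k) = nrm (\<lambda>k. d k - c k)"
  using lp_norm_scale_le[of "\<lambda>k. c k - d k" "-1"] lp_norm_scale_le[of "\<lambda>k. d k - c k" "-1"] assms
  by (simp add: lp_diff)

lemma lp_norm_diff_le: "c \<in> Lp \<Longrightarrow> d \<in> Lp \<Longrightarrow> nrm (\<lambda>k. c k - d k) \<le> nrm c + nrm d"
  using lp_norm_add[OF _ lp_scale[of d "-1"], of c] lp_norm_scale_le[of d "-1"] by simp

lemma lp_norm_triangle:
  assumes "c \<in> Lp" "d \<in> Lp" "e \<in> Lp"
  shows "nrm (\<lambda>k. c k - e k) \<le> nrm (\<lambda>k. c k - d k) + nrm (\<lambda>k. d k - e k)"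
  using lp_norm_add[of "\<lambda>k. c k - d k" "\<lambda>k. d k - e k"] assms by (simp add: lp_diff)

lemma lp_norm_abs_diff:
  assumes "c \<in> Lp" "d \<in> Lp"
  shows "\<bar>nrm c - nrm d\<bar> \<le> nrm (\<lambda>k. c k - d k)"
  using lp_norm_add[of "\<lambda>k. c k - d k" d] lp_norm_add[of "\<lambda>k. d k - c k" c]
    lp_norm_minus_commute[OF assms] assms by (simp add: lp_diff)

lemma lp_coordinate_le:
  assumes "c \<in> Lp" "k \<in> K"
  shows "w k * cmod (c k) \<le> nrm c"
proof (cases "p = \<infinity>")
  case True
  then show ?thesis
    using lp_ball_norm[OF assms(1)] assms(2) unfolding lp_ball_inf[OF True] by simp
next
  case False
  then have "(\<Sum>k\<in>{k}. (w k * cmod (c k)) powr r) \<le> nrm c powr r"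
    using lp_ball_norm[OF assms(1)] assms(2) unfolding lp_ball_fin[OF False] by blast
  then have "\<not> nrm c < w k * cmod (c k)"
    using powr_less_mono2[of r "nrm c" "w k * cmod (c k)"] r_ge_1[OF False] lp_norm_nonneg[OF assms(1)]
    by auto
  then show ?thesis
    by simp
qed

text \<open>Fatou property: each defining inequality involves finitely many coordinates and survives
  the limit.\<close>

lemma lp_ball_lim:
  assumes "\<And>n::nat. lp_ball m (c n)" and lim: "\<And>k. (\<lambda>n. c n k) \<longlonglongrightarrow> d k"
  shows "lp_ball m d"
proof -
  have "d k = 0" if "k \<notin> K" for k
    using lim[of k] assms(1) that by (simp add: lp_ball_def LIMSEQ_const_iff)
  moreover have "w k * cmod (d k) \<le> m" if "k \<in> K" "p = \<infinity>" for k
    by (rule LIMSEQ_le_const2[OF tendsto_mult_left[OF tendsto_norm[OF lim]]])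
      (use assms(1)[unfolded lp_ball_inf[OF that(2)]] that(1) in auto)
  moreover have "(\<Sum>k\<in>J. (w k * cmod (d k)) powr r) \<le> m powr r"
    if "finite J" "J \<subseteq> K" "p \<noteq> \<infinity>" for J
  proof (rule LIMSEQ_le_const2)
    show "(\<lambda>n. \<Sum>k\<in>J. (w k * cmod (c n k)) powr r) \<longlonglongrightarrow> (\<Sum>k\<in>J. (w k * cmod (d k)) powr r)"
    proof (intro tendsto_sum tendsto_powr' tendsto_mult tendsto_norm lim tendsto_const disjI2 conjI)
      show "0 < r"
        using r_ge_1[OF that(3)] by simp
      show "\<forall>\<^sub>F n in sequentially. 0 \<le> w k * cmod (c n k)" if "k \<in> J" for k
        using w_pos[of k] that \<open>J \<subseteq> K\<close> by (auto intro!: always_eventually)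
    qed
    show "\<exists>N. \<forall>n\<ge>N. (\<Sum>k\<in>J. (w k * cmod (c n k)) powr r) \<le> m powr r"
      using assms(1) that by (auto simp: lp_ball_def)
  qed
  ultimately show ?thesis
    by (simp add: lp_ball_def)
qed

lemma lp_tendsto_coordinate:
  assumes "\<And>n. c n \<in> Lp" "d \<in> Lp" "(\<lambda>n::nat. nrm (\<lambda>k. c n k - d k)) \<longlonglongrightarrow> 0"
  shows "(\<lambda>n. c n k) \<longlonglongrightarrow> d k"
proof (cases "k \<in> K")
  case True
  have "(\<lambda>n. c n k - d k) \<longlonglongrightarrow> 0"
  proof (rule Lim_null_comparison)
    show "(\<lambda>n. nrm (\<lambda>k. c n k - d k) / w k) \<longlonglongrightarrow> 0"
      using tendsto_divide[OF assms(3) tendsto_const[of "w k"]] w_pos[OF True] by simp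
    show "\<forall>\<^sub>F n in sequentially. cmod (c n k - d k) \<le> nrm (\<lambda>k. c n k - d k) / w k"
      using lp_coordinate_le[OF lp_diff[OF assms(1,2)] True] w_pos[OF True]
      by (intro always_eventually allI) (simp add: field_simps)
  qed
  then show ?thesis
    by (simp add: LIM_zero_iff)
next
  case False
  then show ?thesis
    using assms by (simp add: lp_vanish)
qed

lemma lp_norm_tendsto:
  assumes "\<And>n. c n \<in> Lp" "d \<in> Lp" "(\<lambda>n::nat. nrm (\<lambda>k. c n k - d k)) \<longlonglongrightarrow> 0"
  shows "(\<lambda>n. nrm (c n)) \<longlonglongrightarrow> nrm d"
proof -
  have "(\<lambda>n. nrm (c n) - nrm d) \<longlonglongrightarrow> 0"
    by (rule Lim_null_comparison[OF _ assms(3)]) (use assms in \<open>simp add: lp_norm_abs_diff\<close>)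
  then show ?thesis
    by (simp add: LIM_zero_iff)
qed

text \<open>With the first index fixed, the differences stay in a small ball while the second index
  tends to infinity; the Fatou property puts the distance to the coordinatewise limit into the same
  ball.\<close>

lemma lp_Cauchy_lim:
  assumes c: "\<And>n::nat. c n \<in> Lp"
    and Cauchy: "\<And>e. e > 0 \<Longrightarrow> \<exists>M. \<forall>m\<ge>M. \<forall>n\<ge>M. nrm (\<lambda>k. c m k - c n k) < e"
    and lim: "\<And>k. (\<lambda>n. c n k) \<longlonglongrightarrow> d k"
  shows "d \<in> Lp" "(\<lambda>n. nrm (\<lambda>k. c n k - d k)) \<longlonglongrightarrow> 0"
proof -
  have near: "\<exists>M. \<forall>m\<ge>M. lp_ball e (\<lambda>k. c m k - d k)" if "e > 0" for e
  proof -
    obtain M where M: "\<And>m n. m \<ge> M \<Longrightarrow> n \<ge> M \<Longrightarrow> nrm (\<lambda>k. c m k - c n k) < e"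
      using Cauchy[OF \<open>e > 0\<close>] by blast
    have "lp_ball e (\<lambda>k. c m k - d k)" if "m \<ge> M" for m
    proof (rule lp_ball_lim)
      show "lp_ball e (\<lambda>k. c m k - c (n + M) k)" for n
        using M[OF that, of "n + M"] \<open>e > 0\<close> by (simp add: lp_ball_iff lp_diff c)
      show "(\<lambda>n. c m k - c (n + M) k) \<longlonglongrightarrow> c m k - d k" for k
        using lim[of k] by (intro tendsto_intros LIMSEQ_ignore_initial_segment)
    qed
    then show ?thesis
      by blast
  qed
  obtain M where "lp_ball 1 (\<lambda>k. c M k - d k)"
    using near[of 1] by auto
  then have "(\<lambda>k. c M k - d k) \<in> Lp"
    by (rule lpI[rotated]) simp
  then have "(\<lambda>k. c M k - (c M k - d k)) \<in> Lp"
    by (rule lp_diff[OF c])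
  then show d: "d \<in> Lp"
    by simp
  show "(\<lambda>n. nrm (\<lambda>k. c n k - d k)) \<longlonglongrightarrow> 0"
  proof (rule LIMSEQ_I)
    fix e :: real assume "e > 0"
    then obtain M where M: "\<And>m. m \<ge> M \<Longrightarrow> lp_ball (e/2) (\<lambda>k. c m k - d k)"
      using near[of "e/2"] by auto
    have "norm (nrm (\<lambda>k. c m k - d k) - 0) < e" if "m \<ge> M" for m
      using lp_norm_leI[OF _ M[OF that]] lp_norm_nonneg[OF lp_diff[OF c d], of m] \<open>e > 0\<close> by simp
    then show "\<exists>M. \<forall>m\<ge>M. norm (nrm (\<lambda>k. c m k - d k) - 0) < e"
      by blast
  qed
qed

lemma lp_Cauchy_convergent:
  assumes c: "\<And>n::nat. c n \<in> Lp"
    and Cauchy: "\<And>e. e > 0 \<Longrightarrow> \<exists>M. \<forall>m\<ge>M. \<forall>n\<ge>M. nrm (\<lambda>k. c m k - c n k) < e"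
  obtains d where "d \<in> Lp" "(\<lambda>n. nrm (\<lambda>k. c n k - d k)) \<longlonglongrightarrow> 0"
proof -
  have "\<exists>d. (\<lambda>n. c n k) \<longlonglongrightarrow> d" for k
  proof (cases "k \<in> K")
    case True
    have "Cauchy (\<lambda>n. c n k)"
    proof (rule CauchyI)
      fix e :: real assume "e > 0"
      obtain M where M: "\<And>m n. m \<ge> M \<Longrightarrow> n \<ge> M \<Longrightarrow> nrm (\<lambda>k. c m k - c n k) < w k * e"
        using Cauchy[of "w k * e"] \<open>e > 0\<close> w_pos[OF True] by auto
      have "norm (c m k - c n k) < e" if "m \<ge> M" "n \<ge> M" for m n
        using M[OF that] lp_coordinate_le[OF lp_diff[OF c c] True, of m n] w_pos[OF True]
        by (metis mult_less_cancel_left_pos order_le_less_trans)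
      then show "\<exists>M. \<forall>m\<ge>M. \<forall>n\<ge>M. norm (c m k - c n k) < e"
        by blast
    qed
    then show ?thesis
      by (simp add: Cauchy_convergent_iff convergent_def)
  next
    case False
    then show ?thesis
      using c by (auto simp: lp_vanish)
  qed
  then obtain d where "\<And>k. (\<lambda>n. c n k) \<longlonglongrightarrow> d k"
    by metis
  then show ?thesis
    using that lp_Cauchy_lim[OF c Cauchy] by blast
qed

lemma lp_restrict:
  assumes "c \<in> Lp"
  shows "(\<lambda>k. if k \<in> J then c k else 0) \<in> Lp" "nrm (\<lambda>k. if k \<in> J then c k else 0) \<le> nrm c"
proof -
  have "lp_ball (nrm c) (\<lambda>k. if k \<in> J then c k else 0)"
    by (rule lp_ball_mono_seq[OF lp_ball_norm[OF assms]]) simp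
  then show "(\<lambda>k. if k \<in> J then c k else 0) \<in> Lp" "nrm (\<lambda>k. if k \<in> J then c k else 0) \<le> nrm c"
    using lp_ball_iff[OF lp_norm_nonneg[OF assms]] by auto
qed

lemma lp_cmod: "c \<in> Lp \<Longrightarrow> (\<lambda>k. complex_of_real (cmod (c k))) \<in> Lp"
  by (rule lpI[OF lp_norm_nonneg lp_ball_mono_seq[OF lp_ball_norm]]) auto

lemma l00_subset_lp: "l00 K \<subseteq> Lp"
proof
  fix c :: "'k cseq" assume c: "c \<in> l00 K"
  define F where "F = {k. c k \<noteq> 0}"
  have F: "finite F" "F \<subseteq> K"
    using c by (auto simp: l00_def F_def)
  have "(\<lambda>k. (w k * cmod (c k)) powr r) summable_on K"
    by (rule finite_nonzero_values_imp_summable_on) (rule finite_subset[OF _ F(1)], auto simp: F_def)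
  moreover have "(\<lambda>k. w k * cmod (c k)) ` K \<subseteq> insert 0 ((\<lambda>k. w k * cmod (c k)) ` F)"
    by (auto simp: F_def)
  then have "bdd_above ((\<lambda>k. w k * cmod (c k)) ` K)"
    using F(1) by (meson bdd_above_finite bdd_above_mono finite_imageI finite_insert)
  ultimately show "c \<in> Lp"
    using F by (auto simp: lp_def F_def)
qed

text \<open>The error is exactly the tail of a convergent series, raised to the power
  \<open>1 / r\<close>. There is no analogue for \<open>p = \<infinity>\<close>, where convergence
  can only be expected coordinatewise; this forces the case distinctions on \<open>p\<close> from
  here on.\<close>

lemma lp_truncation_tendsto:
  assumes fin: "p \<noteq> \<infinity>" and c: "c \<in> Lp"
  shows "((\<lambda>J. nrm (\<lambda>k. (if k \<in> J then c k else 0) - c k)) \<longlongrightarrow> 0) (finite_subsets_at_top K)"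
proof -
  note r = r_ge_1[OF fin]
  let ?f = "\<lambda>k. (w k * cmod (c k)) powr r"
  have sm: "?f summable_on K"
    using c fin by (simp add: lp_def)
  have "((\<lambda>J. (infsum ?f K - sum ?f J) powr (1 / r)) \<longlongrightarrow> 0 powr (1 / r)) (finite_subsets_at_top K)"
  proof (rule tendsto_powr'[OF _ tendsto_const])
    have "((\<lambda>J. infsum ?f K - sum ?f J) \<longlongrightarrow> infsum ?f K - infsum ?f K) (finite_subsets_at_top K)"
      by (intro tendsto_diff tendsto_const infsum_tendsto sm)
    then show "((\<lambda>J. infsum ?f K - sum ?f J) \<longlongrightarrow> 0) (finite_subsets_at_top K)"
      by simp
    have "0 \<le> infsum ?f K - sum ?f J" if "finite J" "J \<subseteq> K" for J
      using finite_sum_le_infsum[OF sm that] by simp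
    then show "(0::real) \<noteq> 0 \<or> 0 < 1 / r \<and>
        (\<forall>\<^sub>F J in finite_subsets_at_top K. 0 \<le> infsum ?f K - sum ?f J)"
      using r by (intro disjI2 conjI eventually_finite_subsets_at_top_weakI) auto
  qed
  moreover have "nrm (\<lambda>k. (if k \<in> J then c k else 0) - c k) = (infsum ?f K - sum ?f J) powr (1 / r)"
    if J: "finite J" "J \<subseteq> K" for J
  proof -
    have "((\<lambda>k. if k \<in> J then ?f k else 0) has_sum sum ?f J) K"
      by (rule has_sum_finite_neutralI[OF J]) auto
    then have "((\<lambda>k. ?f k + - (if k \<in> J then ?f k else 0)) has_sum infsum ?f K + - sum ?f J) K"
      by (intro has_sum_add has_sum_uminusI has_sum_infsum sm)
    then have "((\<lambda>k. (w k * cmod ((if k \<in> J then c k else 0) - c k)) powr r) has_sum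
        infsum ?f K - sum ?f J) K"
      by (subst (asm) has_sum_cong[where g="\<lambda>k. (w k * cmod ((if k \<in> J then c k else 0) - c k)) powr r"]) auto
    then show ?thesis
      using fin by (simp add: lp_norm_def infsumI)
  qed
  then have "\<forall>\<^sub>F J in finite_subsets_at_top K.
      (infsum ?f K - sum ?f J) powr (1 / r) = nrm (\<lambda>k. (if k \<in> J then c k else 0) - c k)"
    by (intro eventually_finite_subsets_at_top_weakI) auto
  ultimately have "((\<lambda>J. nrm (\<lambda>k. (if k \<in> J then c k else 0) - c k)) \<longlongrightarrow> 0 powr (1 / r))
      (finite_subsets_at_top K)"
    by (rule Lim_transform_eventually)
  then show ?thesis
    by simp
qed

end

section \<open>Resolvents of contractions\<close>

definition resolvent_op :: "('h::complex_hilbert \<Rightarrow> 'h) \<Rightarrow> complex \<Rightarrow> 'h \<Rightarrow> 'h" where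
  "resolvent_op T u = inv (\<lambda>x. x - u *\<^sub>C T x)"

locale contraction_op =
  fixes T :: "'h::complex_hilbert \<Rightarrow> 'h" and q :: real
  assumes T: "bounded_clinear T" and q: "0 \<le> q" "q < 1" and norm_le: "norm (T x) \<le> q * norm x"
begin

lemma resolvent_op:
  assumes "cmod u = 1"
  shows "bounded_clinear (resolvent_op T u)"
    and "resolvent_op T u x - u *\<^sub>C T (resolvent_op T u x) = x"
    and "resolvent_op T u (x - u *\<^sub>C T x) = x"
    and "norm (resolvent_op T u x) \<le> norm x / (1 - q)"
proof -
  note I = contraction_invertible[OF bounded_clinear_scaleC[OF T] q, of u]
  have *: "norm (u *\<^sub>C T x) \<le> q * norm x" for x
    using assms norm_le by (simp add: norm_scaleC)
  show "bounded_clinear (resolvent_op T u)"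
    "resolvent_op T u x - u *\<^sub>C T (resolvent_op T u x) = x"
    "resolvent_op T u (x - u *\<^sub>C T x) = x"
    "norm (resolvent_op T u x) \<le> norm x / (1 - q)"
    using invertible_operatorD(2-4)[OF I(1)[OF *]] I(2)[OF *] unfolding resolvent_op_def by simp_all
qed

lemma resolvent_op_eqI:
  assumes "cmod u = 1" "y - u *\<^sub>C T y = x"
  shows "resolvent_op T u x = y"
  using resolvent_op(3)[OF assms(1), of y] assms(2) by simp

text \<open>From \<open>R x - x = u T (R x)\<close> for the resolvent \<open>R\<close>. For the
  iterated squares of \<open>T\<close> the constant \<open>q\<close> tends to 0, so their resolvents
  converge strongly to the identity.\<close>

lemma resolvent_op_near:
  assumes "cmod u = 1"
  shows "norm (resolvent_op T u x - x) \<le> q * (norm x / (1 - q))"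
proof -
  have "resolvent_op T u x - x = u *\<^sub>C T (resolvent_op T u x)"
    using resolvent_op(2)[OF assms, of x] by (simp add: algebra_simps)
  then have "norm (resolvent_op T u x - x) \<le> q * norm (resolvent_op T u x)"
    using norm_le assms by (simp add: norm_scaleC)
  also have "\<dots> \<le> q * (norm x / (1 - q))"
    using resolvent_op(4)[OF assms] q by (intro mult_left_mono) auto
  finally show ?thesis .
qed

text \<open>Only resolvents occur on the right: the matrix of \<open>T\<close> itself is not yet known to lie in the
  algebra when the identity is used to estimate norms.\<close>

lemma resolvent_op_identity:
  assumes u: "cmod u = 1" and v: "cmod v = 1"
  shows "resolvent_op T u x - resolvent_op T v x =
    (1 - u * cnj v) *\<^sub>C (resolvent_op T u x - resolvent_op T u (resolvent_op T v x))"
proof -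
  let ?R = "resolvent_op T"
  note Ru = bounded_clinearD[OF resolvent_op(1)[OF u]]
  define y where "y = ?R v x"
  have x: "x = y - v *\<^sub>C T y"
    using resolvent_op(2)[OF v, of x] by (simp add: y_def)
  have uT: "u *\<^sub>C ?R u (T y) = ?R u y - y"
    using resolvent_op(3)[OF u, of y] by (simp add: Ru algebra_simps)
  have vv: "cnj v * v = 1"
    using v complex_norm_square[of v] by (simp add: mult.commute)
  have 1: "?R u x - ?R u y = (- v) *\<^sub>C ?R u (T y)"
    unfolding x by (simp add: Ru scaleC_minus_left)
  have 2: "?R u x - y = (u - v) *\<^sub>C ?R u (T y)"
    unfolding x scaleC_diff_left uT by (simp add: Ru)
  have 3: "(1 - u * cnj v) * (- v) = u - v"
    using vv by (simp add: algebra_simps)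
  show ?thesis
    unfolding y_def[symmetric] 1 2 scaleC_scaleC 3 ..
qed

lemma contraction_op_square: "contraction_op (\<lambda>x. T (T x)) (q\<^sup>2)"
proof
  show "bounded_clinear (\<lambda>x. T (T x))"
    by (rule bounded_clinear_comp[OF T T])
  show "0 \<le> q\<^sup>2" "q\<^sup>2 < 1"
    using q by (auto simp: power_less_one_iff abs_square_less_1)
  show "norm (T (T x)) \<le> q\<^sup>2 * norm x" for x
    using order_trans[OF norm_le mult_left_mono[OF norm_le q(1)], of x] by (simp add: power2_eq_square)
qed

text \<open>Partial fractions: 1 / (1 - a^2) is the mean of 1 / (1 - a) and 1 / (1 + a), here with a
  = u T.\<close>

lemma resolvent_op_square:
  assumes u: "cmod u = 1"
  shows "resolvent_op (\<lambda>x. T (T x)) (u\<^sup>2) x =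
    (1/2) *\<^sub>C (resolvent_op T u x + resolvent_op T (- u) x)"
proof -
  interpret sq: contraction_op "\<lambda>x. T (T x)" "q\<^sup>2"
    by (rule contraction_op_square)
  note Tl = bounded_clinearD[OF T]
  define y z where "y = resolvent_op T u x" and "z = resolvent_op T (-u) x"
  have y: "y - u *\<^sub>C T y = x" and z: "z + u *\<^sub>C T z = x"
    using resolvent_op(2)[of u x] resolvent_op(2)[of "-u" x] u
    by (simp_all add: y_def z_def scaleC_minus_left)
  \<comment> \<open>Uses the factorisation 1 - u^2 T^2 = (1 + u T) (1 - u T); for \<open>z\<close>
    the factors change places. In the sum of both results the terms u T x cancel.\<close>
  have "y - u\<^sup>2 *\<^sub>C T (T y) = (y - u *\<^sub>C T y) + u *\<^sub>C T (y - u *\<^sub>C T y)"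
    by (simp add: Tl scaleC_diff_right scaleC_scaleC power2_eq_square)
  then have y2: "y - u\<^sup>2 *\<^sub>C T (T y) = x + u *\<^sub>C T x"
    by (simp only: y)
  have "z - u\<^sup>2 *\<^sub>C T (T z) = (z + u *\<^sub>C T z) - u *\<^sub>C T (z + u *\<^sub>C T z)"
    by (simp add: Tl scaleC_add_right scaleC_scaleC power2_eq_square)
  then have z2: "z - u\<^sup>2 *\<^sub>C T (T z) = x - u *\<^sub>C T x"
    by (simp only: z)
  have "(y + z) - u\<^sup>2 *\<^sub>C T (T (y + z)) =
      (y - u\<^sup>2 *\<^sub>C T (T y)) + (z - u\<^sup>2 *\<^sub>C T (T z))"
    by (simp add: Tl scaleC_add_right)
  also have "\<dots> = 2 *\<^sub>C x"
    unfolding y2 z2 using scaleC_add_left[of 1 1 x] by simp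
  finally have "(y + z) - u\<^sup>2 *\<^sub>C T (T (y + z)) = 2 *\<^sub>C x" .
  then have "(1/2) *\<^sub>C ((y + z) - u\<^sup>2 *\<^sub>C T (T (y + z))) = x"
    by (simp add: scaleC_scaleC)
  then have "resolvent_op (\<lambda>x. T (T x)) (u\<^sup>2) x = (1/2) *\<^sub>C (y + z)"
    using u by (intro sq.resolvent_op_eqI) (simp_all add: norm_power Tl scaleC_diff_right scaleC_scaleC mult.commute)
  then show ?thesis
    by (simp add: y_def z_def)
qed

end

section \<open>Localization of the frame projection\<close>

context banach_star_matrix_algebra
begin

lemma zero_mem: "(\<lambda>k l. 0) \<in> \<A>"
  using scale_mem[OF id_mem, of 0] by simp

lemma diff_mem: "A \<in> \<A> \<Longrightarrow> B \<in> \<A> \<Longrightarrow> (\<lambda>k l. A k l - B k l) \<in> \<A>"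
  using add_mem[OF _ scale_mem[of B "-1"], of A] by simp

lemma norm_diff_le: "A \<in> \<A> \<Longrightarrow> B \<in> \<A> \<Longrightarrow> N (\<lambda>k l. A k l - B k l) \<le> N A + N B"
  using norm_triangle[OF _ scale_mem[of B "-1"], of A] norm_scale[of B "-1"] by simp

lemma norm_nonneg: "A \<in> \<A> \<Longrightarrow> 0 \<le> N A"
  using norm_diff_le[of A A] norm_eq_0_iff[OF zero_mem] by simp

lemma norm_diff_commute:
  "A \<in> \<A> \<Longrightarrow> B \<in> \<A> \<Longrightarrow> N (\<lambda>k l. A k l - B k l) = N (\<lambda>k l. B k l - A k l)"
  using norm_scale[of "\<lambda>k l. A k l - B k l" "-1"] by (simp add: diff_mem)

lemma norm_diff_triangle:
  "A \<in> \<A> \<Longrightarrow> B \<in> \<A> \<Longrightarrow> D \<in> \<A> \<Longrightarrow>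
    N (\<lambda>k l. A k l - D k l) \<le> N (\<lambda>k l. A k l - B k l) + N (\<lambda>k l. B k l - D k l)"
  using norm_triangle[of "\<lambda>k l. A k l - B k l" "\<lambda>k l. B k l - D k l"] by (simp add: diff_mem)

lemma geometric_Cauchy_limit:
  assumes X: "\<And>n::nat. X n \<in> \<A>" and c: "0 \<le> c" "c < 1" and "0 \<le> L"
    and step: "\<And>n. N (\<lambda>k l. X (Suc n) k l - X n k l) \<le> L * c ^ n"
  obtains A where "A \<in> \<A>" "(\<lambda>n. N (\<lambda>k l. X n k l - A k l)) \<longlonglongrightarrow> 0"
proof -
  \<comment> \<open>The tail of the geometric series from index \<open>n\<close> on; its differences
    dominate the steps, so the distances telescope.\<close>
  define s where "s n = L * c ^ n / (1 - c)" for n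
  have s: "s n - s (Suc n) = L * c ^ n" "0 \<le> s n" for n
  proof -
    have "s n - s (Suc n) = L * c ^ n * (1 - c) / (1 - c)"
      unfolding s_def diff_divide_distrib[symmetric] by (simp add: algebra_simps)
    then show "s n - s (Suc n) = L * c ^ n"
      using c by simp
    show "0 \<le> s n"
      using c \<open>0 \<le> L\<close> by (simp add: s_def)
  qed
  have le: "N (\<lambda>k l. X m k l - X n k l) \<le> s n - s m" if "n \<le> m" for n m
    using that
  proof (induction m rule: dec_induct)
    case base
    then show ?case
      using norm_eq_0_iff[OF zero_mem] by simp
  next
    case (step m)
    then show ?case
      using norm_diff_triangle[of "X (Suc m)" "X m" "X n"] X assms(5)[of m] s(1)[of m] by force
  qed
  have "s \<longlonglongrightarrow> 0"
    unfolding s_def using c by (auto intro!: tendsto_eq_intros LIMSEQ_power_zero)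
  have "\<exists>M. \<forall>m\<ge>M. \<forall>n\<ge>M. N (\<lambda>k l. X m k l - X n k l) < e" if "e > 0" for e
  proof -
    obtain M where M: "\<And>n. n \<ge> M \<Longrightarrow> s n < e"
      using LIMSEQ_D[OF \<open>s \<longlonglongrightarrow> 0\<close> \<open>e > 0\<close>] s(2) by auto
    have "N (\<lambda>k l. X m k l - X n k l) < e" if "m \<ge> M" "n \<ge> M" for m n
    proof (cases "n \<le> m")
      case True
      then show ?thesis
        using le[OF True] M[OF that(2)] s(2)[of m] by linarith
    next
      case False
      then show ?thesis
        using le[of m n] M[OF that(1)] s(2)[of n] norm_diff_commute[OF X X, of m n] by linarith
    qed
    then show ?thesis
      by blast
  qed
  from complete[OF X this] show ?thesis
    using that by blast
qed

end

context solid_spectral_matrix_algebra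
begin

text \<open>By solidity the matrix that keeps only the entry at (k, l) of a member \<open>A\<close>
  is again a member of no larger norm. If the matrix unit \<open>E\<close> belongs to the algebra,
  this gives the constant \<open>1 / N E\<close>; if it does not, every member vanishes at that
  position. Hence norm limits can be identified entrywise.\<close>

lemma entry_bound: "\<exists>c\<ge>0. \<forall>A\<in>\<A>. cmod (A k l) \<le> c * N A"
proof -
  define E :: "'a cmat" where "E = (\<lambda>i j. if i = k \<and> j = l then 1 else 0)"
  have sub: "(\<lambda>i j. A k l * E i j) \<in> \<A> \<and> N (\<lambda>i j. A k l * E i j) \<le> N A" if A: "A \<in> \<A>" for A
    using A subset_matrices by (intro solid) (auto simp: E_def matrices_def)
  show ?thesis
  proof (cases "E \<in> \<A>")
    case True
    have "E \<noteq> (\<lambda>i j. 0)"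
      by (auto simp: E_def fun_eq_iff)
    then have pos: "N E > 0"
      using norm_eq_0_iff[OF True] norm_nonneg[OF True] by linarith
    have "cmod (A k l) \<le> 1 / N E * N A" if "A \<in> \<A>" for A
      using sub[OF that] norm_scale[OF True, of "A k l"] pos by (simp add: field_simps)
    then show ?thesis
      using pos by (intro exI[of _ "1 / N E"]) auto
  next
    case False
    have "A k l = 0" if "A \<in> \<A>" for A
      using scale_mem[of "\<lambda>i j. A k l * E i j" "1 / A k l"] sub[OF that] False
      by (cases "A k l = 0") auto
    then show ?thesis
      by (intro exI[of _ 0]) auto
  qed
qed

lemma entry_tendsto:
  assumes "\<And>n::nat. X n \<in> \<A>" "A \<in> \<A>" "(\<lambda>n. N (\<lambda>k l. X n k l - A k l)) \<longlonglongrightarrow> 0"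
  shows "(\<lambda>n. X n k l) \<longlonglongrightarrow> A k l"
proof -
  obtain c where c: "\<And>A. A \<in> \<A> \<Longrightarrow> cmod (A k l) \<le> c * N A"
    using entry_bound by blast
  have "(\<lambda>n. X n k l - A k l) \<longlonglongrightarrow> 0"
  proof (rule Lim_null_comparison)
    show "\<forall>\<^sub>F n in sequentially. norm (X n k l - A k l) \<le> c * N (\<lambda>k l. X n k l - A k l)"
      using c[OF diff_mem[OF assms(1,2)]] by simp
    show "(\<lambda>n. c * N (\<lambda>k l. X n k l - A k l)) \<longlonglongrightarrow> 0"
      using tendsto_mult_left[OF assms(3), of c] by simp
  qed
  then show ?thesis
    by (simp add: LIM_zero_iff)
qed

end

section \<open>Matrices of the form identity minus \<open>M R\<close> on l^2\<close>

context hilbert_frame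
begin

sublocale l2: weighted_lp K 2 "\<lambda>_. 1"
  by unfold_locales (simp_all add: weight_def)

lemma op_matrix_add: "M (\<lambda>x. R x + T x) = (\<lambda>k l. M R k l + M T k l)"
  by (auto simp: op_matrix_def cinner_add_left fun_eq_iff)

lemma op_matrix_diff: "M (\<lambda>x. R x - T x) = (\<lambda>k l. M R k l - M T k l)"
  by (auto simp: op_matrix_def cinner_diff_left fun_eq_iff)

lemma op_matrix_scaleC: "M (\<lambda>x. a *\<^sub>C R x) = (\<lambda>k l. a * M R k l)"
  by (auto simp: op_matrix_def cinner_scaleC_left fun_eq_iff)

lemma analysis_diff: "C (f - g) = (\<lambda>k. C f k - C g k)"
  by (auto simp: analysis_def cinner_diff_left)

lemma dual_synthesis_diff:
  assumes "c \<in> l2" "d \<in> l2"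
  shows "dual_synthesis (\<lambda>k. c k - d k) = dual_synthesis c - dual_synthesis d"
proof -
  have "((\<lambda>k. c k *\<^sub>C \<phi> k + - (d k *\<^sub>C \<phi> k)) has_sum (dual_synthesis c + - dual_synthesis d)) K"
    using assms by (intro has_sum_add has_sum_uminus[THEN iffD2]) (simp_all add: dual_synthesis_has_sum)
  then show ?thesis
    using dual_synthesis_has_sum[OF l2.lp_diff[OF assms]] has_sum_unique
    by (fastforce simp: scaleC_diff_left)
qed

lemma id_minus_mat_vec_has_sum:
  assumes R: "bounded_clinear R" and c: "c \<in> l2" and k: "k \<in> K"
  shows "((\<lambda>l. (mat_id K k l - M R k l) * c l) has_sum (c k - C (R (dual_synthesis c)) k)) K"
proof -
  have "((\<lambda>l. mat_id K k l * c l) has_sum (\<Sum>l\<in>{k}. mat_id K k l * c l)) K"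
    using k by (intro has_sum_finite_neutralI[of "{k}"]) (auto simp: mat_id_def)
  then have "((\<lambda>l. mat_id K k l * c l + - (M R k l * c l)) has_sum (c k + - C (R (dual_synthesis c)) k)) K"
    using k by (intro has_sum_add has_sum_uminus[THEN iffD2])
      (simp_all add: op_matrix_mat_vec_has_sum R c mat_id_def)
  then show ?thesis
    by (simp add: algebra_simps)
qed

lemma id_minus_mat_vec:
  assumes R: "bounded_clinear R" and c: "c \<in> l2"
  shows "mat_vec K (\<lambda>k l. mat_id K k l - M R k l) c = (\<lambda>k. c k - C (R (dual_synthesis c)) k)"
proof
  fix k
  show "mat_vec K (\<lambda>k l. mat_id K k l - M R k l) c k = c k - C (R (dual_synthesis c)) k"
    using id_minus_mat_vec_has_sum[OF assms, of k] c
    by (cases "k \<in> K") (auto simp: mat_vec_def op_matrix_def analysis_def infsumI mat_id_def l2.lp_vanish)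
qed

lemma analysis_op_bound:
  assumes R: "bounded_clinear R"
  obtains b where "b \<ge> 0" "\<And>c. c \<in> l2 \<Longrightarrow> l2.nrm (C (R (dual_synthesis c))) \<le> b * l2.nrm c"
proof -
  obtain b1 where b1: "b1 > 0"
    "\<And>c. c \<in> l2 \<Longrightarrow> (norm (synthesis K \<psi> c))\<^sup>2 \<le> b1 * (\<Sum>\<^sub>\<infinity>k\<in>K. (cmod (c k))\<^sup>2)"
    by (metis synthesis_bound)
  obtain b2 where b2: "b2 > 0"
    "\<And>f. (\<Sum>\<^sub>\<infinity>k\<in>K. (cmod (cinner f (\<psi> k)))\<^sup>2) \<le> b2 * (norm f)\<^sup>2"
    by (metis frame_bounds)
  obtain b3 where b3: "b3 > 0" "\<And>x. norm (R (inv S x)) \<le> norm x * b3"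
    using bounded_linear.pos_bounded[OF bounded_clinearD(1)[OF bounded_clinear_comp[OF R S_inv(2)]]] by auto
  have "l2.nrm (C (R (dual_synthesis c))) \<le> sqrt b2 * (b3 * sqrt b1) * l2.nrm c" if c: "c \<in> l2" for c
  proof -
    have "l2.nrm (C (R (dual_synthesis c))) \<le> sqrt (b2 * (norm (R (dual_synthesis c)))\<^sup>2)"
      unfolding lp2_norm infsum_cmod_analysis by (rule real_sqrt_le_mono[OF b2(2)])
    also have "\<dots> = sqrt b2 * norm (R (dual_synthesis c))"
      by (simp add: real_sqrt_mult)
    also have "\<dots> \<le> sqrt b2 * (norm (synthesis K \<psi> c) * b3)"
      unfolding dual_synthesis_def using b2 b3 by (intro mult_left_mono) auto
    also have "norm (synthesis K \<psi> c) \<le> sqrt b1 * l2.nrm c"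
      using real_sqrt_le_mono[OF b1(2)[OF c]] by (simp add: lp2_norm real_sqrt_mult)
    finally show ?thesis
      using b2 b3 by (simp add: mult_ac)
  qed
  then show ?thesis
    using that[of "sqrt b2 * (b3 * sqrt b1)"] b1 b2 b3 by simp
qed

text \<open>Spectral invariance requires a candidate inverse that is already bounded on l^2. This
  bound has to come from the frame inequalities, since membership of the candidate in the algebra is
  what remains to be shown.\<close>

lemma id_minus_B_l2:
  assumes R: "bounded_clinear R"
  shows "(\<lambda>k l. mat_id K k l - M R k l) \<in> B_l2 K"
proof -
  let ?A = "\<lambda>k l. mat_id K k l - M R k l"
  obtain b where b: "b \<ge> 0" "\<And>c. c \<in> l2 \<Longrightarrow> l2.nrm (C (R (dual_synthesis c))) \<le> b * l2.nrm c"
    using analysis_op_bound[OF R] by blast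
  have "?A \<in> matrices K"
    by (auto simp: matrices_def mat_id_def op_matrix_def)
  moreover have "(\<lambda>l. ?A k l * c l) summable_on K" if "c \<in> l2" "k \<in> K" for c k
    using id_minus_mat_vec_has_sum[OF R that] has_sum_imp_summable by blast
  moreover have "mat_vec K ?A c \<in> l2" if "c \<in> l2" for c
    using that by (simp add: id_minus_mat_vec[OF R] l2.lp_diff analysis_l2)
  moreover have "l2.nrm (mat_vec K ?A c) \<le> (1 + b) * l2.nrm c" if "c \<in> l2" for c
    using l2.lp_norm_diff_le[OF that analysis_l2, of "R (dual_synthesis c)"] b(2)[OF that]
    by (simp add: id_minus_mat_vec[OF R that] algebra_simps)
  ultimately show ?thesis
    unfolding B_l2_def bounded_on_lp_def by blast
qed

text \<open>The condition on \<open>R\<close> and \<open>T\<close> says (1 - R) (1 - T) = 1 = (1 -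
  T) (1 - R). Since \<open>M\<close> is multiplicative, the identity carries over to matrices with
  the identity of l^2, although \<open>M\<close> sends the identity operator to a projection
  only.\<close>

lemma id_minus_inverse_on_l2:
  assumes R: "bounded_clinear R" and T: "bounded_clinear T"
    and RT: "\<And>x. R (T x) = R x + T x" and TR: "\<And>x. T (R x) = R x + T x"
  shows "inverse_on_l2 K (\<lambda>k l. mat_id K k l - M R k l) (\<lambda>k l. mat_id K k l - M T k l)"
proof -
  have *: "mat_vec K (\<lambda>k l. mat_id K k l - M R k l) (mat_vec K (\<lambda>k l. mat_id K k l - M T k l) c) = c"
    if R: "bounded_clinear R" and T: "bounded_clinear T" and RT: "\<And>x. R (T x) = R x + T x"
      and c: "c \<in> l2" for R T c
  proof -
    define x where "x = dual_synthesis c"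
    have "dual_synthesis (\<lambda>k. c k - C (T x) k) = x - T x"
      by (simp add: dual_synthesis_diff[OF c analysis_l2] x_def)
    moreover have "R (x - T x) = - T x"
      by (simp add: bounded_clinearD[OF R] RT)
    moreover have "C (- T x) = (\<lambda>k. - C (T x) k)"
      using analysis_diff[of 0 "T x"] by (auto simp: analysis_def fun_eq_iff)
    ultimately show ?thesis
      using c by (simp add: id_minus_mat_vec R T l2.lp_diff analysis_l2 x_def[symmetric])
  qed
  show ?thesis
    unfolding inverse_on_l2_def
    using id_minus_B_l2[OF T] *[OF R T RT] *[OF T R] TR by (auto simp: add.commute)
qed

end

section \<open>Operators whose matrix lies in the algebra\<close>

locale localized_frame =
  solid_spectral_matrix_algebra K \<A> N + hilbert_frame K \<psi>
  for K :: "'k set" and \<A> :: "'k cmat set" and N :: "'k cmat \<Rightarrow> real"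
    and \<psi> :: "'k \<Rightarrow> 'h::complex_hilbert" +
  assumes localized: "localized K \<A> \<psi>"
begin

abbreviation inA :: "('h \<Rightarrow> 'h) \<Rightarrow> bool" where
  "inA R \<equiv> bounded_clinear R \<and> M R \<in> \<A>"

lemma inA_frame_operator: "inA S"
  using localized frame_operator_bounded_clinear
  by (simp add: localized_def op_matrix_frame_operator)

lemma inA_comp: "inA R \<Longrightarrow> inA T \<Longrightarrow> inA (\<lambda>x. R (T x))"
  using mult_mem[of "M R" "M T"] by (simp add: op_matrix_mult bounded_clinear_comp)

lemma inA_diff: "inA R \<Longrightarrow> inA T \<Longrightarrow> inA (\<lambda>x. R x - T x)"
  by (simp add: op_matrix_diff bounded_clinear_diff diff_mem)

lemma inA_scaleC: "inA R \<Longrightarrow> inA (\<lambda>x. a *\<^sub>C R x)"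
  by (simp add: op_matrix_scaleC bounded_clinear_scaleC scale_mem)

text \<open>Spectral invariance in a form that does not presuppose \<open>M(1)\<close> in the
  algebra; it can therefore be used on the way to that fact.\<close>

lemma inA_quasi_inverse:
  assumes "inA R" "bounded_clinear T"
    and "\<And>x. R (T x) = R x + T x" "\<And>x. T (R x) = R x + T x"
  shows "inA T"
proof -
  have "(\<lambda>k l. mat_id K k l - M T k l) \<in> \<A>"
    using inverse_closed[OF _ id_minus_inverse_on_l2] assms diff_mem[OF id_mem] by blast
  from diff_mem[OF id_mem this] show ?thesis
    using assms by simp
qed

text \<open>The operator known to have its matrix in the algebra is the inverse \<open>V\<close> of
  \<open>W\<close>, not \<open>W\<close>. With \<open>R\<close> the resolvent, 1 - R = - u W R,
  while 1 - cnj u V = - cnj u V (1 - u W). The product is 1, so the resolvent is the quasi-inverse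
  of cnj u V.\<close>

lemma resolvent_op_inA:
  assumes "contraction_op W q" and V: "inA V" and VW: "\<And>x. V (W x) = x" "\<And>x. W (V x) = x"
    and u: "cmod u = 1"
  shows "inA (resolvent_op W u)"
proof (rule inA_quasi_inverse)
  interpret contraction_op W q
    by fact
  note Vl = bounded_clinearD[OF conjunct1[OF V]]
  have uu: "cnj u * u = 1"
    using u complex_norm_square[of u] by (simp add: mult.commute)
  let ?R = "\<lambda>x. cnj u *\<^sub>C V x" and ?T = "resolvent_op W u"
  note Tl = bounded_clinearD[OF resolvent_op(1)[OF u]]
  show "inA ?R"
    using V by (rule inA_scaleC)
  show "bounded_clinear ?T"
    using u by (rule resolvent_op)
  show "?R (?T x) = ?R x + ?T x" for x
    using arg_cong[OF resolvent_op(2)[OF u, of x], of ?R] uu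
    by (simp add: Vl VW scaleC_diff_right scaleC_scaleC algebra_simps)
  show "?T (?R x) = ?R x + ?T x" for x
  proof -
    have "W (?R x) = cnj u *\<^sub>C x"
      by (simp add: bounded_clinearD[OF T] VW)
    then show ?thesis
      using resolvent_op(3)[OF u, of "?R x"] uu
      by (simp add: Tl scaleC_scaleC mult.commute algebra_simps)
  qed
qed

text \<open>The resolvent identity bounds the difference by |u - v| N(F u) (1 + N(F v)), which still
  contains the unknown size of \<open>F u\<close>. Absorbing this factor for \<open>u\<close> near
  \<open>v\<close> gives a local bound, compactness of the circle makes it uniform, and the same
  estimate then becomes a Lipschitz bound.\<close>

lemma resolvent_op_Lipschitz:
  assumes "contraction_op W q" and inA: "\<And>u. cmod u = 1 \<Longrightarrow> inA (resolvent_op W u)"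
  obtains L where "0 \<le> L"
    "\<And>u v. cmod u = 1 \<Longrightarrow> cmod v = 1 \<Longrightarrow>
      N (\<lambda>k l. M (resolvent_op W u) k l - M (resolvent_op W v) k l) \<le> L * cmod (u - v)"
proof -
  interpret contraction_op W q
    by fact
  define F where "F u = M (resolvent_op W u)" for u
  have F: "F u \<in> \<A>" "0 \<le> N (F u)" if "cmod u = 1" for u
    using inA[OF that] norm_nonneg by (auto simp: F_def)
  have diff: "N (\<lambda>k l. F u k l - F v k l) \<le> cmod (u - v) * (N (F u) * (1 + N (F v)))"
    if u: "cmod u = 1" and v: "cmod v = 1" for u v
  proof -
    have "(\<lambda>k l. F u k l - F v k l) = M (\<lambda>x. resolvent_op W u x - resolvent_op W v x)"
      by (simp add: F_def op_matrix_diff)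
    also have "\<dots> = (\<lambda>k l. (1 - u * cnj v) * (F u k l - mat_mult K (F u) (F v) k l))"
      unfolding resolvent_op_identity[OF u v]
      by (simp add: F_def op_matrix_diff op_matrix_scaleC op_matrix_mult resolvent_op u v)
    finally have "N (\<lambda>k l. F u k l - F v k l) =
        cmod (1 - u * cnj v) * N (\<lambda>k l. F u k l - mat_mult K (F u) (F v) k l)"
      using norm_scale[OF diff_mem[OF F(1)[OF u] mult_mem[OF F(1)[OF u] F(1)[OF v]]]] by simp
    moreover have "cmod (1 - u * cnj v) = cmod (u - v)"
    proof -
      have "v * cnj v = 1"
        using v complex_norm_square[of v] by simp
      then have "(1 - u * cnj v) = (v - u) * cnj v"
        by (simp add: algebra_simps)
      then show ?thesis
        using v by (simp add: Real_Vector_Spaces.norm_mult norm_minus_commute)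
    qed
    moreover have "N (\<lambda>k l. F u k l - mat_mult K (F u) (F v) k l) \<le> N (F u) + N (F u) * N (F v)"
      using norm_diff_le[OF F(1)[OF u] mult_mem[OF F(1)[OF u] F(1)[OF v]]]
        norm_mult[OF F(1)[OF u] F(1)[OF v]] by linarith
    ultimately show ?thesis
      using mult_left_mono[of _ "N (F u) * (1 + N (F v))" "cmod (u - v)"] by (simp add: distrib_left)
  qed
  \<comment> \<open>Within this radius the difference of \<open>F u\<close> and \<open>F v\<close>
    has norm at most half of \<open>N (F u)\<close>, which can be moved to the left side.\<close>
  define \<delta> where "\<delta> v = 1 / (2 * (1 + N (F v)))" for v
  have local: "N (F u) \<le> 2 * N (F v)"
    if u: "cmod u = 1" and v: "cmod v = 1" and "dist u v < \<delta> v" for u v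
  proof -
    have "cmod (u - v) * (1 + N (F v)) \<le> 1/2"
      using that(3) F(2)[OF v] by (simp add: \<delta>_def dist_norm field_simps)
    then have "N (F u) * (cmod (u - v) * (1 + N (F v))) \<le> N (F u) * (1/2)"
      using F(2)[OF u] by (intro mult_left_mono)
    moreover have "N (F u) \<le> N (F v) + N (\<lambda>k l. F u k l - F v k l)"
      using norm_triangle[OF F(1)[OF v] diff_mem[OF F(1)[OF u] F(1)[OF v]]] by simp
    ultimately show ?thesis
      using diff[OF u v] by (simp add: mult_ac)
  qed
  have "\<exists>b. \<forall>u\<in>sphere 0 1. N (F u) \<le> b"
  proof -
    have "sphere (0::complex) 1 \<subseteq> (\<Union>v\<in>sphere 0 1. ball v (\<delta> v))"
      using F(2) by (force simp: \<delta>_def add_pos_nonneg)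
    then obtain D where D: "D \<subseteq> sphere 0 1" "finite D" "sphere (0::complex) 1 \<subseteq> (\<Union>v\<in>D. ball v (\<delta> v))"
      by (rule compactE_image[OF compact_sphere, rotated]) auto
    have "N (F u) \<le> (\<Sum>v\<in>D. 2 * N (F v))" if u: "u \<in> sphere 0 1" for u
    proof -
      obtain v where v: "v \<in> D" "dist u v < \<delta> v"
        using D(3) u by (auto simp: dist_commute)
      have "N (F u) \<le> 2 * N (F v)"
        using local v D(1) u by auto
      also have "\<dots> \<le> (\<Sum>v\<in>D. 2 * N (F v))"
        using D(1,2) F(2) v(1) by (intro member_le_sum) auto
      finally show ?thesis .
    qed
    then show ?thesis
      by blast
  qed
  then obtain b where b: "\<And>u. cmod u = 1 \<Longrightarrow> N (F u) \<le> b"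
    by (metis mem_sphere_0)
  then have b0: "0 \<le> b"
    by (meson F(2) norm_one order_trans)
  have "N (\<lambda>k l. F u k l - F v k l) \<le> (b * (1 + b)) * cmod (u - v)"
    if u: "cmod u = 1" and v: "cmod v = 1" for u v
  proof -
    have "N (F u) * (1 + N (F v)) \<le> b * (1 + b)"
      using b[OF u] b[OF v] F(2)[OF u] F(2)[OF v] b0 by (intro mult_mono) auto
    then have "cmod (u - v) * (N (F u) * (1 + N (F v))) \<le> cmod (u - v) * (b * (1 + b))"
      by (intro mult_left_mono) auto
    then show ?thesis
      using diff[OF u v] by (simp add: mult_ac)
  qed
  then show ?thesis
    using that[of "b * (1 + b)"] b0 by (auto simp: F_def)
qed

text \<open>Taking square roots on the unit circle, with the roots chosen close together, gains a factor
  \<open>sqrt 2\<close> in the Lipschitz constant.\<close>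

lemma resolvent_op_Lipschitz_square:
  assumes W: "contraction_op W q" and inA: "\<And>u. cmod u = 1 \<Longrightarrow> inA (resolvent_op W u)"
    and "0 \<le> L" and Lip: "\<And>u v. cmod u = 1 \<Longrightarrow> cmod v = 1 \<Longrightarrow>
      N (\<lambda>k l. M (resolvent_op W u) k l - M (resolvent_op W v) k l) \<le> L * cmod (u - v)"
    and u: "cmod u = 1" and v: "cmod v = 1"
  shows "inA (resolvent_op (\<lambda>x. W (W x)) u)"
    and "N (\<lambda>k l. M (resolvent_op (\<lambda>x. W (W x)) u) k l - M (resolvent_op (\<lambda>x. W (W x)) v) k l)
      \<le> L / sqrt 2 * cmod (u - v)"
proof -
  interpret contraction_op W q
    by fact
  interpret sq: contraction_op "\<lambda>x. W (W x)" "q\<^sup>2"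
    by (rule contraction_op_square)
  define F where "F u = M (resolvent_op W u)" for u
  have F: "F u \<in> \<A>" if "cmod u = 1" for u
    using inA[OF that] by (simp add: F_def)
  have sq: "M (resolvent_op (\<lambda>x. W (W x)) (a\<^sup>2)) = (\<lambda>k l. (1/2) * (F a k l + F (- a) k l))"
    if "cmod a = 1" for a
    unfolding ext[OF resolvent_op_square[OF that]] by (simp add: op_matrix_scaleC op_matrix_add F_def)
  have root: "\<exists>a. a\<^sup>2 = u \<and> cmod a = 1" if "cmod u = 1" for u
    using that by (intro exI[of _ "csqrt u"]) (simp add: norm_csqrt)
  obtain a where a: "a\<^sup>2 = u" "cmod a = 1"
    using root[OF u] by blast
  show "inA (resolvent_op (\<lambda>x. W (W x)) u)"
    using sq[OF a(2)] scale_mem[OF add_mem[OF F F], of a "-a" "1/2"] a sq.resolvent_op(1)[OF u] by simp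
  obtain b0 where b0: "b0\<^sup>2 = v" "cmod b0 = 1"
    using root[OF v] by blast
  \<comment> \<open>The sign of the root of \<open>v\<close> is free. By the parallelogram law the
    squared moduli of \<open>a + b0\<close> and \<open>a - b0\<close> add up to 4, so one of them
    has modulus at least \<open>sqrt 2\<close>. Choosing that one as \<open>a + b\<close>, the
    factorisation u - v = (a - b) (a + b) bounds the distance of the roots by |u - v| / sqrt
    2.\<close>
  define b where "b = (if sqrt 2 \<le> cmod (a + b0) then b0 else - b0)"
  have b: "b\<^sup>2 = v" "cmod b = 1"
    using b0 by (auto simp: b_def)
  have "(cmod (a + b0))\<^sup>2 + (cmod (a - b0))\<^sup>2 = 2 * (cmod a)\<^sup>2 + 2 * (cmod b0)\<^sup>2"
    unfolding cmod_power2 by (simp add: power2_eq_square algebra_simps)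
  then have "(cmod (a + b0))\<^sup>2 + (cmod (a - b0))\<^sup>2 = 4"
    using a b0 by simp
  then have "sqrt 2 \<le> cmod (a + b)"
  proof (cases "sqrt 2 \<le> cmod (a + b0)")
    case False
    then have "(cmod (a + b0))\<^sup>2 < (sqrt 2)\<^sup>2"
      by (intro power_strict_mono) auto
    then have "(sqrt 2)\<^sup>2 \<le> (cmod (a - b0))\<^sup>2"
      using \<open>(cmod (a + b0))\<^sup>2 + (cmod (a - b0))\<^sup>2 = 4\<close> by simp
    then show ?thesis
      using False by (simp add: b_def power2_le_iff_abs_le real_le_lsqrt)
  qed (simp add: b_def)
  moreover have "u - v = (a - b) * (a + b)"
    unfolding a(1)[symmetric] b(1)[symmetric] by (simp add: power2_eq_square algebra_simps)
  ultimately have ab: "cmod (a - b) * sqrt 2 \<le> cmod (u - v)"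
    by (simp add: Real_Vector_Spaces.norm_mult mult.commute[of "cmod (a + b)"] mult_left_mono)
  let ?D = "\<lambda>a b k l. F a k l - F b k l"
  have D: "?D a b \<in> \<A>" "?D (- a) (- b) \<in> \<A>"
    using a b F by (auto intro!: diff_mem)
  have "N (\<lambda>k l. M (resolvent_op (\<lambda>x. W (W x)) u) k l - M (resolvent_op (\<lambda>x. W (W x)) v) k l) =
      N (\<lambda>k l. (1/2) * (?D a b k l + ?D (- a) (- b) k l))"
    unfolding a(1)[symmetric] b(1)[symmetric] sq[OF a(2)] sq[OF b(2)] by (simp add: algebra_simps)
  also have "\<dots> = (1/2) * N (\<lambda>k l. ?D a b k l + ?D (- a) (- b) k l)"
    using norm_scale[OF add_mem[OF D], of "1/2"] by simp
  also have "\<dots> \<le> (1/2) * (N (?D a b) + N (?D (- a) (- b)))"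
    using norm_triangle[OF D] by simp
  also have "\<dots> \<le> (1/2) * (L * cmod (a - b) + L * cmod (- a - - b))"
    using Lip[of a b] Lip[of "-a" "-b"] a b by (intro mult_left_mono add_mono) (auto simp: F_def)
  also have "\<dots> = L * cmod (a - b)"
    by (simp add: norm_minus_commute)
  also have "\<dots> \<le> L * (cmod (u - v) / sqrt 2)"
    using ab \<open>0 \<le> L\<close> by (intro mult_left_mono) (auto simp: field_simps)
  finally show "N (\<lambda>k l. M (resolvent_op (\<lambda>x. W (W x)) u) k l - M (resolvent_op (\<lambda>x. W (W x)) v) k l)
      \<le> L / sqrt 2 * cmod (u - v)"
    by simp
qed

lemma inA_id: "inA (\<lambda>x. x)"
proof -
  obtain b where b: "b > 0" "\<And>x. norm (inv S x) \<le> norm x * b"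
    using bounded_linear.pos_bounded[OF bounded_clinearD(1)[OF S_inv(2)]] by auto
  \<comment> \<open>\<open>W\<close> is a multiple of \<open>inv S\<close> because its inverse
    \<open>V\<close> must be a multiple of \<open>S\<close>, whose matrix is the Gram matrix; this
    \<open>\<rho>\<close> makes the norm of \<open>W\<close> at most 1/2.\<close>
  define \<rho> where "\<rho> = 1 / (2 * b)"
  define W where "W x = of_real \<rho> *\<^sub>C inv S x" for x
  define V where "V x = of_real (1 / \<rho>) *\<^sub>C S x" for x
  have \<rho>: "\<rho> > 0"
    using b(1) by (simp add: \<rho>_def)
  interpret W: contraction_op W "1/2"
  proof
    show "bounded_clinear W"
      unfolding W_def by (intro bounded_clinear_scaleC S_inv)
    show "norm (W x) \<le> 1/2 * norm x" for x
    proof -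
      have "norm (W x) = \<rho> * norm (inv S x)"
        using \<rho> by (simp add: W_def norm_scaleC)
      also have "\<dots> \<le> 1/2 * norm x"
        using b(2)[of x] b(1) by (simp add: \<rho>_def field_simps)
      finally show ?thesis .
    qed
  qed simp_all
  have V: "inA V"
    unfolding V_def by (rule inA_scaleC[OF inA_frame_operator])
  have VW: "V (W x) = x" "W (V x) = x" for x
    using \<rho> by (simp_all add: V_def W_def bounded_clinearD[OF S_inv(1)] bounded_clinearD[OF S_inv(2)]
        S_inv(3,4) scaleC_scaleC)
  \<comment> \<open>Iterated squaring: \<open>T n\<close> is the power of \<open>W\<close> with
    exponent 2^n, hence the contraction constant \<open>\<epsilon> n\<close> below.\<close>
  define T where "T = rec_nat W (\<lambda>_ T x. T (T x))"
  have T: "T 0 = W" "T (Suc n) = (\<lambda>x. T n (T n x))" for n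
    by (simp_all add: T_def)
  define \<epsilon> where "\<epsilon> n = (1/2 :: real) ^ (2 ^ n)" for n :: nat
  have contr: "contraction_op (T n) (\<epsilon> n)" for n
  proof (induction n)
    case 0
    then show ?case
      using W.contraction_op_axioms by (simp add: T \<epsilon>_def)
  next
    case (Suc n)
    then show ?case
      using contraction_op.contraction_op_square[OF Suc]
      by (simp add: T \<epsilon>_def mult.commute flip: power_mult)
  qed
  have base: "inA (resolvent_op W u)" if "cmod u = 1" for u
    using resolvent_op_inA[OF W.contraction_op_axioms V VW that] by simp
  obtain L where L: "0 \<le> L" "\<And>u v. cmod u = 1 \<Longrightarrow> cmod v = 1 \<Longrightarrow>
      N (\<lambda>k l. M (resolvent_op W u) k l - M (resolvent_op W v) k l) \<le> L * cmod (u - v)"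
    using resolvent_op_Lipschitz[OF W.contraction_op_axioms base] by blast
  have main: "(\<forall>u. cmod u = 1 \<longrightarrow> inA (resolvent_op (T n) u)) \<and>
      (\<forall>u v. cmod u = 1 \<longrightarrow> cmod v = 1 \<longrightarrow>
        N (\<lambda>k l. M (resolvent_op (T n) u) k l - M (resolvent_op (T n) v) k l)
          \<le> L * (1 / sqrt 2) ^ n * cmod (u - v))" for n
  proof (induction n)
    case 0
    then show ?case
      using L base by (simp add: T)
  next
    case (Suc n)
    have "0 \<le> L * (1 / sqrt 2) ^ n"
      using L(1) by simp
    from resolvent_op_Lipschitz_square[OF contr _ this] Suc show ?case
      by (simp add: T)
  qed
  define X where "X n = M (resolvent_op (T n) 1)" for n
  have X: "X n \<in> \<A>" for n
    using main[of n] by (simp add: X_def)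
  \<comment> \<open>The increment is half the difference of the resolvent matrices at -1 and 1. The
    distance 2 between these points cancels the factor 1/2.\<close>
  have step: "N (\<lambda>k l. X (Suc n) k l - X n k l) \<le> L * (1 / sqrt 2) ^ n" for n
  proof -
    have "X (Suc n) = (\<lambda>k l. (1/2) * (X n k l + M (resolvent_op (T n) (-1)) k l))"
    proof -
      have "resolvent_op (T (Suc n)) 1 =
          (\<lambda>x. (1/2) *\<^sub>C (resolvent_op (T n) 1 x + resolvent_op (T n) (-1) x))"
        using contraction_op.resolvent_op_square[OF contr, of 1 n] by (simp add: T fun_eq_iff)
      then show ?thesis
        by (simp add: X_def op_matrix_scaleC op_matrix_add)
    qed
    then have "(\<lambda>k l. X (Suc n) k l - X n k l) =
        (\<lambda>k l. (1/2) * (M (resolvent_op (T n) (-1)) k l - X n k l))"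
      by (simp add: fun_eq_iff field_simps)
    then have "N (\<lambda>k l. X (Suc n) k l - X n k l) =
        (1/2) * N (\<lambda>k l. M (resolvent_op (T n) (-1)) k l - X n k l)"
      using norm_scale[OF diff_mem, of "M (resolvent_op (T n) (-1))" "X n" "1/2"] main[of n] X by simp
    also have "\<dots> \<le> (1/2) * (L * (1 / sqrt 2) ^ n * cmod (-1 - 1))"
      using main[of n, THEN conjunct2, rule_format, of "-1" 1]
      by (intro mult_left_mono) (simp_all add: X_def)
    finally show ?thesis
      by simp
  qed
  obtain A where A: "A \<in> \<A>" "(\<lambda>n. N (\<lambda>k l. X n k l - A k l)) \<longlonglongrightarrow> 0"
    by (rule geometric_Cauchy_limit[OF X _ _ L(1) step]) auto
  \<comment> \<open>Entries are continuous for \<open>N\<close>, and for a single entry strong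
    convergence of the resolvents to the identity is enough.\<close>
  have "A = M (\<lambda>x. x)"
  proof (intro ext)
    fix k l
    have "(\<lambda>n. resolvent_op (T n) 1 (\<phi> l)) \<longlonglongrightarrow> \<phi> l"
    proof (rule LIM_zero_cancel, rule Lim_null_comparison)
      have le: "\<epsilon> n \<le> (1/2) ^ n" for n
        unfolding \<epsilon>_def by (intro power_decreasing) (auto simp: less_imp_le)
      have half: "\<epsilon> n \<le> 1/2" for n
        using power_decreasing[of 1 "2 ^ n" "1/2::real"] by (simp add: \<epsilon>_def)
      show "\<forall>\<^sub>F n in sequentially. norm (resolvent_op (T n) 1 (\<phi> l) - \<phi> l) \<le> (1/2) ^ n * (norm (\<phi> l) / (1/2))"
      proof (intro always_eventually allI)
        fix n
        have "norm (resolvent_op (T n) 1 (\<phi> l) - \<phi> l) \<le> \<epsilon> n * (norm (\<phi> l) / (1 - \<epsilon> n))"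
          using contraction_op.resolvent_op_near[OF contr, of 1 n "\<phi> l"] by simp
        also have "\<dots> \<le> (1/2) ^ n * (norm (\<phi> l) / (1/2))"
          using le[of n] half[of n] by (intro mult_mono divide_left_mono) auto
        finally show "norm (resolvent_op (T n) 1 (\<phi> l) - \<phi> l) \<le> (1/2) ^ n * (norm (\<phi> l) / (1/2))" .
      qed
      show "(\<lambda>n. (1/2) ^ n * (norm (\<phi> l) / (1/2))) \<longlonglongrightarrow> 0"
        by (auto intro!: tendsto_eq_intros LIMSEQ_power_zero)
    qed
    then have "(\<lambda>n. X n k l) \<longlonglongrightarrow> M (\<lambda>x. x) k l"
      using bounded_linear.tendsto[OF bounded_linear_cinner_left] by (auto simp: X_def op_matrix_def)
    then show "A k l = M (\<lambda>x. x) k l"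
      using entry_tendsto[OF X A] LIMSEQ_unique by blast
  qed
  then show ?thesis
    using A(1) bounded_clinear_id by simp
qed

lemma inA_inv:
  assumes "invertible_operator R" "M R \<in> \<A>"
  shows "inA (inv R)"
proof -
  note RI = invertible_operatorD[OF assms(1)]
  note lin = bounded_clinearD[OF RI(1)] bounded_clinearD[OF RI(2)]
  have "inA (\<lambda>x. x - inv R x)"
  \<comment> \<open>Since (1 - R) (1 - inv R) = (1 - R) + (1 - inv R), these two operators are
    quasi-inverse to each other. Only now is \<open>inA_id\<close> required, to place
    \<open>1 - R\<close> in the algebra.\<close>
  proof (rule inA_quasi_inverse)
    show "inA (\<lambda>x. x - R x)"
      using assms RI by (intro inA_diff inA_id) simp
    show "bounded_clinear (\<lambda>x. x - inv R x)"
      by (intro bounded_clinear_diff bounded_clinear_id RI)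
  qed (simp_all add: lin RI)
  from inA_diff[OF inA_id this] show ?thesis
    by simp
qed

end

section \<open>Matrices on weighted sequence spaces\<close>

text \<open>Lebesgue's theorem for the counting measure. For \<open>p = \<infinity>\<close> it
  replaces the norm continuity of matrix action, because only coordinatewise limits are available
  there.\<close>

lemma infsum_dominated_convergence:
  fixes s :: "nat \<Rightarrow> 'a \<Rightarrow> complex" and h :: "'a \<Rightarrow> real"
  assumes h: "h summable_on A" and le: "\<And>n x. x \<in> A \<Longrightarrow> norm (s n x) \<le> h x"
    and lim: "\<And>x. x \<in> A \<Longrightarrow> (\<lambda>n. s n x) \<longlonglongrightarrow> f x"
  shows "(\<lambda>n. infsum (s n) A) \<longlonglongrightarrow> infsum f A"
proof -
  have eq: "infsum g A = integral\<^sup>L (count_space A) g"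
    if "integrable (count_space A) g" for g :: "'a \<Rightarrow> complex"
    using that by (simp add: infsetsum_infsum[symmetric] Infinite_Set_Sum.abs_summable_on_def infsetsum_def)
  have hint: "integrable (count_space A) h"
    using h summable_on_iff_abs_summable_on_real[of h A] abs_summable_equivalent[of h A]
    unfolding Infinite_Set_Sum.abs_summable_on_def by blast
  have *: "f \<in> borel_measurable (count_space A)" "\<And>n. s n \<in> borel_measurable (count_space A)"
    "AE x in count_space A. (\<lambda>n. s n x) \<longlonglongrightarrow> f x"
    "\<And>n. AE x in count_space A. norm (s n x) \<le> h x"
    using le lim by (auto simp: AE_count_space)
  show ?thesis
    using integral_dominated_convergence[OF *(1,2) hint *(3,4)]
      eq[OF integrable_dominated_convergence[OF *(1,2) hint *(3,4)]]
      eq[OF integrable_dominated_convergence2[OF *(1,2) hint *(3,4)]] by simp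
qed

text \<open>Elements of coorbit spaces are classes of sequences, while unordered sums converge along
  finite subsets; countability of the index set links the two.\<close>

lemma countable_exhaustion:
  assumes "countable K"
  obtains J :: "nat \<Rightarrow> 'a set" where "\<And>n. finite (J n)" "\<And>n. J n \<subseteq> K"
    "filterlim J (finite_subsets_at_top K) sequentially"
proof -
  define J where "J n = {k \<in> K. to_nat_on K k \<le> n}" for n
  have fin: "finite (J n)" for n
  proof (rule finite_imageD)
    show "finite (to_nat_on K ` J n)"
      by (rule finite_subset[of _ "{..n}"]) (auto simp: J_def)
    show "inj_on (to_nat_on K) (J n)"
      using inj_on_to_nat_on[OF assms] by (rule inj_on_subset) (auto simp: J_def)
  qed
  have "\<forall>\<^sub>F n in sequentially. finite (J n) \<and> X \<subseteq> J n \<and> J n \<subseteq> K" if X: "finite X" "X \<subseteq> K" for X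
  proof -
    obtain m where m: "\<And>k. k \<in> X \<Longrightarrow> to_nat_on K k \<le> m"
      using finite_nat_set_iff_bounded_le[of "to_nat_on K ` X"] X(1) by auto
    have "finite (J n) \<and> X \<subseteq> J n \<and> J n \<subseteq> K" if "n \<ge> m" for n
      using m X(2) that fin by (fastforce simp: J_def)
    then show ?thesis
      by (auto simp: eventually_sequentially)
  qed
  then have "filterlim J (finite_subsets_at_top K) sequentially"
    by (simp add: filterlim_finite_subsets_at_top)
  moreover have "J n \<subseteq> K" for n
    by (auto simp: J_def)
  ultimately show ?thesis
    using that[of J] fin by blast
qed

section \<open>Action of the algebra on weighted l^p\<close>

locale coorbit_setting =
  localized_frame K \<A> N \<psi> + weighted_lp K p w
  for K :: "'k set" and \<A> :: "'k cmat set" and N :: "'k cmat \<Rightarrow> real"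
    and \<psi> :: "'k \<Rightarrow> 'h::complex_hilbert" and p :: ennreal and w :: "'k \<Rightarrow> real" +
  assumes countable: "countable K" and admissible: "admissible K \<A> w"
begin

lemma bounded_on_lp: "A \<in> \<A> \<Longrightarrow> bounded_on_lp K p w A"
  using admissible p by (simp add: admissible_def)

lemma mat_vec_summable: "A \<in> \<A> \<Longrightarrow> c \<in> Lp \<Longrightarrow> k \<in> K \<Longrightarrow> (\<lambda>l. A k l * c l) summable_on K"
  using bounded_on_lp by (simp add: bounded_on_lp_def)

lemma mat_vec_lp: "A \<in> \<A> \<Longrightarrow> c \<in> Lp \<Longrightarrow> mat_vec K A c \<in> Lp"
  using bounded_on_lp by (simp add: bounded_on_lp_def)

lemma mat_vec_bound:
  assumes "A \<in> \<A>"
  obtains b where "0 \<le> b" "\<And>c. c \<in> Lp \<Longrightarrow> nrm (mat_vec K A c) \<le> b * nrm c"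
proof -
  obtain b where b: "\<And>c. c \<in> Lp \<Longrightarrow> nrm (mat_vec K A c) \<le> b * nrm c"
    using bounded_on_lp[OF assms] by (auto simp: bounded_on_lp_def)
  have "nrm (mat_vec K A c) \<le> max b 0 * nrm c" if "c \<in> Lp" for c
    using b[OF that] mult_right_mono[OF max.cobounded1 lp_norm_nonneg[OF that], of b 0] by linarith
  then show ?thesis
    using that[of "max b 0"] by simp
qed

lemma mat_vec_outside: "A \<in> \<A> \<Longrightarrow> k \<notin> K \<Longrightarrow> mat_vec K A c k = 0"
  using subset_matrices by (auto simp: mat_vec_def matrices_def)

lemma mat_vec_scale: "mat_vec K A (\<lambda>l. a * c l) = (\<lambda>k. a * mat_vec K A c k)"
  by (simp add: mat_vec_def mult.left_commute infsum_cmult_right')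

lemma mat_vec_add:
  assumes "A \<in> \<A>" "c \<in> Lp" "d \<in> Lp"
  shows "mat_vec K A (\<lambda>l. c l + d l) = (\<lambda>k. mat_vec K A c k + mat_vec K A d k)"
proof
  fix k
  show "mat_vec K A (\<lambda>l. c l + d l) k = mat_vec K A c k + mat_vec K A d k"
  proof (cases "k \<in> K")
    case True
    then show ?thesis
      using assms by (simp add: mat_vec_def distrib_left infsum_add mat_vec_summable)
  next
    case False
    then show ?thesis
      using assms by (simp add: mat_vec_outside)
  qed
qed

lemma mat_vec_diff:
  assumes "A \<in> \<A>" "c \<in> Lp" "d \<in> Lp"
  shows "mat_vec K A (\<lambda>l. c l - d l) = (\<lambda>k. mat_vec K A c k - mat_vec K A d k)"
  using mat_vec_add[OF assms(1,2) lp_scale[OF assms(3), of "-1"]] mat_vec_scale[of A "-1" d] by simp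

text \<open>The filter is arbitrary, since the lemma serves both for sequences and for the finite
  subsets of \<open>K\<close>.\<close>

lemma mat_vec_tendsto:
  assumes "A \<in> \<A>" "\<And>x. c x \<in> Lp" "d \<in> Lp" "((\<lambda>x. nrm (\<lambda>k. c x k - d k)) \<longlongrightarrow> 0) F"
  shows "((\<lambda>x. nrm (\<lambda>k. mat_vec K A (c x) k - mat_vec K A d k)) \<longlongrightarrow> 0) F"
proof -
  obtain b where b: "0 \<le> b" "\<And>c. c \<in> Lp \<Longrightarrow> nrm (mat_vec K A c) \<le> b * nrm c"
    using mat_vec_bound[OF assms(1)] by blast
  show ?thesis
  proof (rule Lim_null_comparison)
    show "\<forall>\<^sub>F x in F. norm (nrm (\<lambda>k. mat_vec K A (c x) k - mat_vec K A d k)) \<le> b * nrm (\<lambda>k. c x k - d k)"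
      using b(2)[OF lp_diff[OF assms(2,3)]] assms
      by (simp add: mat_vec_diff lp_norm_nonneg lp_diff mat_vec_lp)
    show "((\<lambda>x. b * nrm (\<lambda>k. c x k - d k)) \<longlongrightarrow> 0) F"
      using tendsto_mult_left[OF assms(4), of b] by simp
  qed
qed

text \<open>Solidity provides the absolute convergence needed to exchange the two sums.\<close>

lemma mat_vec_mat_mult:
  assumes A: "A \<in> \<A>" and B: "B \<in> \<A>" and c: "c \<in> Lp"
  shows "mat_vec K (mat_mult K A B) c = mat_vec K A (mat_vec K B c)"
proof
  fix k
  show "mat_vec K (mat_mult K A B) c k = mat_vec K A (mat_vec K B c) k"
  proof (cases "k \<in> K")
    case False
    then show ?thesis
      using A B by (simp add: mat_vec_outside mult_mem)
  next
    case k: True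
    define B' :: "'k cmat" where "B' = (\<lambda>m l. of_real (cmod (B m l)))"
    define c' :: "'k cseq" where "c' = (\<lambda>l. of_real (cmod (c l)))"
    have "B' \<in> matrices K"
      using B subset_matrices by (auto simp: matrices_def B'_def)
    then have B': "B' \<in> \<A>"
      using solid[OF B, of B'] by (simp add: B'_def)
    have c': "c' \<in> Lp"
      unfolding c'_def by (rule lp_cmod[OF c])
    have sm: "(\<lambda>l. cmod (B m l) * cmod (c l)) summable_on K" if "m \<in> K" for m
      using mat_vec_summable[OF B c that]
      by (simp add: summable_on_iff_abs_summable_on_complex Real_Vector_Spaces.norm_mult)
    have row: "mat_vec K B' c' m = of_real (\<Sum>\<^sub>\<infinity>l\<in>K. cmod (B m l) * cmod (c l))" if "m \<in> K" for m
      using infsumI[OF has_sum_bounded_linear[OF bounded_linear_of_real has_sum_infsum[OF sm[OF that]]]]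
      by (simp add: mat_vec_def B'_def c'_def)
    \<comment> \<open>\<open>A\<close> acts on the nonnegative sequence of absolute row sums.
      Summability of complex families is absolute, so \<open>A\<close> itself need not be replaced
      by its absolute values.\<close>
    have "(\<lambda>m. A k m * mat_vec K B' c' m) summable_on K"
      by (rule mat_vec_summable[OF A mat_vec_lp[OF B' c'] k])
    then have "(\<lambda>m. cmod (A k m * mat_vec K B' c' m)) summable_on K"
      by (simp add: summable_on_iff_abs_summable_on_complex)
    then have outer: "(\<lambda>m. cmod (A k m) * (\<Sum>\<^sub>\<infinity>l\<in>K. cmod (B m l) * cmod (c l))) summable_on K"
      by (rule summable_on_cong[THEN iffD1, rotated])
        (simp add: row Real_Vector_Spaces.norm_mult infsum_nonneg)
    have "(\<lambda>(m, l). A k m * B m l * c l) summable_on K \<times> K"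
    proof (rule abs_summable_summable, subst Infinite_Sum.abs_summable_on_Sigma_iff, intro conjI ballI)
      show "(\<lambda>l. norm (case (m, l) of (m, l) \<Rightarrow> A k m * B m l * c l)) summable_on K" if "m \<in> K" for m
        using summable_on_cmult_right[OF sm[OF that], of "cmod (A k m)"]
        by (simp add: Real_Vector_Spaces.norm_mult mult.assoc)
      show "(\<lambda>m. norm (\<Sum>\<^sub>\<infinity>l\<in>K. norm (case (m, l) of (m, l) \<Rightarrow> A k m * B m l * c l))) summable_on K"
        using outer
        by (simp add: Real_Vector_Spaces.norm_mult mult.assoc infsum_cmult_right' infsum_nonneg abs_mult)
    qed
    then have "(\<Sum>\<^sub>\<infinity>m\<in>K. \<Sum>\<^sub>\<infinity>l\<in>K. A k m * B m l * c l) = (\<Sum>\<^sub>\<infinity>l\<in>K. \<Sum>\<^sub>\<infinity>m\<in>K. A k m * B m l * c l)"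
      by (rule infsum_swap_banach)
    then show ?thesis
      by (simp add: mat_vec_def mat_mult_def infsum_cmult_left' infsum_cmult_right' mult.assoc
          flip: infsum_cmult_left')
  qed
qed

lemma act_comp:
  assumes "inA R" "inA T" "c \<in> Lp"
  shows "mat_vec K (M R) (mat_vec K (M T) c) = mat_vec K (M (\<lambda>x. R (T x))) c"
  using mat_vec_mat_mult[of "M R" "M T" c] assms by (simp add: op_matrix_mult)

section \<open>Coorbit spaces as spaces of coefficient sequences\<close>

abbreviation "dc \<equiv> dual_coef K \<psi>"

definition coefs :: "'k cseq set" where
  "coefs = {\<alpha> \<in> Lp. mat_vec K (M (\<lambda>x. x)) \<alpha> = \<alpha>}"

lemma act_coefs: "inA R \<Longrightarrow> c \<in> Lp \<Longrightarrow> mat_vec K (M R) c \<in> coefs"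
  using act_comp[OF inA_id, of R c] by (simp add: coefs_def mat_vec_lp)

lemma coefs_lp: "\<alpha> \<in> coefs \<Longrightarrow> \<alpha> \<in> Lp"
  by (simp add: coefs_def)

lemma coefs_add: "\<alpha> \<in> coefs \<Longrightarrow> \<beta> \<in> coefs \<Longrightarrow> (\<lambda>k. \<alpha> k + \<beta> k) \<in> coefs"
  using inA_id by (simp add: coefs_def lp_add mat_vec_add)

lemma coefs_scale: "\<alpha> \<in> coefs \<Longrightarrow> (\<lambda>k. a * \<alpha> k) \<in> coefs"
  by (simp add: coefs_def lp_scale mat_vec_scale)

lemma act_dual_coef: "bounded_clinear R \<Longrightarrow> mat_vec K (M R) (dc f) = C (R (inv S f))"
  by (simp add: dual_coef_eq op_matrix_mat_vec analysis_l2)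

lemma dual_coef_fixed: "mat_vec K (M (\<lambda>x. x)) (dc f) = dc f"
  by (simp add: act_dual_coef bounded_clinear_id) (simp add: dual_coef_eq)

lemma dual_coef_add: "dc (f + g) = (\<lambda>k. dc f k + dc g k)"
  by (auto simp: dual_coef_def analysis_def cinner_add_left)

lemma dual_coef_scale: "dc (a *\<^sub>C f) = (\<lambda>k. a * dc f k)"
  by (auto simp: dual_coef_def analysis_def cinner_scaleC_left)

lemma dual_coef_diff: "dc (f - g) = (\<lambda>k. dc f k - dc g k)"
  by (auto simp: dual_coef_def analysis_def cinner_diff_left)

lemma dual_coef_coefs: "dc f \<in> Lp \<Longrightarrow> dc f \<in> coefs"
  by (simp add: coefs_def dual_coef_fixed)

lemma dual_coef_synthesis:
  assumes "c \<in> l00 K"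
  shows "dc (synthesis K \<psi> c) = mat_vec K (M (\<lambda>x. x)) c"
proof -
  have "c \<in> l2"
    using l2.l00_subset_lp assms by auto
  then show ?thesis
    by (simp add: dual_coef_eq op_matrix_mat_vec bounded_clinear_id dual_synthesis_def)
qed

lemma H00_dual_coef_lp: "f \<in> H00 K \<psi> \<Longrightarrow> dc f \<in> Lp"
  using inA_id l00_subset_lp by (auto simp: H00_def dual_coef_synthesis intro!: mat_vec_lp)

lemma H00_add: "f \<in> H00 K \<psi> \<Longrightarrow> g \<in> H00 K \<psi> \<Longrightarrow> f + g \<in> H00 K \<psi>"
proof -
  have "synthesis K \<psi> c + synthesis K \<psi> d \<in> H00 K \<psi>" if c: "c \<in> l00 K" and d: "d \<in> l00 K" for c d
  proof -
    have sub: "{k. c k + d k \<noteq> 0} \<subseteq> {k. c k \<noteq> 0} \<union> {k. d k \<noteq> 0}"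
      by auto
    have e: "(\<lambda>k. c k + d k) \<in> l00 K"
      using c d finite_subset[OF sub] sub by (auto simp: l00_def)
    have "((\<lambda>k. (c k + d k) *\<^sub>C \<psi> k) has_sum (synthesis K \<psi> c + synthesis K \<psi> d)) K"
      unfolding scaleC_add_left using l2.l00_subset_lp c d
      by (intro has_sum_add synthesis_has_sum) auto
    then have "synthesis K \<psi> (\<lambda>k. c k + d k) = synthesis K \<psi> c + synthesis K \<psi> d"
      by (simp add: synthesis_def infsumI)
    then show ?thesis
      using e by (metis H00_def imageI)
  qed
  then show "f \<in> H00 K \<psi> \<Longrightarrow> g \<in> H00 K \<psi> \<Longrightarrow> f + g \<in> H00 K \<psi>"
    by (auto simp: H00_def)
qed

lemma H00_scale: "f \<in> H00 K \<psi> \<Longrightarrow> a *\<^sub>C f \<in> H00 K \<psi>"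
proof -
  have "a *\<^sub>C synthesis K \<psi> c \<in> H00 K \<psi>" if c: "c \<in> l00 K" for c
  proof -
    have e: "(\<lambda>k. a * c k) \<in> l00 K"
      using c by (auto simp: l00_def elim!: rev_finite_subset)
    have "((\<lambda>k. a *\<^sub>C (c k *\<^sub>C \<psi> k)) has_sum (a *\<^sub>C synthesis K \<psi> c)) K"
      using l2.l00_subset_lp c
      by (intro has_sum_bounded_linear[OF bounded_linear_scaleC_right] synthesis_has_sum) auto
    then have "synthesis K \<psi> (\<lambda>k. a * c k) = a *\<^sub>C synthesis K \<psi> c"
      by (simp add: synthesis_def infsumI scaleC_scaleC)
    then show ?thesis
      using e by (metis H00_def imageI)
  qed
  then show "f \<in> H00 K \<psi> \<Longrightarrow> a *\<^sub>C f \<in> H00 K \<psi>"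
    by (auto simp: H00_def)
qed

text \<open>Names the limit of the dual coefficients of an admissible sequence: in norm for
  \<open>p < \<infinity>\<close>, coordinatewise otherwise, with boundedness built into
  \<open>coorbit_seqs\<close>. Each equivalence class turns out to be the set of sequences that
  represent one fixed \<open>\<alpha>\<close>.\<close>

definition represents :: "(nat \<Rightarrow> 'h) \<Rightarrow> 'k cseq \<Rightarrow> bool" where
  "represents f \<alpha> \<longleftrightarrow> f \<in> coorbit_seqs K \<psi> p w \<and> \<alpha> \<in> Lp \<and>
     (if p = \<infinity> then \<forall>k. (\<lambda>n. dc (f n) k) \<longlonglongrightarrow> \<alpha> k
      else (\<lambda>n. nrm (\<lambda>k. dc (f n) k - \<alpha> k)) \<longlonglongrightarrow> 0)"

lemma coorbit_seqs_inf:
  assumes "p = \<infinity>"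
  shows "f \<in> coorbit_seqs K \<psi> p w \<longleftrightarrow> (\<forall>k\<in>K. convergent (\<lambda>n. dc (f n) k)) \<and>
    (\<forall>n. dc (f n) \<in> Lp) \<and> bdd_above (range (\<lambda>n. nrm (dc (f n))))"
  using assms by (simp add: coorbit_seqs_def)

lemma coorbit_seqs_fin:
  assumes "p \<noteq> \<infinity>"
  shows "f \<in> coorbit_seqs K \<psi> p w \<longleftrightarrow> (\<forall>n. f n \<in> H00 K \<psi>) \<and>
    (\<forall>e>0. \<exists>M. \<forall>m\<ge>M. \<forall>n\<ge>M. nrm (\<lambda>k. dc (f m) k - dc (f n) k) < e)"
  using assms by (simp add: coorbit_seqs_def pre_norm_def dual_coef_diff)

text \<open>Membership of the limit in weighted l^\<infinity> is automatic by the Fatou property of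
  bounded sequences.\<close>

lemma represents_inf:
  assumes inf: "p = \<infinity>"
  shows "represents f \<alpha> \<longleftrightarrow> (\<forall>n. dc (f n) \<in> Lp) \<and> bdd_above (range (\<lambda>n. nrm (dc (f n)))) \<and>
    (\<forall>k. (\<lambda>n. dc (f n) k) \<longlonglongrightarrow> \<alpha> k)" (is "?L \<longleftrightarrow> ?R")
proof
  assume ?L
  then show ?R
    using inf coorbit_seqs_inf[OF inf] unfolding represents_def by metis
next
  assume R: ?R
  then obtain m where m: "\<And>n. nrm (dc (f n)) \<le> m"
    by (auto simp: bdd_above_def)
  have "0 \<le> m"
    using m[of 0] lp_norm_nonneg[of "dc (f 0)"] R by (metis order_trans)
  have "lp_ball m \<alpha>"
    by (rule lp_ball_lim[of m "\<lambda>n. dc (f n)"]) (use R m \<open>0 \<le> m\<close> in \<open>auto simp: lp_ball_iff\<close>)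
  then have "\<alpha> \<in> Lp"
    using \<open>0 \<le> m\<close> lpI by blast
  moreover have "f \<in> coorbit_seqs K \<psi> p w"
    unfolding coorbit_seqs_inf[OF inf] using R by (auto simp: convergent_def)
  ultimately show ?L
    using R inf unfolding represents_def by metis
qed

lemma represents_fin:
  assumes fin: "p \<noteq> \<infinity>"
  shows "represents f \<alpha> \<longleftrightarrow> (\<forall>n. f n \<in> H00 K \<psi>) \<and> \<alpha> \<in> Lp \<and>
    (\<lambda>n. nrm (\<lambda>k. dc (f n) k - \<alpha> k)) \<longlonglongrightarrow> 0" (is "?L \<longleftrightarrow> ?R")
proof
  assume ?L
  then show ?R
    using fin coorbit_seqs_fin[OF fin] unfolding represents_def by metis
next
  assume R: ?R
  then have lp: "dc (f n) \<in> Lp" "\<alpha> \<in> Lp" for n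
    by (auto simp: H00_dual_coef_lp)
  have "\<exists>M. \<forall>m\<ge>M. \<forall>n\<ge>M. nrm (\<lambda>k. dc (f m) k - dc (f n) k) < e" if "e > 0" for e
  proof -
    obtain M where M: "\<And>n. n \<ge> M \<Longrightarrow> norm (nrm (\<lambda>k. dc (f n) k - \<alpha> k)) < e / 2"
      using LIMSEQ_D[OF R[THEN conjunct2, THEN conjunct2], of "e/2"] \<open>e > 0\<close> by auto
    have "nrm (\<lambda>k. dc (f m) k - dc (f n) k) < e" if "m \<ge> M" "n \<ge> M" for m n
      using lp_norm_triangle[OF lp(1) lp(2) lp(1), of m n] M[OF that(1)] M[OF that(2)]
        lp_norm_minus_commute[OF lp(1) lp(2), of n] by simp
    then show ?thesis
      by blast
  qed
  then have "f \<in> coorbit_seqs K \<psi> p w"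
    unfolding coorbit_seqs_fin[OF fin] using R by blast
  then show ?L
    using R fin unfolding represents_def by metis
qed

lemma represents_seqs: "represents f \<alpha> \<Longrightarrow> f \<in> coorbit_seqs K \<psi> p w"
  by (simp add: represents_def)

lemma represents_dual_coef_lp:
  assumes rep: "represents f \<alpha>"
  shows "dc (f n) \<in> Lp"
proof (cases "p = \<infinity>")
  case True
  show ?thesis
    using rep[unfolded represents_inf[OF True]] by blast
next
  case False
  show ?thesis
    using rep[unfolded represents_fin[OF False]] H00_dual_coef_lp by blast
qed

lemma represents_lp: "represents f \<alpha> \<Longrightarrow> \<alpha> \<in> Lp"
  by (simp add: represents_def)

lemma represents_pointwise:
  assumes rep: "represents f \<alpha>"
  shows "(\<lambda>n. dc (f n) k) \<longlonglongrightarrow> \<alpha> k"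
proof (cases "p = \<infinity>")
  case True
  show ?thesis
    using rep[unfolded represents_inf[OF True]] by blast
next
  case False
  show ?thesis
    by (rule lp_tendsto_coordinate[OF represents_dual_coef_lp[OF rep] represents_lp[OF rep]])
      (use rep represents_fin[OF False] in blast)
qed

text \<open>Dual coefficients of vectors are fixed by \<open>M(1)\<close>, and this equation passes
  to the limit: by continuity for finite \<open>p\<close>, by dominated convergence in each row for
  \<open>p = \<infinity>\<close>.\<close>

lemma represents_coefs:
  assumes rep: "represents f \<alpha>"
  shows "\<alpha> \<in> coefs"
proof -
  note lp = represents_dual_coef_lp[OF rep] represents_lp[OF rep]
  let ?P = "M (\<lambda>x. x)"
  have P: "?P \<in> \<A>"
    using inA_id by simp
  have "(\<lambda>n. dc (f n) k) \<longlonglongrightarrow> mat_vec K ?P \<alpha> k" for k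
  proof (cases "k \<in> K \<and> p = \<infinity>")
    case True
    then have k: "k \<in> K" and inf: "p = \<infinity>"
      by auto
    obtain m where m: "\<And>n. nrm (dc (f n)) \<le> m"
      using rep[unfolded represents_inf[OF inf]] by (auto simp: bdd_above_def)
    \<comment> \<open>The extremal sequence of the ball of radius \<open>m\<close>. It lies in
      weighted l^\<infinity>, so admissibility makes its product with the row of \<open>M(1)\<close>
      absolutely summable, and this product is the common majorant.\<close>
    define h where "h l = (if l \<in> K then complex_of_real (m / w l) else 0)" for l
    have "m \<ge> 0"
      using lp_norm_nonneg[OF lp(1)] m[of 0] order_trans by blast
    have "w l * cmod (h l) \<le> m" if "l \<in> K" for l
      using w_pos[OF that] \<open>m \<ge> 0\<close> that by (simp add: h_def norm_divide)
    then have "lp_ball m h"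
      unfolding lp_ball_inf[OF inf] by (simp add: h_def)
    then have "h \<in> Lp"
      by (rule lpI[OF \<open>m \<ge> 0\<close>])
    then have sm: "(\<lambda>l. norm (?P k l * h l)) summable_on K"
      using mat_vec_summable[OF P _ k] by (simp add: summable_on_iff_abs_summable_on_complex)
    have "(\<lambda>n. \<Sum>\<^sub>\<infinity>l\<in>K. ?P k l * dc (f n) l) \<longlonglongrightarrow> (\<Sum>\<^sub>\<infinity>l\<in>K. ?P k l * \<alpha> l)"
    proof (rule infsum_dominated_convergence[OF sm])
      fix n l assume l: "l \<in> K"
      have "w l * cmod (dc (f n) l) \<le> m"
        using lp_coordinate_le[OF lp(1) l, of n] m[of n] by simp
      then have "cmod (dc (f n) l) \<le> cmod (h l)"
        using l w_pos[OF l] \<open>m \<ge> 0\<close> by (simp add: h_def norm_divide field_simps)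
      then show "norm (?P k l * dc (f n) l) \<le> norm (?P k l * h l)"
        by (simp add: Real_Vector_Spaces.norm_mult mult_left_mono)
    next
      show "(\<lambda>n. ?P k l * dc (f n) l) \<longlonglongrightarrow> ?P k l * \<alpha> l" for l
        by (intro tendsto_mult_left represents_pointwise[OF rep])
    qed
    then show ?thesis
      using dual_coef_fixed by (simp add: mat_vec_def fun_eq_iff)
  next
    case False
    show ?thesis
    proof (cases "k \<in> K")
      case True
      with False have fin: "p \<noteq> \<infinity>"
        by simp
      have "(\<lambda>n. mat_vec K ?P (dc (f n)) k) \<longlonglongrightarrow> mat_vec K ?P \<alpha> k"
        by (rule lp_tendsto_coordinate) (use rep[unfolded represents_fin[OF fin]] lp P in
            \<open>auto intro: mat_vec_lp mat_vec_tendsto\<close>)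
      then show ?thesis
        by (simp add: dual_coef_fixed)
    next
      case False
      then show ?thesis
        using lp(1) by (simp add: lp_vanish mat_vec_outside[OF P])
    qed
  qed
  then have "mat_vec K ?P \<alpha> = \<alpha>"
    using represents_pointwise[OF rep] LIMSEQ_unique by blast
  then show ?thesis
    using lp by (simp add: coefs_def)
qed

lemma represents_exists:
  assumes f: "f \<in> coorbit_seqs K \<psi> p w"
  obtains \<alpha> where "represents f \<alpha>"
proof (cases "p = \<infinity>")
  case True
  note f' = f[unfolded coorbit_seqs_inf[OF True]]
  have "\<exists>a. (\<lambda>n. dc (f n) k) \<longlonglongrightarrow> a" for k
  proof (cases "k \<in> K")
    case False
    then have "dc (f n) k = 0" for n
      by (simp add: dual_coef_def analysis_def)
    then show ?thesis
      by auto
  qed (use f' in \<open>auto simp: convergent_def\<close>)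
  then obtain \<alpha> where "\<And>k. (\<lambda>n. dc (f n) k) \<longlonglongrightarrow> \<alpha> k"
    by metis
  then have "represents f \<alpha>"
    unfolding represents_inf[OF True] using f' by simp
  then show ?thesis
    by (rule that)
next
  case False
  note f' = f[unfolded coorbit_seqs_fin[OF False]]
  obtain \<alpha> where "\<alpha> \<in> Lp" "(\<lambda>n. nrm (\<lambda>k. dc (f n) k - \<alpha> k)) \<longlonglongrightarrow> 0"
    using lp_Cauchy_convergent[of "\<lambda>n. dc (f n)"] f' H00_dual_coef_lp by blast
  then have "represents f \<alpha>"
    unfolding represents_fin[OF False] using f' by blast
  then show ?thesis
    by (rule that)
qed

text \<open>Truncate \<open>\<alpha>\<close> to finite sets and synthesise with the frame. The dual
  coefficients are \<open>M(1)\<close> applied to the truncations, so they tend to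
  \<open>M(1) \<alpha> = \<alpha>\<close>; for \<open>p = \<infinity>\<close> each coordinate is a
  partial sum of a convergent row.\<close>

lemma coefs_represented:
  assumes \<alpha>: "\<alpha> \<in> coefs"
  obtains f where "represents f \<alpha>"
proof -
  obtain J where J: "\<And>n::nat. finite (J n)" "\<And>n. J n \<subseteq> K"
    "filterlim J (finite_subsets_at_top K) sequentially"
    using countable_exhaustion[OF countable] by metis
  let ?P = "M (\<lambda>x. x)"
  have P: "?P \<in> \<A>"
    using inA_id by simp
  define c where "c n = (\<lambda>k. if k \<in> J n then \<alpha> k else 0)" for n
  have lp: "\<alpha> \<in> Lp" and fixed: "mat_vec K ?P \<alpha> = \<alpha>"
    using \<alpha> by (auto simp: coefs_def)
  have c: "c n \<in> Lp" "nrm (c n) \<le> nrm \<alpha>" "c n \<in> l00 K" for n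
    using lp_restrict[OF lp, of "J n"] J by (auto simp: c_def l00_def)
  define f where "f n = synthesis K \<psi> (c n)" for n
  have dc: "dc (f n) = mat_vec K ?P (c n)" for n
    unfolding f_def by (rule dual_coef_synthesis[OF c(3)])
  have "represents f \<alpha>"
  proof (cases "p = \<infinity>")
    case True
    obtain b where b: "0 \<le> b" "\<And>c. c \<in> Lp \<Longrightarrow> nrm (mat_vec K ?P c) \<le> b * nrm c"
      using mat_vec_bound[OF P] by blast
    have "nrm (dc (f n)) \<le> b * nrm \<alpha>" for n
      using b(2)[OF c(1)] mult_left_mono[OF c(2) b(1)] by (metis dc order_trans)
    then have "bdd_above (range (\<lambda>n. nrm (dc (f n))))"
      by (rule bdd_aboveI2)
    moreover have "dc (f n) \<in> Lp" for n
      using c P by (simp add: dc mat_vec_lp)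
    moreover have "(\<lambda>n. dc (f n) k) \<longlonglongrightarrow> \<alpha> k" for k
    proof (cases "k \<in> K")
      case True
      have eq: "dc (f n) k = (\<Sum>l\<in>J n. ?P k l * \<alpha> l)" for n
        unfolding dc mat_vec_def
        by (rule infsumI, rule has_sum_finite_neutralI[OF J(1,2)]) (auto simp: c_def)
      have "((\<lambda>X. \<Sum>l\<in>X. ?P k l * \<alpha> l) \<longlongrightarrow> \<alpha> k) (finite_subsets_at_top K)"
        using infsum_tendsto[OF mat_vec_summable[OF P lp True]] fixed
        by (simp add: mat_vec_def fun_eq_iff)
      then show ?thesis
        unfolding eq using J(3) by (rule filterlim_compose)
    next
      case False
      then show ?thesis
        using lp by (simp add: lp_vanish dc mat_vec_outside[OF P])
    qed
    ultimately show ?thesis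
      unfolding represents_inf[OF True] by blast
  next
    case False
    have "(\<lambda>n. nrm (\<lambda>k. c n k - \<alpha> k)) \<longlonglongrightarrow> 0"
      using filterlim_compose[OF lp_truncation_tendsto[OF False lp] J(3)] by (simp add: c_def)
    then have "(\<lambda>n. nrm (\<lambda>k. mat_vec K ?P (c n) k - mat_vec K ?P \<alpha> k)) \<longlonglongrightarrow> 0"
      by (intro mat_vec_tendsto P c lp)
    moreover have "f n \<in> H00 K \<psi>" for n
      using c(3) by (auto simp: f_def H00_def)
    ultimately show ?thesis
      unfolding represents_fin[OF False] using lp by (simp add: dc fixed)
  qed
  then show ?thesis
    by (rule that)
qed

lemma represents_rel:
  assumes f: "represents f \<alpha>" and g: "represents g \<beta>"
  shows "(f, g) \<in> coorbit_rel K \<psi> p w \<longleftrightarrow> \<alpha> = \<beta>"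
proof (cases "p = \<infinity>")
  case True
  have lim: "(\<lambda>n. dc (f n - g n) k) \<longlonglongrightarrow> \<alpha> k - \<beta> k" for k
    unfolding dual_coef_diff using represents_pointwise[OF f] represents_pointwise[OF g] by (rule tendsto_diff)
  have "(f, g) \<in> coorbit_rel K \<psi> p w \<longleftrightarrow> (\<forall>k\<in>K. (\<lambda>n. dc (f n - g n) k) \<longlonglongrightarrow> 0)"
    using represents_seqs[OF f] represents_seqs[OF g] True by (simp add: coorbit_rel_def)
  also have "\<dots> \<longleftrightarrow> (\<forall>k\<in>K. \<alpha> k - \<beta> k = 0)"
  proof (intro ball_cong refl)
    fix k
    show "(\<lambda>n. dc (f n - g n) k) \<longlonglongrightarrow> 0 \<longleftrightarrow> \<alpha> k - \<beta> k = 0"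
      using lim[of k] LIMSEQ_unique[OF lim[of k], of 0] by auto
  qed
  also have "\<dots> \<longleftrightarrow> \<alpha> = \<beta>"
    using represents_lp[OF f] represents_lp[OF g] lp_vanish by (metis ext right_minus_eq)
  finally show ?thesis .
next
  case False
  note f' = f[unfolded represents_fin[OF False]] and g' = g[unfolded represents_fin[OF False]]
  have lp: "dc (f n) \<in> Lp" "dc (g n) \<in> Lp" "\<alpha> \<in> Lp" "\<beta> \<in> Lp" for n
    using f' g' H00_dual_coef_lp by auto
  have lim: "(\<lambda>n. nrm (dc (f n - g n))) \<longlonglongrightarrow> nrm (\<lambda>k. \<alpha> k - \<beta> k)"
    unfolding dual_coef_diff
  proof (rule lp_norm_tendsto)
    show "(\<lambda>n. nrm (\<lambda>k. dc (f n) k - dc (g n) k - (\<alpha> k - \<beta> k))) \<longlonglongrightarrow> 0"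
    proof (rule Lim_null_comparison)
      show "\<forall>\<^sub>F n in sequentially. norm (nrm (\<lambda>k. dc (f n) k - dc (g n) k - (\<alpha> k - \<beta> k)))
          \<le> nrm (\<lambda>k. dc (f n) k - \<alpha> k) + nrm (\<lambda>k. dc (g n) k - \<beta> k)"
      proof (intro always_eventually allI)
        fix n
        have "(\<lambda>k. dc (f n) k - dc (g n) k - (\<alpha> k - \<beta> k)) = (\<lambda>k. (dc (f n) k - \<alpha> k) - (dc (g n) k - \<beta> k))"
          by (simp add: fun_eq_iff)
        then show "norm (nrm (\<lambda>k. dc (f n) k - dc (g n) k - (\<alpha> k - \<beta> k)))
            \<le> nrm (\<lambda>k. dc (f n) k - \<alpha> k) + nrm (\<lambda>k. dc (g n) k - \<beta> k)"
          using lp_norm_diff_le[of "\<lambda>k. dc (f n) k - \<alpha> k" "\<lambda>k. dc (g n) k - \<beta> k"] lp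
          by (simp add: lp_diff lp_norm_nonneg)
      qed
      show "(\<lambda>n. nrm (\<lambda>k. dc (f n) k - \<alpha> k) + nrm (\<lambda>k. dc (g n) k - \<beta> k)) \<longlonglongrightarrow> 0"
        using f' g' by (intro tendsto_add_zero) blast+
    qed
  qed (auto simp: lp lp_diff)
  have "(f, g) \<in> coorbit_rel K \<psi> p w \<longleftrightarrow> (\<lambda>n. nrm (dc (f n - g n))) \<longlonglongrightarrow> 0"
    using represents_seqs[OF f] represents_seqs[OF g] False by (simp add: coorbit_rel_def pre_norm_def)
  also have "\<dots> \<longleftrightarrow> nrm (\<lambda>k. \<alpha> k - \<beta> k) = 0"
    using lim LIMSEQ_unique[OF lim, of 0] by auto
  also have "\<dots> \<longleftrightarrow> \<alpha> = \<beta>"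
  proof
    assume 0: "nrm (\<lambda>k. \<alpha> k - \<beta> k) = 0"
    have "\<alpha> k = \<beta> k" for k
    proof (cases "k \<in> K")
      case True
      then show ?thesis
        using lp_coordinate_le[OF lp_diff[OF lp(3,4)] True] w_pos[OF True] 0
        by (simp add: mult_le_0_iff)
    next
      case False
      then show ?thesis
        using lp by (simp add: lp_vanish)
    qed
    then show "\<alpha> = \<beta>"
      by blast
  qed (simp add: lp_zero)
  finally show ?thesis .
qed

text \<open>The inverse of \<open>coorbit_coef\<close>: all coorbit operations are computed by
  transport along it.\<close>

definition cls :: "'k cseq \<Rightarrow> 'h coorb" where
  "cls \<alpha> = {f. represents f \<alpha>}"

lemma rel_Image: "represents f \<alpha> \<Longrightarrow> coorbit_rel K \<psi> p w `` {f} = cls \<alpha>"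
proof -
  assume f: "represents f \<alpha>"
  have "(f, g) \<in> coorbit_rel K \<psi> p w \<longleftrightarrow> represents g \<alpha>" for g
  proof
    assume fg: "(f, g) \<in> coorbit_rel K \<psi> p w"
    then have "g \<in> coorbit_seqs K \<psi> p w"
      by (simp add: coorbit_rel_def)
    then obtain \<beta> where g: "represents g \<beta>"
      using represents_exists by blast
    then show "represents g \<alpha>"
      using fg represents_rel[OF f g] by simp
  qed (simp add: represents_rel[OF f])
  then show ?thesis
    by (auto simp: cls_def)
qed

lemma coorbit_eq: "coorbit K \<psi> p w = cls ` coefs"
proof -
  have "X \<in> coorbit K \<psi> p w \<longleftrightarrow> X \<in> cls ` coefs" for X
  proof
    assume "X \<in> coorbit K \<psi> p w"
    then obtain f where f: "f \<in> coorbit_seqs K \<psi> p w" "X = coorbit_rel K \<psi> p w `` {f}"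
      unfolding coorbit_def by (rule quotientE)
    obtain \<alpha> where "represents f \<alpha>"
      using represents_exists[OF f(1)] .
    then show "X \<in> cls ` coefs"
      using f(2) rel_Image represents_coefs by blast
  next
    assume "X \<in> cls ` coefs"
    then obtain \<alpha> where \<alpha>: "\<alpha> \<in> coefs" "X = cls \<alpha>"
      by blast
    obtain f where f: "represents f \<alpha>"
      using coefs_represented[OF \<alpha>(1)] .
    show "X \<in> coorbit K \<psi> p w"
      using quotientI[OF represents_seqs[OF f], of "coorbit_rel K \<psi> p w"] rel_Image[OF f] \<alpha>(2)
      by (simp add: coorbit_def)
  qed
  then show ?thesis
    by blast
qed

text \<open>The definite description is meaningful only on a nonempty class. For
  \<open>\<alpha>\<close> outside \<open>coefs\<close> the set \<open>cls \<alpha>\<close> is empty,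
  by \<open>represents_coefs\<close>.\<close>

lemma coorbit_coef_cls:
  assumes "\<alpha> \<in> coefs"
  shows "coorbit_coef K \<psi> (cls \<alpha>) = \<alpha>"
proof
  fix k
  obtain f where f: "represents f \<alpha>"
    using coefs_represented[OF assms] .
  show "coorbit_coef K \<psi> (cls \<alpha>) k = \<alpha> k"
    unfolding coorbit_coef_def
  proof (rule the_equality)
    show "\<forall>f\<in>cls \<alpha>. (\<lambda>n. dc (f n) k) \<longlonglongrightarrow> \<alpha> k"
      by (simp add: cls_def represents_pointwise)
    show "a = \<alpha> k" if "\<forall>f\<in>cls \<alpha>. (\<lambda>n. dc (f n) k) \<longlonglongrightarrow> a" for a
      using that f LIMSEQ_unique[OF _ represents_pointwise[OF f]] by (auto simp: cls_def)
  qed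
qed

lemma coorbit_norm_cls:
  assumes "\<alpha> \<in> coefs"
  shows "coorbit_norm K \<psi> p w (cls \<alpha>) = nrm \<alpha>"
proof (cases "p = \<infinity>")
  case True
  then show ?thesis
    using coorbit_coef_cls[OF assms] by (simp add: coorbit_norm_def)
next
  case False
  obtain f where f: "represents f \<alpha>"
    using coefs_represented[OF assms] .
  have lim: "(\<lambda>n. pre_norm K \<psi> p w (g n)) \<longlonglongrightarrow> nrm \<alpha>" if g: "represents g \<alpha>" for g
    unfolding pre_norm_def using g represents_dual_coef_lp[OF g] represents_fin[OF False]
    by (intro lp_norm_tendsto) blast+
  have "(THE s. \<forall>f\<in>cls \<alpha>. (\<lambda>n. pre_norm K \<psi> p w (f n)) \<longlonglongrightarrow> s) = nrm \<alpha>"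
  proof (rule the_equality)
    show "\<forall>f\<in>cls \<alpha>. (\<lambda>n. pre_norm K \<psi> p w (f n)) \<longlonglongrightarrow> nrm \<alpha>"
      by (simp add: cls_def lim)
    show "a = nrm \<alpha>" if "\<forall>f\<in>cls \<alpha>. (\<lambda>n. pre_norm K \<psi> p w (f n)) \<longlonglongrightarrow> a" for a
      using that f LIMSEQ_unique[OF _ lim[OF f]] by (auto simp: cls_def)
  qed
  then show ?thesis
    using False by (simp add: coorbit_norm_def)
qed

lemma represents_add:
  assumes f: "represents f \<alpha>" and g: "represents g \<beta>"
  shows "represents (\<lambda>n. f n + g n) (\<lambda>k. \<alpha> k + \<beta> k)"
proof (cases "p = \<infinity>")
  case True
  note f' = f[unfolded represents_inf[OF True]] and g' = g[unfolded represents_inf[OF True]]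
  obtain m m' where "\<And>n. nrm (dc (f n)) \<le> m" "\<And>n. nrm (dc (g n)) \<le> m'"
    using f' g' by (auto simp: bdd_above_def)
  then have "nrm (\<lambda>k. dc (f n) k + dc (g n) k) \<le> m + m'" for n
    using lp_norm_add[of "dc (f n)" "dc (g n)"] f' g' by (meson add_mono order_trans)
  then have "bdd_above (range (\<lambda>n. nrm (\<lambda>k. dc (f n) k + dc (g n) k)))"
    by (rule bdd_aboveI2)
  then show ?thesis
    unfolding represents_inf[OF True] dual_coef_add using f' g'
    by (auto intro: lp_add tendsto_add)
next
  case False
  note f' = f[unfolded represents_fin[OF False]] and g' = g[unfolded represents_fin[OF False]]
  have lp: "dc (f n) \<in> Lp" "dc (g n) \<in> Lp" "\<alpha> \<in> Lp" "\<beta> \<in> Lp" for n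
    using f' g' H00_dual_coef_lp by auto
  have "(\<lambda>n. nrm (\<lambda>k. dc (f n) k + dc (g n) k - (\<alpha> k + \<beta> k))) \<longlonglongrightarrow> 0"
  proof (rule Lim_null_comparison)
    show "\<forall>\<^sub>F n in sequentially. norm (nrm (\<lambda>k. dc (f n) k + dc (g n) k - (\<alpha> k + \<beta> k)))
        \<le> nrm (\<lambda>k. dc (f n) k - \<alpha> k) + nrm (\<lambda>k. dc (g n) k - \<beta> k)"
    proof (intro always_eventually allI)
      fix n
      have "(\<lambda>k. dc (f n) k + dc (g n) k - (\<alpha> k + \<beta> k)) = (\<lambda>k. (dc (f n) k - \<alpha> k) + (dc (g n) k - \<beta> k))"
        by (simp add: fun_eq_iff)
      then show "norm (nrm (\<lambda>k. dc (f n) k + dc (g n) k - (\<alpha> k + \<beta> k)))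
          \<le> nrm (\<lambda>k. dc (f n) k - \<alpha> k) + nrm (\<lambda>k. dc (g n) k - \<beta> k)"
        using lp_norm_add[of "\<lambda>k. dc (f n) k - \<alpha> k" "\<lambda>k. dc (g n) k - \<beta> k"]
          lp_norm_nonneg[of "\<lambda>k. (dc (f n) k - \<alpha> k) + (dc (g n) k - \<beta> k)"] lp
        by (simp add: lp_diff lp_add)
    qed
    show "(\<lambda>n. nrm (\<lambda>k. dc (f n) k - \<alpha> k) + nrm (\<lambda>k. dc (g n) k - \<beta> k)) \<longlonglongrightarrow> 0"
      using f' g' by (intro tendsto_add_zero) blast+
  qed
  then show ?thesis
    unfolding represents_fin[OF False] dual_coef_add using f' g' by (auto intro: lp_add H00_add)
qed

lemma represents_scale:
  assumes f: "represents f \<alpha>"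
  shows "represents (\<lambda>n. a *\<^sub>C f n) (\<lambda>k. a * \<alpha> k)"
proof (cases "p = \<infinity>")
  case True
  note f' = f[unfolded represents_inf[OF True]]
  obtain m where "\<And>n. nrm (dc (f n)) \<le> m"
    using f' by (auto simp: bdd_above_def)
  then have "nrm (\<lambda>k. a * dc (f n) k) \<le> cmod a * m" for n
    using lp_norm_scale_le[of "dc (f n)" a] f' by (meson mult_left_mono norm_ge_zero order_trans)
  then have "bdd_above (range (\<lambda>n. nrm (\<lambda>k. a * dc (f n) k)))"
    by (rule bdd_aboveI2)
  then show ?thesis
    unfolding represents_inf[OF True] dual_coef_scale using f'
    by (auto intro: lp_scale tendsto_mult_left)
next
  case False
  note f' = f[unfolded represents_fin[OF False]]
  have lp: "dc (f n) \<in> Lp" "\<alpha> \<in> Lp" for n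
    using f' H00_dual_coef_lp by auto
  have "(\<lambda>n. nrm (\<lambda>k. a * dc (f n) k - a * \<alpha> k)) \<longlonglongrightarrow> 0"
  proof (rule Lim_null_comparison)
    show "\<forall>\<^sub>F n in sequentially. norm (nrm (\<lambda>k. a * dc (f n) k - a * \<alpha> k))
        \<le> cmod a * nrm (\<lambda>k. dc (f n) k - \<alpha> k)"
      unfolding right_diff_distrib[symmetric]
      using lp_norm_scale_le[OF lp_diff[OF lp], of a] lp_norm_nonneg[OF lp_scale[OF lp_diff[OF lp]], of a]
      by simp
    show "(\<lambda>n. cmod a * nrm (\<lambda>k. dc (f n) k - \<alpha> k)) \<longlonglongrightarrow> 0"
      using f' by (intro tendsto_mult_right_zero) blast
  qed
  then show ?thesis
    unfolding represents_fin[OF False] dual_coef_scale using f' by (auto intro: lp_scale H00_scale)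
qed

lemma coorbit_add_cls:
  assumes "\<alpha> \<in> coefs" "\<beta> \<in> coefs"
  shows "coorbit_add K \<psi> p w (cls \<alpha>) (cls \<beta>) = cls (\<lambda>k. \<alpha> k + \<beta> k)"
proof -
  obtain f g where fg: "represents f \<alpha>" "represents g \<beta>"
    using assms coefs_represented by metis
  let ?Z = "{\<lambda>n. f n + g n | f g. f \<in> cls \<alpha> \<and> g \<in> cls \<beta>}"
  have "coorbit_rel K \<psi> p w `` ?Z = (\<Union>h\<in>?Z. coorbit_rel K \<psi> p w `` {h})"
    by blast
  also have "\<dots> = (\<Union>h\<in>?Z. cls (\<lambda>k. \<alpha> k + \<beta> k))"
    by (intro SUP_cong refl rel_Image) (auto simp: cls_def represents_add)
  also have "\<dots> = cls (\<lambda>k. \<alpha> k + \<beta> k)"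
    using fg by (auto simp: cls_def)
  finally show ?thesis
    by (simp add: coorbit_add_def)
qed

lemma coorbit_scale_cls:
  assumes "\<alpha> \<in> coefs"
  shows "coorbit_scale K \<psi> p w a (cls \<alpha>) = cls (\<lambda>k. a * \<alpha> k)"
proof -
  obtain f where f: "represents f \<alpha>"
    using coefs_represented[OF assms] .
  let ?Z = "{\<lambda>n. a *\<^sub>C f n | f. f \<in> cls \<alpha>}"
  have "coorbit_rel K \<psi> p w `` ?Z = (\<Union>h\<in>?Z. coorbit_rel K \<psi> p w `` {h})"
    by blast
  also have "\<dots> = (\<Union>h\<in>?Z. cls (\<lambda>k. a * \<alpha> k))"
    by (intro SUP_cong refl rel_Image) (auto simp: cls_def represents_scale)
  also have "\<dots> = cls (\<lambda>k. a * \<alpha> k)"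
    using f by (auto simp: cls_def)
  finally show ?thesis
    by (simp add: coorbit_scale_def)
qed

lemma coorbit_embed_cls:
  assumes g: "dc g \<in> Lp"
  shows "coorbit_embed K \<psi> p w g = cls (dc g)"
proof (cases "p = \<infinity>")
  case True
  have "represents (\<lambda>n. g) (dc g)"
    unfolding represents_inf[OF True] using g by simp
  then show ?thesis
    using True rel_Image[of "\<lambda>n. g" "dc g"] by (simp add: coorbit_embed_def)
next
  case False
  have "represents f (dc g) \<longleftrightarrow> (\<forall>n. f n \<in> H00 K \<psi> \<and> dc (f n - g) \<in> Lp) \<and>
      (\<lambda>n. nrm (dc (f n - g))) \<longlonglongrightarrow> 0" for f
    unfolding represents_fin[OF False] dual_coef_diff using g H00_dual_coef_lp lp_diff by blast
  then show ?thesis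
    using False by (simp add: coorbit_embed_def pre_norm_def cls_def)
qed

section \<open>Extension of operators\<close>

text \<open>The coefficients of a vector \<open>f\<close> are the analysis of
  \<open>inv S f\<close>, so \<open>lift R\<close> extends S R \<open>inv S\<close> and not
  \<open>R\<close>. Hence an operator is conjugated by \<open>S\<close> before it is lifted.\<close>

definition lift :: "('h \<Rightarrow> 'h) \<Rightarrow> 'h coorb \<Rightarrow> 'h coorb" where
  "lift R X = cls (mat_vec K (M R) (coorbit_coef K \<psi> X))"

lemma lift_cls: "\<alpha> \<in> coefs \<Longrightarrow> lift R (cls \<alpha>) = cls (mat_vec K (M R) \<alpha>)"
  by (simp add: lift_def coorbit_coef_cls)

lemma lift_bounded_linear:
  assumes R: "inA R"
  shows "coorbit_bounded_linear K \<psi> p w (lift R)"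
proof -
  have RA: "M R \<in> \<A>"
    using R by simp
  obtain b where "0 \<le> b" "\<And>c. c \<in> Lp \<Longrightarrow> nrm (mat_vec K (M R) c) \<le> b * nrm c"
    using mat_vec_bound[OF RA] by blast
  then show ?thesis
    unfolding coorbit_bounded_linear_def coorbit_eq
    by (auto simp: lift_cls act_coefs[OF R] coefs_lp coorbit_add_cls coorbit_scale_cls coefs_add
        coefs_scale mat_vec_add[OF RA] mat_vec_scale coorbit_norm_cls intro!: exI[of _ b])
qed

text \<open>\<open>M (inv S)\<close> is the Gram matrix of the dual frame, so it sends
  \<open>c\<close> to the dual coefficients of the series with terms
  \<open>c k *\<^sub>C \<phi> k\<close>. Being in the algebra, it carries norm convergence of
  truncations to the coorbit space for finite \<open>p\<close>; for \<open>p = \<infinity>\<close>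
  its rows sum coordinatewise.\<close>

lemma has_dual_synthesis_cls:
  assumes c: "c \<in> Lp"
  shows "has_dual_synthesis K \<psi> p w c (cls (mat_vec K (M (inv S)) c))"
proof -
  have I: "inA (inv S)"
    using inA_inv[OF frame_operator_invertible] inA_frame_operator by blast
  then have IA: "M (inv S) \<in> \<A>"
    by simp
  define c' where "c' J = (\<lambda>k. if k \<in> J then c k else 0)" for J
  define \<gamma> where "\<gamma> J = mat_vec K (M (inv S)) (c' J)" for J
  define \<beta> where "\<beta> = mat_vec K (M (inv S)) c"
  have c': "c' J \<in> Lp" for J
    using lp_restrict[OF c] by (simp add: c'_def)
  have mem: "\<gamma> J \<in> coefs" "\<beta> \<in> coefs" for J
    unfolding \<gamma>_def \<beta>_def by (rule act_coefs[OF I c'], rule act_coefs[OF I c])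
  have emb: "coorbit_embed K \<psi> p w (\<Sum>k\<in>J. c k *\<^sub>C \<phi> k) = cls (\<gamma> J)" if J: "finite J" "J \<subseteq> K" for J
  proof -
    have "c' J \<in> l00 K"
      using J by (auto simp: l00_def c'_def)
    then have l2: "c' J \<in> l2"
      using l2.l00_subset_lp by blast
    have "((\<lambda>k. c' J k *\<^sub>C \<phi> k) has_sum (\<Sum>k\<in>J. c k *\<^sub>C \<phi> k)) K"
      by (rule has_sum_finite_neutralI[OF J]) (auto simp: c'_def)
    then have "dual_synthesis (c' J) = (\<Sum>k\<in>J. c k *\<^sub>C \<phi> k)"
      using dual_synthesis_has_sum[OF l2] has_sum_unique by blast
    then have "dc (\<Sum>k\<in>J. c k *\<^sub>C \<phi> k) = \<gamma> J"
      unfolding \<gamma>_def dual_coef_eq by (simp add: op_matrix_mat_vec[OF S_inv(2) l2])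
    then show ?thesis
      using coorbit_embed_cls mem(1) coefs_lp by metis
  qed
  have ev: "\<forall>\<^sub>F J in finite_subsets_at_top K. finite J \<and> J \<subseteq> K"
    by (intro eventually_finite_subsets_at_top_weakI) simp
  have inf: "((\<lambda>J. coorbit_coef K \<psi> (coorbit_embed K \<psi> p w (\<Sum>k\<in>J. c k *\<^sub>C \<phi> k)) l) \<longlongrightarrow>
      coorbit_coef K \<psi> (cls \<beta>) l) (finite_subsets_at_top K)" if l: "l \<in> K" for l
  proof (rule Lim_transform_eventually)
    show "((\<lambda>J. \<Sum>k\<in>J. M (inv S) l k * c k) \<longlongrightarrow> coorbit_coef K \<psi> (cls \<beta>) l) (finite_subsets_at_top K)"
      using infsum_tendsto[OF mat_vec_summable[OF IA c l]]
      by (simp add: coorbit_coef_cls mem) (simp add: \<beta>_def mat_vec_def)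
    show "\<forall>\<^sub>F J in finite_subsets_at_top K. (\<Sum>k\<in>J. M (inv S) l k * c k) =
        coorbit_coef K \<psi> (coorbit_embed K \<psi> p w (\<Sum>k\<in>J. c k *\<^sub>C \<phi> k)) l"
      using ev
    proof eventually_elim
      case (elim J)
      then have "\<gamma> J l = (\<Sum>k\<in>J. M (inv S) l k * c k)"
        unfolding \<gamma>_def mat_vec_def
        by (intro infsumI has_sum_finite_neutralI[of J]) (auto simp: c'_def)
      then show ?case
        using elim by (simp add: emb coorbit_coef_cls mem)
    qed
  qed
  have fin: "((\<lambda>J. coorbit_norm K \<psi> p w (coorbit_add K \<psi> p w
      (coorbit_embed K \<psi> p w (\<Sum>k\<in>J. c k *\<^sub>C \<phi> k)) (coorbit_scale K \<psi> p w (-1) (cls \<beta>)))) \<longlongrightarrow> 0)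
      (finite_subsets_at_top K)" if "p \<noteq> \<infinity>"
  proof (rule Lim_transform_eventually)
    show "((\<lambda>J. nrm (\<lambda>k. \<gamma> J k - \<beta> k)) \<longlongrightarrow> 0) (finite_subsets_at_top K)"
      unfolding \<gamma>_def \<beta>_def
      by (rule mat_vec_tendsto[OF IA c' c]) (use lp_truncation_tendsto[OF that c] in \<open>simp add: c'_def\<close>)
    show "\<forall>\<^sub>F J in finite_subsets_at_top K. nrm (\<lambda>k. \<gamma> J k - \<beta> k) =
        coorbit_norm K \<psi> p w (coorbit_add K \<psi> p w
          (coorbit_embed K \<psi> p w (\<Sum>k\<in>J. c k *\<^sub>C \<phi> k)) (coorbit_scale K \<psi> p w (-1) (cls \<beta>)))"
      using ev
    proof eventually_elim
      case (elim J)
      then show ?case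
        using coefs_add[OF mem(1) coefs_scale[OF mem(2), of "-1"], of J]
          coefs_scale[OF mem(2), of "-1"] mem
        by (simp add: emb coorbit_add_cls coorbit_scale_cls coorbit_norm_cls)
    qed
  qed
  have "cls \<beta> \<in> coorbit K \<psi> p w" "\<And>J. finite J \<Longrightarrow> J \<subseteq> K \<Longrightarrow>
      coorbit_embed K \<psi> p w (\<Sum>k\<in>J. c k *\<^sub>C \<phi> k) \<in> coorbit K \<psi> p w"
    using mem emb by (auto simp: coorbit_eq)
  then show ?thesis
    unfolding has_dual_synthesis_def Let_def \<beta>_def[symmetric] using inf fin by auto
qed

lemma inA_conjugate: "inA R \<Longrightarrow> inA (\<lambda>x. inv S (R (S x)))"
  using inA_comp[OF _ inA_comp[OF _ inA_frame_operator], of "inv S" R]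
    inA_inv[OF frame_operator_invertible] inA_frame_operator by blast

text \<open>Gram matrix, matrix of \<open>R\<close> and dual synthesis become \<open>M S\<close>,
  \<open>M R\<close> and \<open>M (inv S)\<close> in coefficients. Their product is the matrix of
  the conjugated operator.\<close>

lemma coorbit_extension_lift:
  assumes R: "inA R"
  shows "coorbit_extension K \<psi> p w R (lift (\<lambda>x. inv S (R (S x))))"
proof -
  define Q where "Q = (\<lambda>x. inv S (R (S x)))"
  have Q: "inA Q"
    unfolding Q_def by (rule inA_conjugate[OF R])
  have I: "inA (inv S)"
    using inA_inv[OF frame_operator_invertible] inA_frame_operator by blast
  have H00: "lift Q (coorbit_embed K \<psi> p w f) = coorbit_embed K \<psi> p w (R f)" if "f \<in> H00 K \<psi>" for f
  proof -
    have f: "dc f \<in> Lp"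
      by (rule H00_dual_coef_lp[OF that])
    have "mat_vec K (M Q) (dc f) = dc (R f)"
      using Q by (simp add: act_dual_coef) (simp add: Q_def S_inv dual_coef_eq)
    then show ?thesis
      using mat_vec_lp[of "M Q" "dc f"] Q f by (simp add: coorbit_embed_cls lift_cls dual_coef_coefs)
  qed
  have syn: "has_dual_synthesis K \<psi> p w (mat_vec K (M R) (mat_vec K (M S) \<alpha>)) (lift Q (cls \<alpha>))"
    if \<alpha>: "\<alpha> \<in> coefs" for \<alpha>
  proof -
    have lp: "mat_vec K (M R) (mat_vec K (M S) \<alpha>) \<in> Lp"
      using R inA_frame_operator coefs_lp[OF \<alpha>] by (intro mat_vec_lp) auto
    have "mat_vec K (M (inv S)) (mat_vec K (M R) (mat_vec K (M S) \<alpha>)) = mat_vec K (M Q) \<alpha>"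
      unfolding Q_def
      by (simp only: act_comp[OF R inA_frame_operator coefs_lp[OF \<alpha>]]
          act_comp[OF I inA_comp[OF R inA_frame_operator] coefs_lp[OF \<alpha>]])
    then show ?thesis
      using has_dual_synthesis_cls[OF lp] by (simp add: lift_cls[OF \<alpha>])
  qed
  have "bounded_on_lp K p w (M S)" "bounded_on_lp K p w (M R)"
    using R inA_frame_operator by (auto intro: bounded_on_lp)
  then show ?thesis
    unfolding coorbit_extension_def Let_def Q_def[symmetric] op_matrix_frame_operator[symmetric]
    using lift_bounded_linear[OF Q] H00 syn
    by (auto simp: coorbit_eq coorbit_coef_cls coefs_lp)
qed

lemma lift_inverse:
  assumes "inA R" "inA T" "\<And>x. T (R x) = x" and X: "X \<in> coorbit K \<psi> p w"
  shows "lift T (lift R X) = X"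
proof -
  obtain \<alpha> where \<alpha>: "\<alpha> \<in> coefs" "X = cls \<alpha>"
    using X by (auto simp: coorbit_eq)
  have "lift T (lift R X) = cls (mat_vec K (M (\<lambda>x. T (R x))) \<alpha>)"
    using assms \<alpha>(1) by (simp only: \<alpha>(2) lift_cls act_coefs coefs_lp act_comp)
  \<comment> \<open>What remains is \<open>M(1)\<close>, a proper projection in general; it acts as
    the identity because \<open>\<alpha>\<close> lies in \<open>coefs\<close>.\<close>
  also have "\<dots> = X"
    using \<alpha> assms(3) by (simp add: coefs_def)
  finally show ?thesis .
qed

lemma invertible_on_coorbit:
  assumes R: "invertible_operator R" "M R \<in> \<A>"
  shows "invertible_on_coorbit K \<psi> p w R"
proof -
  have RA: "inA R" and RI: "inA (inv R)"
    using R inA_inv invertible_operatorD(1) by auto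
  note QA = inA_conjugate[OF RA] inA_conjugate[OF RI]
  let ?T = "lift (\<lambda>x. inv S (R (S x)))" and ?T' = "lift (\<lambda>x. inv S (inv R (S x)))"
  have inv: "?T' (?T X) = X" "?T (?T' X) = X" if "X \<in> coorbit K \<psi> p w" for X
    using lift_inverse[OF QA(1,2) _ that] lift_inverse[OF QA(2,1) _ that]
    by (simp_all add: S_inv invertible_operatorD[OF R(1)])
  have maps: "?T X \<in> coorbit K \<psi> p w" "?T' X \<in> coorbit K \<psi> p w" if "X \<in> coorbit K \<psi> p w" for X
    using lift_bounded_linear[OF QA(1)] lift_bounded_linear[OF QA(2)] that
    by (auto simp: coorbit_bounded_linear_def)
  have "bij_betw ?T (coorbit K \<psi> p w) (coorbit K \<psi> p w)"
    by (rule bij_betw_byWitness[where f' = ?T']) (auto simp: inv maps)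
  then show ?thesis
    unfolding invertible_on_coorbit_def
    using coorbit_extension_lift[OF RA] coorbit_extension_lift[OF RI] inv(1) by blast
qed

end

theorem theorem6:
  fixes K :: "(real ^ 'd) set"
    and \<A> :: "(real ^ 'd) cmat set" and N :: "(real ^ 'd) cmat \<Rightarrow> real"
    and \<psi> :: "real ^ 'd \<Rightarrow> 'h::complex_hilbert"
    and w :: "real ^ 'd \<Rightarrow> real"
    and U :: "'h \<Rightarrow> 'h"
  assumes "separable_space_UNIV TYPE('h)"
    and "countable K" and "separated_set K"
    and "solid_spectral_matrix_algebra K \<A> N"
    and "is_frame K \<psi>" and "localized K \<A> \<psi>"
    and "weight K w" and "admissible K \<A> w"
    and "bounded_clinear U" and "invertible_operator U"
    and "op_matrix K \<psi> (dual_frame K \<psi>) U \<in> \<A>"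
  shows "\<forall>p\<ge>1. invertible_on_coorbit K \<psi> p w U"
proof (intro allI impI)
  fix p :: ennreal assume p: "1 \<le> p"
  interpret solid_spectral_matrix_algebra K \<A> N
    by fact
  interpret coorbit_setting K \<A> N \<psi> p w
    by unfold_locales (use assms p in auto)
  show "invertible_on_coorbit K \<psi> p w U"
    using assms by (intro invertible_on_coorbit)
qed

end
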